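(* Let $(X,d)$ be a proper, roughly geodesic, strongly hyperbolic metric space with base point $o\in X$, and let $\Gamma$ be a non-elementary discrete group of isometries of $(X,d)$ acting cocompactly on $X$. Put $|\gamma|=d(o,\gamma o)$. Then there exists a constant $C>0$ such that for all $s\in[0,1]$ and all $\gamma\in\Gamma$, $$C^{-1}\Big(\omega_{|s-\frac12|}(|\gamma|)+1\Big)e^{-\frac12\alpha|\gamma|}\ \le\ \phi_s(\gamma)\ \le\ C\Big(\omega_{|s-\frac12|}(|\gamma|)+1\Big)e^{-\frac12\alpha|\gamma|}.$$
   Context: Gromov product: $(x,y)_o=\frac12(d(x,o)+d(y,o)-d(x,y))$. $(X,d)$ is strongly hyperbolic if for some $\epsilon>0$, $e^{-\epsilon(x,y)_o}\le e^{-\epsilon(x,z)_o}+e^{-\epsilon(z,y)_o}$ for all $x,y,z,o\in X$. It is then Gromov hyperbolic, the Gromov product extends continuously to $X\cup\partial X$ ($\partial X$ the Gromov boundary), and $d_o(\xi,\eta)=e^{-\epsilon(\xi,\eta)_o}$ is a metric on $\partial X$. Roughly geodesic: there is $C_X>0$ such that any $x,y\in X$ are joined by a map $r:[a,b]\to X$, $r(a)=x$, $r(b)=y$, with $|t-u|-C_X\le d(r(t),r(u))\le|t-u|+C_X$. A discrete group of isometries is one acting properly discontinuously. Volume growth: $\alpha=\limsup_{T\to\infty}\frac1T\log|\Gamma o\cap B_X(o,T)|$. Busemann function: $\beta_\xi(x,y)=2(\xi,y)_x-d(x,y)$ for $\xi\in\partial X$, $x,y\in X$. The Patterson–Sullivan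 measure $\nu_o$ is the Hausdorff measure of dimension $\alpha/\epsilon$ on $(\partial X,d_o)$ normalized to be a probability measure; it satisfies $\frac{d\gamma_*\nu_o}{d\nu_o}(\xi)=e^{\alpha\beta_\xi(o,\gamma o)}$. Spherical function, for $s\in\mathbb{R}$: $\phi_s(\gamma)=\int_{\partial X}\big(\frac{d\gamma_*\nu_o}{d\nu_o}\big)^s d\nu_o=\int_{\partial X}e^{s\alpha\beta_\xi(o,\gamma o)}d\nu_o(\xi)$. For $t\ge0$: $\omega_\sigma(t)=\frac{2\sinh(\sigma\alpha t)}{1-e^{-2\sigma\alpha}}$ if $\sigma\ne0$, and $\omega_0(t)=t$. *)

theory Defs
  imports "HOL-Analysis.Analysis" "HOL-Algebra.Bij"
begin

section \<open>Strongly hyperbolic spaces\<close>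

definition gromov_product :: "'a::metric_space \<Rightarrow> 'a \<Rightarrow> 'a \<Rightarrow> real" where
  "gromov_product p x y = (dist x p + dist y p - dist x y) / 2"

definition proper_metric :: "'a::metric_space itself \<Rightarrow> bool" where
  "proper_metric _ \<longleftrightarrow> (\<forall>(x::'a) r. compact (cball x r))"

definition roughly_geodesic :: "'a::metric_space itself \<Rightarrow> bool" where
  "roughly_geodesic _ \<longleftrightarrow>
     (\<exists>C>0. \<forall>x y::'a. \<exists>a b. \<exists>r :: real \<Rightarrow> 'a. a \<le> b \<and> r a = x \<and> r b = y \<and>
        (\<forall>t\<in>{a..b}. \<forall>u\<in>{a..b}.
           \<bar>t - u\<bar> - C \<le> dist (r t) (r u) \<and> dist (r t) (r u) \<le> \<bar>t - u\<bar> + C))"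

definition strongly_hyperbolic :: "'a::metric_space itself \<Rightarrow> real \<Rightarrow> bool" where
  "strongly_hyperbolic _ \<epsilon> \<longleftrightarrow> 0 < \<epsilon> \<and>
     (\<forall>x y z p :: 'a. exp (- \<epsilon> * gromov_product p x y)
        \<le> exp (- \<epsilon> * gromov_product p x z) + exp (- \<epsilon> * gromov_product p z y))"


section \<open>The Gromov boundary\<close>

definition converges_at_infinity :: "'a::metric_space \<Rightarrow> (nat \<Rightarrow> 'a) \<Rightarrow> bool" where
  "converges_at_infinity p u \<longleftrightarrow>
     filterlim (\<lambda>(m, n). gromov_product p (u m) (u n)) at_top (sequentially \<times>\<^sub>F sequentially)"

definition boundary_rel :: "'a::metric_space \<Rightarrow> (nat \<Rightarrow> 'a) rel" where
  "boundary_rel p = {(u, v). converges_at_infinity p u \<and> converges_at_infinity p v \<and>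
     filterlim (\<lambda>n. gromov_product p (u n) (v n)) at_top sequentially}"

text \<open>Boundary points are equivalence classes, i.e. a boundary point is the set of all sequences
  of points of the space that converge to it. The base point \<open>p\<close> only serves to
  express convergence; neither the relation nor the boundary depends on it.\<close>

definition gromov_boundary :: "'a::metric_space \<Rightarrow> (nat \<Rightarrow> 'a) set set" where
  "gromov_boundary p = {u. converges_at_infinity p u} // boundary_rel p"

text \<open>The continuous extension of the Gromov product to pairs of boundary points: the common limit
  along all sequences converging to the two points. It exists when the space is strongly
  hyperbolic, and equals \<open>\<infinity>\<close> exactly on the diagonal.\<close>

definition boundary_product ::
  "'a::metric_space \<Rightarrow> (nat \<Rightarrow> 'a) set \<Rightarrow> (nat \<Rightarrow> 'a) set \<Rightarrow> ereal" where
  "boundary_product p \<xi> \<eta> =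
     (THE l. \<forall>u\<in>\<xi>. \<forall>v\<in>\<eta>. (\<lambda>n. ereal (gromov_product p (u n) (v n))) \<longlonglongrightarrow> l)"

text \<open>\<open>exp (- \<epsilon> * boundary_product p \<xi> \<eta>)\<close>, with \<open>exp (- \<infinity>) = 0\<close>.\<close>

definition boundary_dist ::
  "real \<Rightarrow> 'a::metric_space \<Rightarrow> (nat \<Rightarrow> 'a) set \<Rightarrow> (nat \<Rightarrow> 'a) set \<Rightarrow> real" where
  "boundary_dist \<epsilon> p \<xi> \<eta> =
     (if boundary_product p \<xi> \<eta> = \<infinity> then 0
      else exp (- \<epsilon> * real_of_ereal (boundary_product p \<xi> \<eta>)))"


section \<open>Groups of isometries\<close>

definition isometry_group :: "('a::metric_space \<Rightarrow> 'a) set \<Rightarrow> bool" where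
  "isometry_group \<Gamma> \<longleftrightarrow> subgroup \<Gamma> (BijGroup UNIV) \<and>
     (\<forall>\<gamma>\<in>\<Gamma>. \<forall>x y. dist (\<gamma> x) (\<gamma> y) = dist x y)"

definition properly_discontinuous :: "('a::metric_space \<Rightarrow> 'a) set \<Rightarrow> bool" where
  "properly_discontinuous \<Gamma> \<longleftrightarrow> (\<forall>K. compact K \<longrightarrow> finite {\<gamma>\<in>\<Gamma>. \<gamma> ` K \<inter> K \<noteq> {}})"

definition cocompact :: "('a::metric_space \<Rightarrow> 'a) set \<Rightarrow> bool" where
  "cocompact \<Gamma> \<longleftrightarrow> (\<exists>K. compact K \<and> (\<Union>\<gamma>\<in>\<Gamma>. \<gamma> ` K) = UNIV)"

definition orbit_of :: "('a \<Rightarrow> 'a) set \<Rightarrow> 'a \<Rightarrow> 'a set" where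
  "orbit_of \<Gamma> p = (\<lambda>\<gamma>. \<gamma> p) ` \<Gamma>"

definition limit_set :: "('a::metric_space \<Rightarrow> 'a) set \<Rightarrow> 'a \<Rightarrow> (nat \<Rightarrow> 'a) set set" where
  "limit_set \<Gamma> p = {\<xi>\<in>gromov_boundary p. \<exists>u\<in>\<xi>. range u \<subseteq> orbit_of \<Gamma> p}"

text \<open>A group is elementary if its limit set has at most two points.\<close>

definition non_elementary :: "('a::metric_space \<Rightarrow> 'a) set \<Rightarrow> 'a \<Rightarrow> bool" where
  "non_elementary \<Gamma> p \<longleftrightarrow> \<not> (finite (limit_set \<Gamma> p) \<and> card (limit_set \<Gamma> p) \<le> 2)"

text \<open>For a properly discontinuous cocompact group on a proper roughly geodesic space, this upper
  limit is finite, so that \<open>real_of_ereal\<close> loses nothing.\<close>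

definition volume_growth :: "('a::metric_space \<Rightarrow> 'a) set \<Rightarrow> 'a \<Rightarrow> real" where
  "volume_growth \<Gamma> p = real_of_ereal
     (Limsup at_top (\<lambda>T::real. ereal (ln (real (card (orbit_of \<Gamma> p \<inter> ball p T))) / T)))"


section \<open>Hausdorff measures\<close>

definition ediam :: "('b \<Rightarrow> 'b \<Rightarrow> real) \<Rightarrow> 'b set \<Rightarrow> ennreal" where
  "ediam d U = (SUP x\<in>U. SUP y\<in>U. ennreal (d x y))"

text \<open>\<open>diam(U)\<close> to the power \<open>s\<close>, with the convention that \<open>diam(U)\<close> to the power \<open>0\<close> is \<open>1\<close> for
  nonempty \<open>U\<close>. It is only applied to sets of finite diameter.\<close>

definition hausdorff_gauge :: "('b \<Rightarrow> 'b \<Rightarrow> real) \<Rightarrow> real \<Rightarrow> 'b set \<Rightarrow> ennreal" where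
  "hausdorff_gauge d s U =
     (if U = {} then 0 else if s = 0 then 1 else ennreal (enn2real (ediam d U) powr s))"

definition hausdorff_premeasure ::
  "'b set \<Rightarrow> ('b \<Rightarrow> 'b \<Rightarrow> real) \<Rightarrow> real \<Rightarrow> real \<Rightarrow> 'b set \<Rightarrow> ennreal" where
  "hausdorff_premeasure M d s \<delta> A =
     (INF U\<in>{U :: nat \<Rightarrow> 'b set. A \<subseteq> (\<Union>n. U n) \<and> (\<forall>n. U n \<subseteq> M \<and> ediam d (U n) \<le> ennreal \<delta>)}.
        \<Sum>n. hausdorff_gauge d s (U n))"

definition hausdorff_outer_measure ::
  "'b set \<Rightarrow> ('b \<Rightarrow> 'b \<Rightarrow> real) \<Rightarrow> real \<Rightarrow> 'b set \<Rightarrow> ennreal" where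
  "hausdorff_outer_measure M d s A = (SUP \<delta>\<in>{0<..}. hausdorff_premeasure M d s \<delta> A)"

text \<open>The restriction of the outer measure to the Borel sets of the metric space \<open>(M, d)\<close>,
  normalized to have total mass \<open>1\<close>. The outer measure is a metric outer measure, hence countably
  additive on Borel sets, as \<open>measure_of\<close> requires.\<close>

definition normalized_hausdorff_measure ::
  "'b set \<Rightarrow> ('b \<Rightarrow> 'b \<Rightarrow> real) \<Rightarrow> real \<Rightarrow> 'b measure" where
  "normalized_hausdorff_measure M d s =
     measure_of M {U. openin (Metric_space.mtopology M d) U}
       (\<lambda>A. hausdorff_outer_measure M d s A / hausdorff_outer_measure M d s M)"


section \<open>Patterson-Sullivan measure and spherical functions\<close>

definition patterson_sullivan ::
  "real \<Rightarrow> ('a::metric_space \<Rightarrow> 'a) set \<Rightarrow> 'a \<Rightarrow> (nat \<Rightarrow> 'a) set measure" where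
  "patterson_sullivan \<epsilon> \<Gamma> p =
     normalized_hausdorff_measure (gromov_boundary p) (boundary_dist \<epsilon> p) (volume_growth \<Gamma> p / \<epsilon>)"

definition boundary_action :: "('a \<Rightarrow> 'a) \<Rightarrow> (nat \<Rightarrow> 'a) set \<Rightarrow> (nat \<Rightarrow> 'a) set" where
  "boundary_action \<gamma> \<xi> = (\<lambda>u. \<gamma> \<circ> u) ` \<xi>"

text \<open>\<open>RN_deriv \<nu> (distr \<nu> \<nu> (boundary_action \<gamma>))\<close> is the density of the image measure of
  \<open>\<nu>\<close> under \<open>\<gamma>\<close> with respect to \<open>\<nu>\<close>; it is almost everywhere positive and finite.\<close>

definition spherical_function ::
  "real \<Rightarrow> ('a::metric_space \<Rightarrow> 'a) set \<Rightarrow> 'a \<Rightarrow> real \<Rightarrow> ('a \<Rightarrow> 'a) \<Rightarrow> real" where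
  "spherical_function \<epsilon> \<Gamma> p s \<gamma> =
     (let \<nu> = patterson_sullivan \<epsilon> \<Gamma> p
      in \<integral>\<xi>. enn2real (RN_deriv \<nu> (distr \<nu> \<nu> (boundary_action \<gamma>)) \<xi>) powr s \<partial>\<nu>)"

definition omega :: "real \<Rightarrow> real \<Rightarrow> real \<Rightarrow> real" where
  "omega \<alpha> \<sigma> t = (if \<sigma> = 0 then t else 2 * sinh (\<sigma> * \<alpha> * t) / (1 - exp (- 2 * \<sigma> * \<alpha>)))"

end

theory Submission
  imports Defs "HOL-Real_Asymp.Real_Asymp"
begin

text \<open>Write \<open>V\<^sub>\<gamma>(\<xi>) = exp (- \<epsilon> (\<xi>, \<gamma>p)\<^sub>p)\<close> and \<open>w(\<gamma>) = exp (- \<epsilon> |\<gamma>|)\<close>. Strong hyperbolicity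
  makes the action exactly conformal,
  \<open>d(\<gamma>\<inverse>\<xi>, \<gamma>\<inverse>\<eta>) V\<^sub>\<gamma>(\<xi>) V\<^sub>\<gamma>(\<eta>) = w(\<gamma>) d(\<xi>, \<eta>)\<close>, so Hausdorff measure of dimension
  \<open>s = \<alpha>/\<epsilon>\<close> is transformed with density \<open>(w/V\<^sup>2)\<^sup>s\<close>. By cocompactness every ball of the
  boundary can be blown up to unit size, and contains a copy of the boundary minus a small set.
  This self-similarity replaces the Patterson construction: the growth rate \<open>\<alpha>\<close> fixes the exponential
  rate of the separation numbers of the boundary; sub- and supermultiplicativity of these numbers
  then give \<open>0 < H\<^sup>s < \<infinity>\<close>, and, transported by the group, that a ball of radius \<open>r\<close> has mass
  comparable with \<open>r\<^sup>s\<close>. Hence \<open>{(\<xi>, \<gamma>p)\<^sub>p \<ge> t}\<close> has mass comparable with \<open>exp (- \<alpha> t)\<close> for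
  \<open>0 \<le> t \<le> |\<gamma>|\<close>, up to an additive constant in \<open>t\<close>, and the spherical function is computed by
  integrating over the superlevel sets of \<open>(\<xi>, \<gamma>p)\<^sub>p\<close>.\<close>

section \<open>Hausdorff measure\<close>

text \<open>The growth rate is only an upper limit and carries no subexponential information, while
  bounds up to a constant are wanted. Self-similarity upgrades it, because a strict inequality at
  one scale iterates to a strict inequality between exponents: a cover whose \<open>s\<close>-sum is
  too small would work for some exponent below \<open>s\<close> as well and bound the growth by it,
  and too many separated points at one scale would branch into growth faster than \<open>s\<close>.
  The obstacle to branching is the exceptional set \<open>Z\<close>, whose position is not
  controlled; it is met by demanding many points outside every small set.

  The change of behaviour at 1/2 has a simple origin. On the set where the Gromov product with
  \<open>\<gamma>p\<close> is about \<open>t\<close>, of mass about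
  \<open>exp (- \<alpha> * t)\<close>, the density to the power \<sigma> is \<open>exp (- \<sigma> *
  \<alpha> * |\<gamma>|) * exp (2 * \<sigma> * \<alpha> * t)\<close>, so the integrand in
  \<open>t\<close> has exponent \<open>(2 * \<sigma> - 1) * \<alpha>\<close>, which changes sign
  there.\<close>

locale hausdorff_space = Metric_space M d for M :: "'b set" and d +
  fixes s :: real
  assumes s_pos: "0 < s"
begin

abbreviation pre :: "real \<Rightarrow> 'b set \<Rightarrow> ennreal" where "pre \<equiv> hausdorff_premeasure M d s"
abbreviation H :: "'b set \<Rightarrow> ennreal" where "H \<equiv> hausdorff_outer_measure M d s"
abbreviation gauge :: "'b set \<Rightarrow> ennreal" where "gauge \<equiv> hausdorff_gauge d s"

lemma ediam_le_iff: "0 \<le> r \<Longrightarrow> ediam d U \<le> ennreal r \<longleftrightarrow> (\<forall>x\<in>U. \<forall>y\<in>U. d x y \<le> r)"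
  by (auto simp: ediam_def SUP_le_iff)

text \<open>For positive \<open>s\<close> the case of the empty set is absorbed, since
  \<open>0 powr s\<close> is 0.\<close>

lemma gauge_eq: "gauge U = ennreal (enn2real (ediam d U) powr s)"
  using s_pos by (simp add: hausdorff_gauge_def ediam_def bot_ennreal)

lemma gauge_empty [simp]: "gauge {} = 0"
  by (simp add: hausdorff_gauge_def)

lemma gauge_le:
  assumes "0 \<le> r" "\<And>x y. x \<in> U \<Longrightarrow> y \<in> U \<Longrightarrow> d x y \<le> r"
  shows "gauge U \<le> ennreal (r powr s)"
proof -
  have "ediam d U \<le> ennreal r"
    using assms by (simp add: ediam_le_iff)
  then have "enn2real (ediam d U) \<le> r"
    using assms(1) by (simp add: enn2real_leI)
  then show ?thesis
    using s_pos by (auto simp: gauge_eq intro!: ennreal_leI powr_mono2)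
qed

text \<open>The bound \<open>r\<close> makes the diameter finite; \<open>enn2real\<close> would send
  an infinite one to 0.\<close>

lemma dist_le_ediam:
  assumes "ediam d U \<le> ennreal r" "x \<in> U" "y \<in> U"
  shows "d x y \<le> enn2real (ediam d U)"
proof -
  have "ennreal (d x y) \<le> ediam d U"
    unfolding ediam_def using assms by (meson SUP_upper2 order_refl)
  moreover have "ediam d U = ennreal (enn2real (ediam d U))"
    using le_less_trans[OF assms(1) ennreal_less_top] by simp
  ultimately show ?thesis
    by (metis ennreal_le_iff enn2real_nonneg)
qed

lemma pre_le:
  assumes "A \<subseteq> (\<Union>n. U n)" "\<And>n. U n \<subseteq> M" "\<And>n. ediam d (U n) \<le> ennreal \<delta>"
  shows "pre \<delta> A \<le> (\<Sum>n. gauge (U n))"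
  unfolding hausdorff_premeasure_def using assms by (intro INF_lower) auto

lemma pre_less:
  assumes "pre \<delta> A < e"
  obtains U where "A \<subseteq> (\<Union>n. U n)" "\<And>n. U n \<subseteq> M" "\<And>n. ediam d (U n) \<le> ennreal \<delta>"
    "(\<Sum>n. gauge (U n)) < e"
  using assms unfolding hausdorff_premeasure_def INF_less_iff by auto

lemma pre_mono: "A \<subseteq> B \<Longrightarrow> pre \<delta> A \<le> pre \<delta> B"
  unfolding hausdorff_premeasure_def by (intro INF_superset_mono) auto

lemma pre_antimono: "\<delta> \<le> \<delta>' \<Longrightarrow> pre \<delta>' A \<le> pre \<delta> A"
  unfolding hausdorff_premeasure_def
  by (intro INF_superset_mono) (auto intro: order_trans ennreal_leI)

lemma pre_empty [simp]: "pre \<delta> {} = 0"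
  using pre_le[of "{}" "\<lambda>_. {}" \<delta>] by (auto simp: ediam_def bot_ennreal)

lemma pre_UN: "pre \<delta> (\<Union>i. A i) \<le> (\<Sum>i::nat. pre \<delta> (A i))"
proof (rule ennreal_le_epsilon)
  fix e :: real
  assume "0 < e" "(\<Sum>n. pre \<delta> (A n)) < top_class.top"
  then have *: "\<And>n. pre \<delta> (A n) < pre \<delta> (A n) + e * (1/2)^Suc n"
    by (auto simp add: less_top dest!: ennreal_suminf_lessD)
  have "\<forall>n. \<exists>U. A n \<subseteq> (\<Union>i. U i) \<and> (\<forall>i. U i \<subseteq> M) \<and> (\<forall>i. ediam d (U i) \<le> ennreal \<delta>)
      \<and> (\<Sum>i. gauge (U i)) \<le> pre \<delta> (A n) + e * (1/2)^Suc n"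
    using pre_less[OF *] by (metis less_imp_le)
  then obtain B where B: "\<And>n. A n \<subseteq> (\<Union>i. B n i)" "\<And>n i. B n i \<subseteq> M"
      "\<And>n i. ediam d (B n i) \<le> ennreal \<delta>" "\<And>n. (\<Sum>i. gauge (B n i)) \<le> pre \<delta> (A n) + e * (1/2)^Suc n"
    by metis
  \<comment> \<open>\<open>prod_decode\<close> lists the doubly indexed near-optimal covers as one
    sequence; their errors \<open>e / 2 ^ (n + 1)\<close> add up to \<open>e\<close>.\<close>
  define C where "C = case_prod B \<circ> prod_decode"
  have "(\<Union>i. A i) \<subseteq> (\<Union>i. C i)"
    using B(1) by (auto simp add: C_def subset_eq) (metis prod.case prod_encode_inverse)
  then have "pre \<delta> (\<Union>i. A i) \<le> (\<Sum>i. gauge (C i))"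
    by (rule pre_le) (auto simp: C_def split_def B(2,3) subsetD[OF B(2)])
  also have "\<dots> = (\<Sum>n. \<Sum>i. gauge (B n i))"
    unfolding C_def comp_def by (intro suminf_ennreal_2dimen) auto
  also have "\<dots> \<le> (\<Sum>n. pre \<delta> (A n) + e * (1/2) ^ Suc n)"
    by (intro suminf_le allI B(4)) auto
  also have "\<dots> = (\<Sum>n. pre \<delta> (A n)) + (\<Sum>n. ennreal e * ennreal ((1/2) ^ Suc n))"
    using \<open>0 < e\<close> by (subst suminf_add[symmetric])
                     (auto simp del: ennreal_suminf_cmult simp add: ennreal_mult[symmetric])
  also have "\<dots> = (\<Sum>n. pre \<delta> (A n)) + e"
    unfolding ennreal_suminf_cmult
    by (subst suminf_ennreal_eq[OF zero_le_power power_half_series]) auto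
  finally show "pre \<delta> (\<Union>i. A i) \<le> (\<Sum>n. pre \<delta> (A n)) + e" .
qed

lemma pre_le_H: "0 < \<delta> \<Longrightarrow> pre \<delta> A \<le> H A"
  unfolding hausdorff_outer_measure_def by (intro SUP_upper) auto

lemma H_leI: "(\<And>\<delta>. 0 < \<delta> \<Longrightarrow> pre \<delta> A \<le> c) \<Longrightarrow> H A \<le> c"
  unfolding hausdorff_outer_measure_def by (intro SUP_least) auto

lemma H_mono: "A \<subseteq> B \<Longrightarrow> H A \<le> H B"
  using pre_mono pre_le_H by (intro H_leI) (meson order_trans)

lemma H_empty [simp]: "H {} = 0"
  using H_leI[of "{}" 0] by simp

lemma H_UN: "H (\<Union>i. A i) \<le> (\<Sum>i::nat. H (A i))"
  by (rule H_leI) (auto intro!: order_trans[OF pre_UN] suminf_le pre_le_H)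

lemma H_Un: "H (A \<union> B) \<le> H A + H B"
proof -
  have "A \<union> B = (\<Union>i::nat. if i = 0 then A else if i = 1 then B else {})"
    by (auto split: if_splits)
  also have "H \<dots> \<le> (\<Sum>i::nat. H (if i = 0 then A else if i = 1 then B else {}))"
    by (rule H_UN)
  also have "\<dots> = (\<Sum>i\<in>{0,1}. H (if i = (0::nat) then A else if i = 1 then B else {}))"
    by (rule suminf_finite) auto
  finally show ?thesis
    by simp
qed

text \<open>No set of diameter at most \<open>\<delta>\<close> can meet both \<open>A\<close> and
  \<open>B\<close>, so a cover of the union splits into disjoint subfamilies covering the two
  parts.\<close>

lemma pre_separated:
  assumes r: "\<delta> < r" "0 < \<delta>" "\<And>x y. x \<in> A \<Longrightarrow> y \<in> B \<Longrightarrow> r \<le> d x y"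
  shows "pre \<delta> A + pre \<delta> B \<le> pre \<delta> (A \<union> B)"
proof (rule ennreal_le_epsilon)
  fix e :: real
  assume "0 < e" "pre \<delta> (A \<union> B) < top_class.top"
  then have "pre \<delta> (A \<union> B) < pre \<delta> (A \<union> B) + ennreal e"
    by auto
  then obtain U where U: "A \<union> B \<subseteq> (\<Union>n. U n)" "\<And>n. U n \<subseteq> M" "\<And>n. ediam d (U n) \<le> ennreal \<delta>"
    "(\<Sum>n. gauge (U n)) < pre \<delta> (A \<union> B) + ennreal e"
    using pre_less by metis
  define part where "part X n = (if U n \<inter> X = {} then {} else U n)" for X n
  have "pre \<delta> X \<le> (\<Sum>n. gauge (part X n))" if "X \<subseteq> A \<union> B" for X
  proof (rule pre_le)
    show "X \<subseteq> (\<Union>n. part X n)"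
    proof
      fix x
      assume x: "x \<in> X"
      then obtain n where "x \<in> U n"
        using U(1) \<open>X \<subseteq> A \<union> B\<close> by blast
      then show "x \<in> (\<Union>n. part X n)"
        using x by (intro UN_I[of n]) (auto simp: part_def)
    qed
  qed (use U(2,3) in \<open>auto simp: part_def ediam_def bot_ennreal\<close>)
  then have "pre \<delta> A + pre \<delta> B \<le> (\<Sum>n. gauge (part A n)) + (\<Sum>n. gauge (part B n))"
    by (intro add_mono) auto
  also have "\<dots> = (\<Sum>n. gauge (part A n) + gauge (part B n))"
    by (rule suminf_add) auto
  also have "\<dots> \<le> (\<Sum>n. gauge (U n))"
  proof (intro suminf_le)
    fix n
    have "U n \<inter> A = {} \<or> U n \<inter> B = {}"
    proof (rule ccontr)
      assume "\<not> ?thesis"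
      then obtain x y where "x \<in> U n" "x \<in> A" "y \<in> U n" "y \<in> B"
        by blast
      moreover have "d x y \<le> \<delta>" if "x \<in> U n" "y \<in> U n" for x y
        using U(3)[of n] that r(2) by (simp add: ediam_le_iff)
      ultimately show False
        using r(1,3) by (meson le_less_trans not_le)
    qed
    then show "gauge (part A n) + gauge (part B n) \<le> gauge (U n)"
      by (auto simp: part_def)
  qed auto
  finally show "pre \<delta> A + pre \<delta> B \<le> pre \<delta> (A \<union> B) + ennreal e"
    using U(4) by (meson less_imp_le order_trans)
qed

lemma H_separated:
  assumes r: "0 < r" "\<And>x y. x \<in> A \<Longrightarrow> y \<in> B \<Longrightarrow> r \<le> d x y"
  shows "H A + H B \<le> H (A \<union> B)"
proof -
  have *: "pre \<delta>1 A + pre \<delta>2 B \<le> H (A \<union> B)" if "0 < \<delta>1" "0 < \<delta>2" for \<delta>1 \<delta>2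
  proof -
    \<comment> \<open>The two suprema in \<open>H A + H B\<close> are taken independently, so both
      scales are lowered to a common one below the gap \<open>r\<close>.\<close>
    define \<delta> where "\<delta> = Min {\<delta>1, \<delta>2, r / 2}"
    have \<delta>: "0 < \<delta>" "\<delta> \<le> \<delta>1" "\<delta> \<le> \<delta>2" "\<delta> < r"
      using that r(1) by (auto simp: \<delta>_def min_def)
    have "pre \<delta>1 A + pre \<delta>2 B \<le> pre \<delta> A + pre \<delta> B"
      using \<delta> by (intro add_mono pre_antimono) auto
    also have "\<dots> \<le> pre \<delta> (A \<union> B)"
      using \<delta> r(2) by (intro pre_separated[of \<delta> r]) auto
    also have "\<dots> \<le> H (A \<union> B)"
      using \<delta> by (intro pre_le_H)
    finally show ?thesis .
  qed
  have ne: "{0::real<..} \<noteq> {}"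
    by (simp add: ex_gt_or_lt gt_ex)
  have "H A + pre \<delta>2 B \<le> H (A \<union> B)" if "0 < \<delta>2" for \<delta>2
    unfolding hausdorff_outer_measure_def[of M d s A] ennreal_SUP_add_left[OF ne, symmetric]
    using *[OF _ that] by (auto intro!: SUP_least)
  then have "(SUP \<delta>\<in>{0<..}. H A + pre \<delta> B) \<le> H (A \<union> B)"
    by (intro SUP_least) auto
  then show ?thesis
    unfolding ennreal_SUP_add_right[OF ne, symmetric] hausdorff_outer_measure_def[of M d s B] .
qed

text \<open>Splitting the open set into the layers between the superlevel sets
  \<open>{dist(x, M - U) \<ge> 1 / (n + 1)}\<close>, the layers of equal parity are pairwise separated, so
  their total mass is bounded by that of \<open>A\<close>, and the mass of the layers near the complement
  tends to zero.\<close>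

lemma H_open_split:
  assumes U: "openin mtopology U" and A: "A \<subseteq> M" and fin: "H A < top_class.top"
  shows "H (A \<inter> U) + H (A - U) \<le> H A"
proof -
  define An where "An n = {x \<in> A \<inter> U. \<forall>y\<in>M - U. inverse (real (Suc n)) \<le> d x y}" for n
  define R where "R n = An (Suc n) - An n" for n
  have An_mono: "An n \<subseteq> An m" if "n \<le> m" for n m
  proof -
    have "inverse (real (Suc m)) \<le> inverse (real (Suc n))"
      using that by (intro le_imp_inverse_le) auto
    note le = order_trans[OF this]
    show ?thesis
      unfolding An_def using le by (auto simp del: of_nat_Suc)
  qed
  have An_A: "An n \<subseteq> A" "An n \<subseteq> U" for n
    by (auto simp: An_def)
  \<comment> \<open>A point of \<open>R k\<close> fails to lie in \<open>An k\<close>, so some point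
    outside \<open>U\<close> is within \<open>1 / (k + 1)\<close> of it; for \<open>n < k\<close>
    this keeps it a positive distance away from \<open>An n\<close>.\<close>
  have gap: "inverse (real (Suc n)) - inverse (real (Suc k)) \<le> d x z"
    if x: "x \<in> An n" and z: "z \<in> R k" for n k x z
  proof -
    obtain y where y: "y \<in> M - U" "d z y < inverse (real (Suc k))"
      using z unfolding R_def An_def by auto
    have "inverse (real (Suc n)) \<le> d x y"
      using x y unfolding An_def by auto
    also have "\<dots> \<le> d x z + d z y"
      using x y z A unfolding R_def An_def by (intro triangle) auto
    finally show ?thesis
      using y(2) by simp
  qed
  have An_UN: "A \<inter> U = An n \<union> (\<Union>k. R (k + n))" for n
  proof
    show "A \<inter> U \<subseteq> An n \<union> (\<Union>k. R (k + n))"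
    proof
      fix x
      assume x: "x \<in> A \<inter> U"
      then obtain r where r: "0 < r" "mball x r \<subseteq> U"
        using U unfolding openin_mtopology by blast
      obtain m where m: "inverse (real (Suc m)) < r"
        using reals_Archimedean[OF r(1)] by blast
      have "x \<in> An m"
        unfolding An_def
      proof (safe)
        fix y
        assume y: "y \<in> M" "y \<notin> U"
        then have "y \<notin> mball x r"
          using r by blast
        then show "inverse (real (Suc m)) \<le> d x y"
          using m y x A by (auto simp: in_mball)
      qed (use x in auto)
      then have ex: "\<exists>m. x \<in> An m"
        by blast
      define l where "l = (LEAST m. x \<in> An m)"
      have l: "x \<in> An l" "\<And>m. m < l \<Longrightarrow> x \<notin> An m"
        unfolding l_def by (rule LeastI_ex[OF ex]) (rule not_less_Least)
      show "x \<in> An n \<union> (\<Union>k. R (k + n))"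
      proof (cases "l \<le> n")
        case True
        then show ?thesis
          using l(1) An_mono by blast
      next
        case False
        then obtain k where k: "l = Suc (k + n)"
          by (metis add.commute less_imp_Suc_add not_le)
        then have "x \<in> R (k + n)"
          using l(1) l(2)[of "k + n"] by (auto simp: R_def)
        then show ?thesis
          by blast
      qed
    qed
  qed (auto simp: R_def An_def)
  have layers: "(\<Sum>k<n. H (R (2 * k + i))) \<le> H (\<Union>k<n. R (2 * k + i))" for n i
  proof (induction n)
    case (Suc n)
    \<comment> \<open>One whole layer is skipped between the earlier layers of this parity and the
      next one, which leaves a positive gap.\<close>
    have sub: "(\<Union>k<n. R (2 * k + i)) \<subseteq> An (2 * n + i - 1)"
    proof safe
      fix x k
      assume k: "k < n" and "x \<in> R (2 * k + i)"
      then have "x \<in> An (Suc (2 * k + i))"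
        by (simp add: R_def)
      moreover have "Suc (2 * k + i) \<le> 2 * n + i - 1"
        using k by linarith
      ultimately show "x \<in> An (2 * n + i - 1)"
        using An_mono by blast
    qed
    show ?case
    proof (cases "2 * n + i = 0")
      case True
      then show ?thesis
        by (simp add: lessThan_Suc)
    next
      case False
      define k where "k = 2 * n + i"
      have k: "k - 1 < k"
        using False by (simp add: k_def)
      have "H (\<Union>k<n. R (2 * k + i)) + H (R k) \<le> H ((\<Union>k<n. R (2 * k + i)) \<union> R k)"
      proof (rule H_separated[of "inverse (real (Suc (k - 1))) - inverse (real (Suc k))"])
        show "0 < inverse (real (Suc (k - 1))) - inverse (real (Suc k))"
          using less_imp_inverse_less[of "real (Suc (k - 1))" "real (Suc k)"] k by simp
        show "inverse (real (Suc (k - 1))) - inverse (real (Suc k)) \<le> d x z"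
          if "x \<in> (\<Union>k<n. R (2 * k + i))" "z \<in> R k" for x z
          using that sub by (intro gap) (auto simp: k_def)
      qed
      also have "(\<Union>k<n. R (2 * k + i)) \<union> R k = (\<Union>k<Suc n. R (2 * k + i))"
        by (auto simp: k_def lessThan_Suc)
      finally show ?thesis
        using Suc by (simp add: k_def) (meson add_right_mono order_trans)
    qed
  qed simp
  have half: "(\<Sum>k. H (R (2 * k + i))) \<le> H A" for i
    unfolding suminf_eq_SUP
    by (intro SUP_least order_trans[OF layers] H_mono) (auto simp: R_def An_def)
  define S where "S = (\<Sum>k. H (R k))"
  have partial: "(\<Sum>k<n. H (R k)) \<le> H A + H A" for n
  proof -
    have "(\<Sum>k<n. H (R k)) \<le> (\<Sum>k<2 * n. H (R k))"
      by (intro sum_mono2) auto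
    also have "\<dots> = (\<Sum>k<n. H (R (2 * k + 0))) + (\<Sum>k<n. H (R (2 * k + 1)))"
      by (induction n) (auto simp: algebra_simps)
    also have "\<dots> \<le> (\<Sum>k. H (R (2 * k + 0))) + (\<Sum>k. H (R (2 * k + 1)))"
      by (intro add_mono sum_le_suminf) auto
    also have "\<dots> \<le> H A + H A"
      by (intro add_mono half)
    finally show ?thesis .
  qed
  have "S \<le> H A + H A"
    unfolding S_def suminf_eq_SUP by (intro SUP_least partial)
  also have "\<dots> < top_class.top"
    using fin by simp
  finally have S: "S < top_class.top" .
  \<comment> \<open>The partial sums are added on both sides, so no subtraction in
    \<open>ennreal\<close> occurs; the supremum over \<open>n\<close> adds the finite sum
    \<open>S\<close>, which then cancels.\<close>
  have main: "H (A \<inter> U) + H (A - U) + (\<Sum>k<n. H (R k)) \<le> H A + S" for n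
  proof -
    have "H (A \<inter> U) \<le> H (An n) + H (\<Union>k. R (k + n))"
      by (subst An_UN[of n]) (rule H_Un)
    also have "\<dots> \<le> H (An n) + (\<Sum>k. H (R (k + n)))"
      by (intro add_left_mono H_UN)
    finally have 1: "H (A \<inter> U) \<le> H (An n) + (\<Sum>k. H (R (k + n)))" .
    have 2: "H (An n) + H (A - U) \<le> H A"
    proof -
      have "H (An n) + H (A - U) \<le> H (An n \<union> (A - U))"
        using A by (intro H_separated[of "inverse (real (Suc n))"]) (auto simp: An_def)
      also have "\<dots> \<le> H A"
        using An_A by (intro H_mono) auto
      finally show ?thesis .
    qed
    have 3: "(\<Sum>k. H (R (k + n))) + (\<Sum>k<n. H (R k)) = S"
      unfolding S_def by (rule suminf_offset[symmetric, THEN trans, rotated]) (auto simp: add.commute)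
    have "H (A \<inter> U) + H (A - U) + (\<Sum>k<n. H (R k))
        \<le> (H (An n) + (\<Sum>k. H (R (k + n)))) + H (A - U) + (\<Sum>k<n. H (R k))"
      using 1 by (intro add_right_mono)
    also have "\<dots> = (H (An n) + H (A - U)) + ((\<Sum>k. H (R (k + n))) + (\<Sum>k<n. H (R k)))"
      by (simp add: ac_simps)
    also have "\<dots> \<le> H A + S"
      unfolding 3 using 2 by (intro add_right_mono)
    finally show ?thesis .
  qed
  have "H (A \<inter> U) + H (A - U) + S = (SUP n. H (A \<inter> U) + H (A - U) + (\<Sum>k<n. H (R k)))"
    unfolding S_def suminf_eq_SUP by (rule ennreal_SUP_add_right) simp
  also have "\<dots> \<le> H A + S"
    by (intro SUP_least main)
  finally have "S + (H (A \<inter> U) + H (A - U)) \<le> S + H A"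
    by (simp only: add.commute)
  then show ?thesis
    using S by (auto simp: ennreal_add_left_cancel_le)
qed

section \<open>Borel sets and Caratheodory's construction\<close>

abbreviation borel_sets :: "'b set set" where
  "borel_sets \<equiv> sigma_sets M {U. openin mtopology U}"

text \<open>Open sets satisfy Caratheodory's splitting condition by \<open>H_open_split\<close>;
  finite total mass makes every test set finite, as that lemma asks.\<close>

lemma H_measure_space:
  assumes "H M < top_class.top"
  shows "measure_space M borel_sets H"
proof -
  interpret P: sigma_algebra M "Pow M"
    by (rule sigma_algebra_Pow)
  have oms: "outer_measure_space (Pow M) H"
    unfolding outer_measure_space_def positive_def increasing_def countably_subadditive_def
    using H_mono H_UN by auto
  have L: "measure_space M (lambda_system M (Pow M) H) H"
    by (rule P.caratheodory_lemma[OF oms])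
  then have sa: "sigma_algebra M (lambda_system M (Pow M) H)"
    by (simp add: measure_space_def)
  have "{U. openin mtopology U} \<subseteq> lambda_system M (Pow M) H"
  proof safe
    fix U
    assume U: "openin mtopology U"
    then have UM: "U \<subseteq> M"
      by (simp add: openin_mtopology)
    have "H (U \<inter> x) + H ((M - U) \<inter> x) = H x" if x: "x \<subseteq> M" for x
    proof (rule antisym)
      have "H x < top_class.top"
        using H_mono[OF x] assms by (rule le_less_trans)
      moreover have "U \<inter> x = x \<inter> U" "(M - U) \<inter> x = x - U"
        using x by auto
      ultimately show "H (U \<inter> x) + H ((M - U) \<inter> x) \<le> H x"
        using H_open_split[OF U x] by simp
      have "x = (U \<inter> x) \<union> ((M - U) \<inter> x)"
        using x by auto
      then show "H x \<le> H (U \<inter> x) + H ((M - U) \<inter> x)"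
        using H_Un by metis
    qed
    then show "U \<in> lambda_system M (Pow M) H"
      using UM by (auto simp: lambda_system_def)
  qed
  then have "borel_sets \<subseteq> lambda_system M (Pow M) H"
    by (rule sigma_algebra.sigma_sets_subset[OF sa])
  moreover have "sigma_algebra M borel_sets"
    by (rule sigma_algebra_sigma_sets) (auto simp: openin_mtopology)
  ultimately show ?thesis
    using measure_down[OF L] by blast
qed

lemma H_lipschitz:
  assumes K: "0 < K" and f: "f ` A \<subseteq> M" and L: "\<And>x y. x \<in> A \<Longrightarrow> y \<in> A \<Longrightarrow> d (f x) (f y) \<le> K * d x y"
  shows "H (f ` A) \<le> ennreal (K powr s) * H A"
proof (rule H_leI)
  fix \<delta> :: real
  assume \<delta>: "0 < \<delta>"
  show "pre \<delta> (f ` A) \<le> ennreal (K powr s) * H A"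
  proof -
    have "pre \<delta> (f ` A) \<le> ennreal (K powr s) * (\<Sum>n. gauge (U n))"
      if U: "A \<subseteq> (\<Union>n. U n)" "\<And>n. U n \<subseteq> M" "\<And>n. ediam d (U n) \<le> ennreal (\<delta> / K)" for U
    proof -
      have dist_le: "d (f x) (f y) \<le> K * enn2real (ediam d (U n))" if "x \<in> U n \<inter> A" "y \<in> U n \<inter> A" for n x y
      proof -
        have "d (f x) (f y) \<le> K * d x y"
          using L that by auto
        also have "\<dots> \<le> K * enn2real (ediam d (U n))"
          using K dist_le_ediam[OF U(3)] that by (intro mult_left_mono) auto
        finally show ?thesis .
      qed
      have "enn2real (ediam d (U n)) \<le> \<delta> / K" for n
        using U(3)[of n] \<delta> K by (simp add: enn2real_leI)
      then have small: "K * enn2real (ediam d (U n)) \<le> \<delta>" for n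
        using K by (simp add: field_simps)
      \<comment> \<open>The cover sets are cut down to \<open>A\<close> before being mapped, since
        \<open>f\<close> is controlled there only.\<close>
      have "pre \<delta> (f ` A) \<le> (\<Sum>n. gauge (f ` (U n \<inter> A)))"
      proof (rule pre_le)
        show "f ` A \<subseteq> (\<Union>n. f ` (U n \<inter> A))"
          unfolding image_UN[symmetric] using U(1) by (intro image_mono) auto
        show "f ` (U n \<inter> A) \<subseteq> M" for n
          using f by blast
        show "ediam d (f ` (U n \<inter> A)) \<le> ennreal \<delta>" for n
          unfolding ediam_le_iff[OF less_imp_le[OF \<delta>]]
          by (auto intro!: order_trans[OF dist_le small])
      qed
      also have "\<dots> \<le> (\<Sum>n. ennreal (K powr s) * gauge (U n))"
      proof (intro suminf_le)
        fix n
        have "gauge (f ` (U n \<inter> A)) \<le> ennreal ((K * enn2real (ediam d (U n))) powr s)"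
          using K dist_le by (intro gauge_le) auto
        also have "\<dots> = ennreal (K powr s) * gauge (U n)"
          using K by (simp add: gauge_eq powr_mult ennreal_mult)
        finally show "gauge (f ` (U n \<inter> A)) \<le> ennreal (K powr s) * gauge (U n)" .
      qed auto
      finally show ?thesis
        by simp
    qed
    then have le: "pre \<delta> (f ` A) / ennreal (K powr s) \<le> pre (\<delta> / K) A"
      unfolding hausdorff_premeasure_def[of M d s "\<delta> / K"] using K
      by (intro INF_greatest divide_le_posI_ennreal) (auto simp: mult.commute)
    also have "\<dots> \<le> H A"
      using \<delta> K by (intro pre_le_H) simp
    finally have "pre \<delta> (f ` A) / ennreal (K powr s) * ennreal (K powr s) \<le> H A * ennreal (K powr s)"
      by (rule mult_right_mono) simp
    moreover have "pre \<delta> (f ` A) / ennreal (K powr s) * ennreal (K powr s) = pre \<delta> (f ` A)"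
      using K by (simp add: ennreal_divide_times ennreal_divide_self)
    ultimately show ?thesis
      by (metis mult.commute)
  qed
qed

lemma pre_finite_cover:
  assumes "finite I" "A \<subseteq> (\<Union>i\<in>I. U i)" "0 \<le> \<delta>"
    "\<And>i. i \<in> I \<Longrightarrow> U i \<subseteq> M" "\<And>i x y. i \<in> I \<Longrightarrow> x \<in> U i \<Longrightarrow> y \<in> U i \<Longrightarrow> d x y \<le> \<delta>"
  shows "pre \<delta> A \<le> ennreal (real (card I) * \<delta> powr s)"
proof -
  obtain h where h: "bij_betw h {0..<card I} I"
    using ex_bij_betw_nat_finite[OF assms(1)] by blast
  define W where "W n = (if n < card I then U (h n) else {})" for n
  have hI: "h n \<in> I" if "n < card I" for n
    using bij_betwE[OF h] that by auto
  have "pre \<delta> A \<le> (\<Sum>n. gauge (W n))"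
  proof (rule pre_le)
    show "A \<subseteq> (\<Union>n. W n)"
    proof
      fix x
      assume "x \<in> A"
      then obtain i where i: "i \<in> I" "x \<in> U i"
        using assms(2) by blast
      then obtain n where "n < card I" "h n = i"
        using h unfolding bij_betw_def by (metis atLeastLessThan_iff imageE)
      then show "x \<in> (\<Union>n. W n)"
        using i by (auto simp: W_def)
    qed
    show "W n \<subseteq> M" for n
      using hI assms(4) by (auto simp: W_def)
    show "ediam d (W n) \<le> ennreal \<delta>" for n
      using hI assms(3,5) by (auto simp: W_def ediam_le_iff)
  qed
  also have "\<dots> = (\<Sum>n<card I. gauge (W n))"
    by (intro suminf_finite) (auto simp: W_def)
  also have "\<dots> \<le> (\<Sum>n<card I. ennreal (\<delta> powr s))"
    using hI assms(3,5) by (intro sum_mono gauge_le) (auto simp: W_def)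
  also have "\<dots> = ennreal (real (card I) * \<delta> powr s)"
    by (simp add: ennreal_mult ennreal_of_nat_eq_real_of_nat)
  finally show ?thesis .
qed

end

section \<open>Separated sets under conformal expansion\<close>

context Metric_space
begin

text \<open>The strict inequality makes a separated set of maximal size a net for closed balls of
  radius \<open>r\<close>; finiteness keeps \<open>card\<close> meaningful.\<close>

definition separated :: "real \<Rightarrow> 'a set \<Rightarrow> bool" where
  "separated r S \<longleftrightarrow> S \<subseteq> M \<and> finite S \<and> (\<forall>x\<in>S. \<forall>y\<in>S. x \<noteq> y \<longrightarrow> r < d x y)"

lemma separatedD: "separated r S \<Longrightarrow> x \<in> S \<Longrightarrow> y \<in> S \<Longrightarrow> x \<noteq> y \<Longrightarrow> r < d x y"
  by (auto simp: separated_def)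

lemma separated_subset: "separated r S \<Longrightarrow> T \<subseteq> S \<Longrightarrow> separated r T"
  by (auto simp: separated_def intro: finite_subset)

lemma separated_mono: "separated r S \<Longrightarrow> r' \<le> r \<Longrightarrow> separated r' S"
  by (fastforce simp: separated_def)

end

text \<open>In the application \<open>M\<close> is the Gromov boundary, \<open>V g \<xi> = exp (- \<epsilon> (\<xi>, g p)\<^sub>p)\<close> and
  \<open>w g = exp (- \<epsilon> d(p, g p))\<close>; the assumption \<open>ray\<close> holds because orbit points follow a rough
  geodesic ray towards \<open>x\<close>.\<close>

locale conformal_space = Metric_space M d for M :: "'b set" and d +
  fixes G :: "'g set" and act :: "'g \<Rightarrow> 'b \<Rightarrow> 'b" and iv :: "'g \<Rightarrow> 'g"
    and V :: "'g \<Rightarrow> 'b \<Rightarrow> real" and w :: "'g \<Rightarrow> real" and c :: real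
  assumes compact: "compact_space mtopology"
    and d_le_1: "x \<in> M \<Longrightarrow> y \<in> M \<Longrightarrow> d x y \<le> 1"
    and iv_in: "g \<in> G \<Longrightarrow> iv g \<in> G"
    and iv_iv: "g \<in> G \<Longrightarrow> iv (iv g) = g"
    and act_in: "g \<in> G \<Longrightarrow> x \<in> M \<Longrightarrow> act g x \<in> M"
    and act_iv: "g \<in> G \<Longrightarrow> x \<in> M \<Longrightarrow> act (iv g) (act g x) = x"
    and w_pos: "0 < w g"
    and w_le_V: "x \<in> M \<Longrightarrow> w g \<le> V g x"
    and V_le_1: "x \<in> M \<Longrightarrow> V g x \<le> 1"
    and V_le: "x \<in> M \<Longrightarrow> y \<in> M \<Longrightarrow> V g x \<le> d x y + V g y"
    and d_le: "x \<in> M \<Longrightarrow> y \<in> M \<Longrightarrow> d x y \<le> V g x + V g y"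
    and V_act: "g \<in> G \<Longrightarrow> x \<in> M \<Longrightarrow> V g (act g x) * V (iv g) x = w g"
    and d_act: "g \<in> G \<Longrightarrow> x \<in> M \<Longrightarrow> y \<in> M \<Longrightarrow> d (act g x) (act g y) * V (iv g) x * V (iv g) y = d x y * w g"
    and c_ge_1: "1 \<le> c"
    and ray: "x \<in> M \<Longrightarrow> 0 < \<rho> \<Longrightarrow> \<rho> \<le> 1 \<Longrightarrow> \<exists>g\<in>G. \<rho> / c \<le> w g \<and> w g \<le> c * \<rho> \<and> V g x \<le> c * \<rho>"
    and three: "\<exists>x\<in>M. \<exists>y\<in>M. \<exists>z\<in>M. x \<noteq> y \<and> y \<noteq> z \<and> x \<noteq> z"
begin

lemma V_pos: "x \<in> M \<Longrightarrow> 0 < V g x"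
  using w_pos w_le_V by (rule less_le_trans)

lemma act_iv': "g \<in> G \<Longrightarrow> x \<in> M \<Longrightarrow> act g (act (iv g) x) = x"
  using act_iv[of "iv g"] iv_in iv_iv by simp

lemma act_inj: "g \<in> G \<Longrightarrow> x \<in> M \<Longrightarrow> y \<in> M \<Longrightarrow> act g x = act g y \<Longrightarrow> x = y"
  using act_iv by metis

lemma M_nonempty: "M \<noteq> {}"
  using three by blast

lemma d_pos: "x \<in> M \<Longrightarrow> y \<in> M \<Longrightarrow> x \<noteq> y \<Longrightarrow> 0 < d x y"
  using nonneg[of x y] zero[of x y] by linarith

lemma w_iv: assumes "g \<in> G" shows "w (iv g) = w g"
proof -
  obtain x where x: "x \<in> M"
    using M_nonempty by blast
  show ?thesis
    using V_act[OF assms x] V_act[OF iv_in[OF assms] act_in[OF assms x]] act_iv[OF assms x] iv_iv[OF assms]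
    by (simp add: mult.commute)
qed

text \<open>The distortion lost in \<open>zoom\<close>: a factor \<open>c\<close> from the lower
  bound on \<open>w g\<close>, and \<open>1 + c\<close> from \<open>V g\<close> at each of the two
  points.\<close>

definition C :: real where "C = c * (1 + c)\<^sup>2"

lemma C_ge_1: "1 \<le> C"
proof -
  have "1 * 1 \<le> c * (1 + c)\<^sup>2"
    using c_ge_1 by (intro mult_mono one_le_power) auto
  then show ?thesis
    by (simp add: C_def)
qed

text \<open>The element that \<open>ray\<close> gives at scale \<open>\<rho>\<close> has all of
  \<open>A\<close> in its shadow, where its \<open>V\<close> is at most
  \<open>(1 + c) * \<rho>\<close>; by conformality its inverse stretches distances in
  \<open>A\<close> by at least \<open>1 / (C * \<rho>)\<close>.\<close>

lemma zoom:
  assumes A: "A \<subseteq> M" "A \<noteq> {}" and \<rho>: "0 < \<rho>" "\<rho> \<le> 1"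
    and diam: "\<And>x y. x \<in> A \<Longrightarrow> y \<in> A \<Longrightarrow> d x y \<le> \<rho>"
  shows "\<exists>g\<in>G. \<forall>x\<in>A. \<forall>y\<in>A. d x y \<le> C * \<rho> * d (act g x) (act g y)"
proof -
  obtain x0 where x0: "x0 \<in> A" using A by blast
  obtain g where g: "g \<in> G" "\<rho> / c \<le> w g" "V g x0 \<le> c * \<rho>"
    using ray[of x0 \<rho>] x0 A \<rho> by blast
  have V: "V g x \<le> (1 + c) * \<rho>" "0 \<le> V g x" if "x \<in> A" for x
    using V_le[of x x0 g] diam[OF that x0] g(3) that x0 A(1) V_pos[of x g]
    by (auto simp: algebra_simps subset_iff)
  have "d x y \<le> C * \<rho> * d (act (iv g) x) (act (iv g) y)" if xy: "x \<in> A" "y \<in> A" for x y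
  proof -
    let ?d' = "d (act (iv g) x) (act (iv g) y)"
    have "d x y * (\<rho> / c) \<le> d x y * w (iv g)"
      using g(2) w_iv[OF g(1)] by (intro mult_left_mono) auto
    also have "\<dots> = ?d' * (V g x * V g y)"
      using d_act[OF iv_in[OF g(1)], of x y] iv_iv[OF g(1)] subsetD[OF A(1) xy(1)] subsetD[OF A(1) xy(2)]
      by (simp add: mult_ac)
    also have "\<dots> \<le> ?d' * (((1 + c) * \<rho>) * ((1 + c) * \<rho>))"
      using V[OF xy(1)] V[OF xy(2)] c_ge_1 \<rho>(1) by (intro mult_left_mono mult_mono) auto
    finally have "d x y * \<rho> \<le> (C * \<rho> * ?d') * \<rho>"
      using c_ge_1 by (simp add: C_def field_simps power2_eq_square)
    then show ?thesis
      using \<rho>(1) by (simp only: mult_le_cancel_right)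
  qed
  then show ?thesis
    using iv_in[OF g(1)] by blast
qed

text \<open>The exceptional set \<open>Z\<close> is the shadow of \<open>g\<inverse>p\<close>, outside which \<open>g\<close> contracts into the
  shadow of \<open>gp\<close>.\<close>

lemma shrink:
  assumes \<kappa>: "0 < \<kappa>" "\<kappa> \<le> 1" and x: "x \<in> M" and \<rho>: "0 < \<rho>" "\<rho> \<le> 1"
  obtains g Z where "g \<in> G" "Z \<subseteq> M" "\<forall>y\<in>Z. \<forall>z\<in>Z. d y z \<le> 2 * \<kappa>"
    "\<forall>y\<in>M - Z. d (act g y) x \<le> 2 * c / \<kappa> * \<rho>"
    "\<forall>y\<in>M. \<forall>z\<in>M. \<rho> / c * d y z \<le> d (act g y) (act g z)"
proof -
  obtain g where g: "g \<in> G" "\<rho> / c \<le> w g" "w g \<le> c * \<rho>" "V g x \<le> c * \<rho>"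
    using ray[OF x \<rho>] by blast
  define Z where "Z = {y \<in> M. V (iv g) y < \<kappa>}"
  have "d y z \<le> 2 * \<kappa>" if "y \<in> Z" "z \<in> Z" for y z
    using that d_le[of y z "iv g"] by (auto simp: Z_def)
  moreover have "d (act g y) x \<le> 2 * c / \<kappa> * \<rho>" if y: "y \<in> M - Z" for y
  proof -
    have "V g (act g y) * \<kappa> \<le> V g (act g y) * V (iv g) y"
      using y V_pos[OF act_in[OF g(1), of y], of g] by (intro mult_left_mono) (auto simp: Z_def)
    also have "\<dots> \<le> c * \<rho>"
      using V_act[OF g(1), of y] y g(3) by simp
    finally have "V g (act g y) \<le> c * \<rho> / \<kappa>"
      using \<kappa>(1) by (simp add: field_simps)
    moreover have "c * \<rho> * 1 \<le> c * \<rho> / \<kappa>"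
      using c_ge_1 \<rho>(1) \<kappa> mult_left_le[of \<kappa> "c * \<rho>"] by (simp add: field_simps)
    moreover have "d (act g y) x \<le> V g (act g y) + V g x"
      using y x act_in[OF g(1)] by (intro d_le) auto
    ultimately have "d (act g y) x \<le> c * \<rho> / \<kappa> + c * \<rho> / \<kappa>"
      using g(4) by linarith
    then show ?thesis
      by (simp add: field_simps)
  qed
  moreover have "\<rho> / c * d y z \<le> d (act g y) (act g z)" if yz: "y \<in> M" "z \<in> M" for y z
  proof -
    have "\<rho> / c * d y z \<le> d y z * w g"
      using g(2) by (subst mult.commute) (intro mult_left_mono, auto)
    also have "\<dots> = d (act g y) (act g z) * (V (iv g) y * V (iv g) z)"
      using d_act[OF g(1) yz] by simp
    also have "\<dots> \<le> d (act g y) (act g z) * 1"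
      using V_le_1[OF yz(1), of "iv g"] V_le_1[OF yz(2), of "iv g"] V_pos[OF yz(1), of "iv g"] V_pos[OF yz(2), of "iv g"]
      by (intro mult_left_mono mult_le_one) auto
    finally show ?thesis
      by simp
  qed
  ultimately show ?thesis
    using that[OF g(1), of Z] by (auto simp: Z_def)
qed

section \<open>Packing numbers and their recursive inequalities\<close>

lemma finite_net:
  assumes "0 < r"
  obtains F where "finite F" "F \<subseteq> M" "M \<subseteq> (\<Union>x\<in>F. mball x r)"
proof -
  have "mtotally_bounded M"
    using compact by (simp add: compact_space_eq_mcomplete_mtotally_bounded)
  then show ?thesis
    using assms that unfolding mtotally_bounded_def by blast
qed

text \<open>Two points of a separated set cannot share a centre of an
  \<open>r / 2\<close>-net.\<close>

lemma separated_bound: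
  assumes "0 < r"
  obtains n where "\<And>S. separated r S \<Longrightarrow> card S \<le> n"
proof -
  have "0 < r / 2"
    using assms by simp
  then obtain F where F: "finite F" "F \<subseteq> M" "M \<subseteq> (\<Union>x\<in>F. mball x (r / 2))"
    by (rule finite_net) (rule that)
  have "card S \<le> card F" if S: "separated r S" for S
  proof -
    have "\<forall>x\<in>S. \<exists>y\<in>F. x \<in> mball y (r / 2)"
      using subset_trans[OF conjunct1[OF S[unfolded separated_def]] F(3)] by blast
    then obtain h where h: "\<And>x. x \<in> S \<Longrightarrow> h x \<in> F \<and> x \<in> mball (h x) (r / 2)"
      by metis
    have "inj_on h S"
    proof (rule inj_onI, rule ccontr)
      fix x y
      assume xy: "x \<in> S" "y \<in> S" "h x = h y" "x \<noteq> y"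
      then have "d x y \<le> d x (h x) + d (h x) y" "d (h x) x < r / 2" "d (h x) y < r / 2"
        using h[of x] h[of y] triangle[of x "h x" y] by (auto simp: in_mball)
      then show False
        using separatedD[OF S xy(1,2,4)] commute[of x "h x"] by simp
    qed
    then show ?thesis
      using h by (intro card_inj_on_le[of h _ F] F(1)) auto
  qed
  then show ?thesis
    by (rule that)
qed

text \<open>The packing number at scale \<open>r\<close>. For positive \<open>r\<close> the maximum
  is over a finite set by \<open>separated_bound\<close>, nonempty because the empty set is
  separated.\<close>

definition P :: "real \<Rightarrow> nat" where "P r = Max (card ` {S. separated r S})"

lemma P_facts:
  assumes r: "0 < r"
  shows "separated r S \<Longrightarrow> card S \<le> P r" "\<exists>S. separated r S \<and> card S = P r"
proof -
  obtain n where n: "\<And>S. separated r S \<Longrightarrow> card S \<le> n"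
    using separated_bound[OF r] by metis
  have fin: "finite (card ` {S. separated r S})"
    by (rule finite_subset[of _ "{..n}"]) (use n in auto)
  show "separated r S \<Longrightarrow> card S \<le> P r"
    unfolding P_def using fin by (intro Max_ge) auto
  have "separated r {}"
    by (simp add: separated_def)
  then have "P r \<in> card ` {S. separated r S}"
    unfolding P_def using fin by (intro Max_in) auto
  then show "\<exists>S. separated r S \<and> card S = P r"
    by auto
qed

lemma P_antimono: "0 < r \<Longrightarrow> r \<le> r' \<Longrightarrow> P r' \<le> P r"
  using P_facts(1)[of r] P_facts(2)[of r'] separated_mono by fastforce

lemma separated_net:
  assumes r: "0 < r" and S: "separated r S" "card S = P r"
  shows "M \<subseteq> (\<Union>x\<in>S. mcball x r)"
proof
  have SM: "S \<subseteq> M" "finite S"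
    using S(1) by (auto simp: separated_def)
  fix y
  assume y: "y \<in> M"
  show "y \<in> (\<Union>x\<in>S. mcball x r)"
  proof (rule ccontr)
    assume no: "y \<notin> (\<Union>x\<in>S. mcball x r)"
    then have far: "r < d x y" if "x \<in> S" for x
      using that y SM by (force simp: in_mcball)
    then have "y \<notin> S"
      using y r by fastforce
    moreover have "separated r (insert y S)"
      unfolding separated_def
    proof (intro conjI ballI impI)
      fix a b
      assume ab: "a \<in> insert y S" "b \<in> insert y S" "a \<noteq> b"
      show "r < d a b"
      proof (cases "a = y")
        case True
        then show ?thesis
          using ab far[of b] commute[of y b] by simp
      next
        case False
        then show ?thesis
          using ab far[of a] separatedD[OF S(1), of a b] by (cases "b = y") simp_all
      qed
    qed (use SM y in simp_all)
    ultimately show False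
      using P_facts(1)[OF r, of "insert y S"] S(2) SM by simp
  qed
qed

text \<open>Zooming the piece \<open>W i\<close> turns an \<open>r\<close>-separated subset into an
  \<open>r / (C * \<rho> i)\<close>-separated one, so packing numbers satisfy
  \<open>P r \<le> (\<Sum>i\<in>I. P (r / (C * \<rho> i)))\<close>. The power
  \<open>r powr - t\<close> is a supersolution of this recursion when the sum in the hypothesis is
  at most 1.\<close>

lemma subdivision:
  assumes I: "finite I" "M \<subseteq> (\<Union>i\<in>I. W i)" and t: "0 \<le> t" and sum: "(\<Sum>i\<in>I. (C * \<rho> i) powr t) \<le> 1"
    and W: "\<And>i. i \<in> I \<Longrightarrow> W i \<subseteq> M \<and> 0 < \<rho> i \<and> C * \<rho> i < 1 \<and> (\<forall>x\<in>W i. \<forall>y\<in>W i. d x y \<le> \<rho> i)"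
  shows "\<exists>K. \<forall>r S. 0 < r \<longrightarrow> r \<le> 1 \<longrightarrow> separated r S \<longrightarrow> real (card S) \<le> K * r powr - t"
proof -
  define a where "a i = C * \<rho> i" for i
  have a: "0 < a i" "a i < 1" if "i \<in> I" for i
    using W[OF that] C_ge_1 by (auto simp: a_def)
  have ne: "I \<noteq> {}"
    using I(2) M_nonempty by auto
  define l where "l = Min (a ` I)"
  define m where "m = Max (a ` I)"
  have lm: "l \<le> a i" "a i \<le> m" if "i \<in> I" for i
    using that I(1) by (auto simp: l_def m_def)
  have l: "0 < l" and m: "0 < m" "m < 1"
    using Min_in[of "a ` I"] Max_in[of "a ` I"] ne I(1) a unfolding l_def[symmetric] m_def[symmetric]
    by fastforce+
  have zoom_i: "real (card (S \<inter> W i)) \<le> real k"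
    if i: "i \<in> I" and S: "separated r S" and r: "0 < r"
      and k: "\<And>T. separated (r / a i) T \<Longrightarrow> card T \<le> k" for i r S k
  proof (cases "W i = {}")
    case False
    have "\<rho> i \<le> 1"
      using W[OF i] C_ge_1 mult_right_mono[of 1 C "\<rho> i"] by linarith
    then obtain g where g: "g \<in> G" "\<And>x y. x \<in> W i \<Longrightarrow> y \<in> W i \<Longrightarrow> d x y \<le> a i * d (act g x) (act g y)"
      using zoom[of "W i" "\<rho> i"] W[OF i] False unfolding a_def by blast
    have WM: "W i \<subseteq> M"
      using W[OF i] by blast
    have inj: "inj_on (act g) (S \<inter> W i)"
      using act_inj[OF g(1)] WM by (intro inj_onI) blast
    have "r / a i < d (act g x) (act g y)" if "x \<in> S \<inter> W i" "y \<in> S \<inter> W i" "x \<noteq> y" for x y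
      using separatedD[OF S, of x y] g(2)[of x y] a[OF i] that by (simp add: field_simps)
    moreover have "act g ` (S \<inter> W i) \<subseteq> M" "finite (S \<inter> W i)"
      using act_in[OF g(1)] WM S by (auto simp: separated_def)
    ultimately have "separated (r / a i) (act g ` (S \<inter> W i))"
      unfolding separated_def by blast
    then show ?thesis
      using k card_image[OF inj] by fastforce
  qed simp
  \<comment> \<open>Once the scale reaches 1 a separated set has at most one point, but division by
    \<open>a i\<close> may overshoot up to \<open>1 / l\<close>; this \<open>K\<close> keeps the
    bound at least 1 on that whole range.\<close>
  define K where "K = l powr - t"
  have big: "real (card S) \<le> K * r powr - t" if "1 \<le> r" "r \<le> 1 / l" "separated r S" for r S
  proof -
    have "x = y" if "x \<in> S" "y \<in> S" for x y
      using separatedD[OF \<open>separated r S\<close> that] d_le_1[of x y] that \<open>1 \<le> r\<close> \<open>separated r S\<close>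
      unfolding separated_def by fastforce
    then have "card S \<le> 1"
      using that(3) by (auto simp: separated_def card_le_Suc0_iff_eq)
    moreover have "1 \<le> (l * r) powr - t"
    proof -
      have "l * r \<le> 1" "0 < l * r"
        using that l by (auto simp: field_simps)
      then have "(l * r) powr t \<le> 1"
        using t by (intro powr_le1) auto
      then show ?thesis
        using one_le_inverse[of "(l * r) powr t"] \<open>0 < l * r\<close> by (simp only: powr_minus powr_gt_zero)
    qed
    moreover have "(l * r) powr - t = K * r powr - t"
      using l that(1) by (simp add: K_def powr_mult)
    ultimately show ?thesis
      by linarith
  qed
  have main: "m ^ n \<le> r \<Longrightarrow> r \<le> 1 / l \<Longrightarrow> separated r S \<Longrightarrow> real (card S) \<le> K * r powr - t" for n r S
  proof (induction n arbitrary: r S)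
    case 0
    then show ?case
      using big by simp
  next
    case (Suc n)
    have r: "0 < r"
      using Suc.prems(1) m by (meson less_le_trans zero_less_power)
    show ?case
    proof (cases "1 \<le> r")
      case True
      then show ?thesis
        using big Suc.prems by blast
    next
      case False
      have part: "real (card (S \<inter> W i)) \<le> K * r powr - t * a i powr t" if i: "i \<in> I" for i
      proof -
        have "m ^ n * a i \<le> m ^ n * m"
          using lm[OF i] m by (intro mult_left_mono) auto
        then have "m ^ n * a i \<le> r"
          using Suc.prems(1) by (simp add: mult.commute)
        then have "m ^ n \<le> r / a i"
          using a[OF i] by (simp add: field_simps)
        moreover have "r / a i \<le> 1 / l"
          using False r lm[OF i] l by (intro frac_le) auto
        ultimately have IH: "real (card T) \<le> K * (r / a i) powr - t" if "separated (r / a i) T" for T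
          using Suc.IH that by blast
        have nn: "0 \<le> K * (r / a i) powr - t"
          by (simp add: K_def)
        \<comment> \<open>\<open>zoom_i\<close> takes a natural number as bound, hence the
          floor.\<close>
        have "real (card (S \<inter> W i)) \<le> real (nat \<lfloor>K * (r / a i) powr - t\<rfloor>)"
          by (rule zoom_i[OF i Suc.prems(3) r]) (use IH le_nat_floor in blast)
        also have "\<dots> \<le> K * (r / a i) powr - t"
          using nn by (rule of_nat_floor)
        also have "\<dots> = K * r powr - t * a i powr t"
          using r a[OF i] by (simp add: powr_divide powr_minus divide_simps)
        finally show ?thesis .
      qed
      have "S = (\<Union>i\<in>I. S \<inter> W i)"
        using I(2) Suc.prems(3) by (auto simp: separated_def)
      then have "card S \<le> (\<Sum>i\<in>I. card (S \<inter> W i))"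
        using card_UN_le[OF I(1), of "\<lambda>i. S \<inter> W i"] by simp
      then have "real (card S) \<le> (\<Sum>i\<in>I. real (card (S \<inter> W i)))"
        by (metis of_nat_le_iff of_nat_sum)
      also have "\<dots> \<le> (\<Sum>i\<in>I. K * r powr - t * a i powr t)"
        by (intro sum_mono part)
      also have "\<dots> = K * r powr - t * (\<Sum>i\<in>I. a i powr t)"
        by (simp add: sum_distrib_left)
      also have "\<dots> \<le> K * r powr - t * 1"
        using sum by (intro mult_left_mono) (auto simp: a_def K_def)
      finally show ?thesis
        by simp
    qed
  qed
  have "1 \<le> 1 / l"
    using lm a ne l by (meson all_not_in_conv le_divide_eq_1_pos less_imp_le order_trans)
  then have "real (card S) \<le> K * r powr - t" if "0 < r" "r \<le> 1" "separated r S" for r S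
    using main that real_arch_pow_inv[OF that(1) m(2)] by (meson less_imp_le order_trans)
  then show ?thesis
    by blast
qed

text \<open>A crude exponent from a cover by equal balls. It shows that the volume growth is finite,
  before any sharp exponent is available.\<close>

lemma polynomial_growth:
  obtains K t where "0 \<le> t" "\<And>r S. 0 < r \<Longrightarrow> r \<le> 1 \<Longrightarrow> separated r S \<Longrightarrow> real (card S) \<le> K * r powr - t"
proof -
  define \<rho> where "\<rho> = 1 / (2 * C)"
  have \<rho>: "0 < \<rho>" "C * \<rho> = 1 / 2"
    using C_ge_1 by (auto simp: \<rho>_def)
  have "0 < \<rho> / 2"
    using \<rho> by simp
  then obtain F where F: "finite F" "F \<subseteq> M" "M \<subseteq> (\<Union>x\<in>F. mball x (\<rho> / 2))"
    by (rule finite_net) (rule that)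
  have ne: "F \<noteq> {}"
    using F(3) M_nonempty by auto
  then have N: "1 \<le> card F"
    using F(1) by (simp add: Suc_le_eq card_gt_0_iff)
  \<comment> \<open>Solves \<open>card F * (1 / 2) powr t = 1\<close>, the equality case of
    \<open>subdivision\<close> for equal pieces.\<close>
  define t where "t = log 2 (card F)"
  have t: "0 \<le> t"
    using N by (simp add: t_def)
  have "(2::real) powr t = card F"
    using N by (simp add: t_def)
  then have "(\<Sum>i\<in>F. (C * \<rho>) powr t) \<le> 1"
    using N by (simp add: \<rho> powr_divide)
  moreover have "mball x (\<rho> / 2) \<subseteq> M \<and> 0 < \<rho> \<and> C * \<rho> < 1 \<and> (\<forall>y\<in>mball x (\<rho> / 2). \<forall>z\<in>mball x (\<rho> / 2). d y z \<le> \<rho>)"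
    if "x \<in> F" for x
  proof -
    have "d y z \<le> \<rho>" if "y \<in> mball x (\<rho> / 2)" "z \<in> mball x (\<rho> / 2)" for y z
      using that triangle[of y x z] commute[of y x] by (auto simp: in_mball)
    then show ?thesis
      using \<rho> by (auto simp: in_mball)
  qed
  ultimately obtain K where "\<forall>r S. 0 < r \<longrightarrow> r \<le> 1 \<longrightarrow> separated r S \<longrightarrow> real (card S) \<le> K * r powr - t"
    using subdivision[OF F(1,3) t, of "\<lambda>_. \<rho>"] by blast
  then show ?thesis
    using that[OF t] by blast
qed

text \<open>A shrunken copy of a further separated set is planted around each point of a separated
  set, and this is iterated. The exceptional set of \<open>shrink\<close> varies with the point, so
  \<open>N\<close> points avoiding it must exist wherever it lies.\<close>

lemma branching:
  assumes \<kappa>: "0 < \<kappa>" "\<kappa> \<le> 1" and r: "0 < r" "r \<le> 1"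
    and S: "\<And>Z. Z \<subseteq> M \<Longrightarrow> (\<And>y z. y \<in> Z \<Longrightarrow> z \<in> Z \<Longrightarrow> d y z \<le> 2 * \<kappa>) \<Longrightarrow>
      \<exists>S. separated r S \<and> S \<inter> Z = {} \<and> N \<le> card S"
  shows "\<exists>S. separated ((r * \<kappa> / (6 * c\<^sup>2)) ^ k) S \<and> N ^ k \<le> card S"
proof -
  have "6 * 1 \<le> 6 * c\<^sup>2"
    using c_ge_1 by (intro mult_left_mono one_le_power) auto
  then have C: "6 \<le> 6 * c\<^sup>2"
    by simp
  define l where "l = r * \<kappa> / (6 * c\<^sup>2)"
  have "r * \<kappa> \<le> 1 * 1"
    using r \<kappa> by (intro mult_mono) auto
  then have l: "0 < l" "l \<le> 1 / 6"
    unfolding l_def using r \<kappa> C divide_pos_pos[OF mult_pos_pos[OF r(1) \<kappa>(1)], of "6 * c\<^sup>2"] frac_le[of 1 "r * \<kappa>" 6 "6 * c\<^sup>2"] by linarith+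
  have "\<exists>S. separated (l ^ k) S \<and> N ^ k \<le> card S"
  proof (induction k)
    case 0
    obtain x where "x \<in> M"
      using M_nonempty by blast
    then show ?case
      by (intro exI[of _ "{x}"]) (auto simp: separated_def)
  next
    case (Suc k)
    then obtain S0 where S0: "separated (l ^ k) S0" "N ^ k \<le> card S0"
      by blast
    define \<sigma> where "\<sigma> = l ^ k"
    have \<sigma>: "0 < \<sigma>" "\<sigma> \<le> 1"
      using l by (auto simp: \<sigma>_def intro: power_le_one)
    \<comment> \<open>With this scale a copy lands within \<open>\<sigma> / 3\<close> of its centre
      and has separation \<open>\<rho> / c * r = l * \<sigma>\<close>; copies around different
      centres stay \<open>\<sigma> / 3\<close> apart, which exceeds
      \<open>l * \<sigma>\<close>.\<close>
    define \<rho> where "\<rho> = \<sigma> * \<kappa> / (6 * c)"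
    have "\<sigma> * \<kappa> \<le> 1 * 1"
      using \<sigma> \<kappa> by (intro mult_mono) auto
    then have \<rho>: "0 < \<rho>" "\<rho> \<le> 1"
      unfolding \<rho>_def using \<sigma> \<kappa> c_ge_1 frac_le[of 1 "\<sigma> * \<kappa>" 1 "6 * c"] by auto
    have "\<exists>T. separated (l * \<sigma>) T \<and> (\<forall>y\<in>T. d y x \<le> \<sigma> / 3) \<and> N \<le> card T" if x: "x \<in> S0" for x
    proof -
      have xM: "x \<in> M"
        using x S0 by (auto simp: separated_def)
      obtain g Z where g: "g \<in> G" and Z: "Z \<subseteq> M" "\<forall>y\<in>Z. \<forall>z\<in>Z. d y z \<le> 2 * \<kappa>"
        and gZ: "\<forall>y\<in>M - Z. d (act g y) x \<le> 2 * c / \<kappa> * \<rho>"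
        and g2: "\<forall>y\<in>M. \<forall>z\<in>M. \<rho> / c * d y z \<le> d (act g y) (act g z)"
        by (rule shrink[OF \<kappa> xM \<rho>]) (rule that)
      obtain T where T: "separated r T" "T \<inter> Z = {}" "N \<le> card T"
        using S[of Z] Z by blast
      have TM: "T \<subseteq> M" "finite T"
        using T(1) by (auto simp: separated_def)
      have "inj_on (act g) T"
        using act_inj[OF g] TM by (intro inj_onI) blast
      then have "card (act g ` T) = card T"
        by (rule card_image)
      moreover have "d (act g y) x \<le> \<sigma> / 3" if "y \<in> T" for y
      proof -
        have "d (act g y) x \<le> 2 * c / \<kappa> * \<rho>"
          using gZ that TM T(2) by blast
        also have "\<dots> = \<sigma> / 3"
          using c_ge_1 \<kappa> by (simp add: \<rho>_def)
        finally show ?thesis .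
      qed
      moreover have "l * \<sigma> < d (act g y) (act g z)" if "y \<in> T" "z \<in> T" "y \<noteq> z" for y z
      proof -
        have "l * \<sigma> = \<rho> / c * r"
          using c_ge_1 by (simp add: l_def \<rho>_def power2_eq_square mult_ac)
        also have "\<dots> < \<rho> / c * d y z"
          using separatedD[OF T(1) that] \<rho> c_ge_1 by (intro mult_strict_left_mono) auto
        also have "\<dots> \<le> d (act g y) (act g z)"
          using g2 that TM by blast
        finally show ?thesis .
      qed
      moreover have "act g ` T \<subseteq> M"
        using act_in[OF g] TM by blast
      ultimately show ?thesis
        using T(3) TM by (intro exI[of _ "act g ` T"]) (auto simp: separated_def)
    qed
    then obtain T where T: "\<And>x. x \<in> S0 \<Longrightarrow> separated (l * \<sigma>) (T x)"
      "\<And>x y. x \<in> S0 \<Longrightarrow> y \<in> T x \<Longrightarrow> d y x \<le> \<sigma> / 3" "\<And>x. x \<in> S0 \<Longrightarrow> N \<le> card (T x)"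
      by metis
    have S0M: "S0 \<subseteq> M" "finite S0"
      using S0(1) by (auto simp: separated_def)
    have TM: "T x \<subseteq> M" "finite (T x)" if "x \<in> S0" for x
      using T(1)[OF that] by (auto simp: separated_def)
    have far: "l * \<sigma> < d y z" if x: "x \<in> S0" "x' \<in> S0" "x \<noteq> x'" and y: "y \<in> T x" "z \<in> T x'" for x x' y z
    proof -
      have yz: "y \<in> M" "z \<in> M" "x \<in> M" "x' \<in> M"
        using TM x y S0M by blast+
      have "\<sigma> < d x x'"
        using separatedD[OF S0(1) x] by (simp add: \<sigma>_def)
      moreover have "d x x' \<le> d x y + d y x'" "d y x' \<le> d y z + d z x'"
        using yz by (auto intro: triangle)
      moreover have "d x y \<le> \<sigma> / 3" "d z x' \<le> \<sigma> / 3"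
        using T(2)[OF x(1) y(1)] T(2)[OF x(2) y(2)] commute[of x y] by auto
      moreover have "l * \<sigma> \<le> 1 / 6 * \<sigma>"
        using l \<sigma> by (intro mult_right_mono) auto
      ultimately show ?thesis
        using \<sigma> by linarith
    qed
    have "separated (l * \<sigma>) (\<Union>x\<in>S0. T x)"
      unfolding separated_def
    proof (intro conjI ballI impI)
      fix y z
      assume "y \<in> (\<Union>x\<in>S0. T x)" "z \<in> (\<Union>x\<in>S0. T x)" "y \<noteq> z"
      then obtain x x' where "x \<in> S0" "x' \<in> S0" "y \<in> T x" "z \<in> T x'" "y \<noteq> z"
        by blast
      then show "l * \<sigma> < d y z"
        using far[of x x' y z] separatedD[OF T(1), of x y z] by (cases "x = x'") auto
    qed (use TM S0M in auto)
    moreover have "N ^ Suc k \<le> card (\<Union>x\<in>S0. T x)"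
    proof -
      have "T x \<inter> T x' = {}" if "x \<in> S0" "x' \<in> S0" "x \<noteq> x'" for x x'
      proof (rule ccontr)
        assume "T x \<inter> T x' \<noteq> {}"
        then obtain y where y: "y \<in> T x" "y \<in> T x'"
          by blast
        have "d y y = 0"
          using y TM that by (simp add: subset_iff)
        then show False
          using far[OF that y] l \<sigma> mult_pos_pos[of l \<sigma>] by linarith
      qed
      then have "card (\<Union>x\<in>S0. T x) = (\<Sum>x\<in>S0. card (T x))"
        using S0M TM by (intro card_UN_disjoint) auto
      also have "\<dots> \<ge> (\<Sum>x\<in>S0. N)"
        by (intro sum_mono T)
      finally have "card S0 * N \<le> card (\<Union>x\<in>S0. T x)"
        by simp
      moreover have "N ^ k * N \<le> card S0 * N"
        using S0(2) by (rule mult_right_mono) simp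
      ultimately have "N ^ k * N \<le> card (\<Union>x\<in>S0. T x)"
        by (rule order_trans[rotated])
      then show ?thesis
        by (simp add: mult.commute)
    qed
    ultimately show ?case
      by (intro exI[of _ "\<Union>x\<in>S0. T x"]) (simp add: \<sigma>_def)
  qed
  then show ?thesis
    by (simp add: l_def)
qed

text \<open>Of two fixed distinct points at least one has \<open>V (iv g)\<close> bounded below, and
  \<open>g\<close> carries it into its own shadow. Thus every orbit point is seen from
  \<open>p\<close> in the direction of some boundary point.\<close>

lemma visible_point:
  obtains b where "1 \<le> b" "\<And>g. g \<in> G \<Longrightarrow> \<exists>x\<in>M. V g x \<le> b * w g"
proof -
  obtain x y where xy: "x \<in> M" "y \<in> M" "x \<noteq> y"
    using three by blast
  define \<delta> where "\<delta> = d x y / 2"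
  have \<delta>: "0 < \<delta>" "\<delta> \<le> 1"
    using d_pos[OF xy] d_le_1[OF xy(1,2)] by (auto simp: \<delta>_def)
  have "\<exists>x\<in>M. V g x \<le> 1 / \<delta> * w g" if g: "g \<in> G" for g
  proof -
    have "\<delta> \<le> V (iv g) x \<or> \<delta> \<le> V (iv g) y"
      unfolding \<delta>_def using d_le[OF xy(1,2), of "iv g"] by linarith
    then obtain z where z: "z \<in> M" "\<delta> \<le> V (iv g) z"
      using xy by blast
    have "V g (act g z) * \<delta> \<le> V g (act g z) * V (iv g) z"
      using z V_pos[OF act_in[OF g z(1)], of g] by (intro mult_left_mono) auto
    also have "\<dots> = w g"
      by (rule V_act[OF g z(1)])
    finally show ?thesis
      using act_in[OF g z(1)] \<delta> by (intro bexI[of _ "act g z"]) (auto simp: field_simps)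
  qed
  moreover have "1 \<le> 1 / \<delta>"
    using \<delta> by simp
  ultimately show ?thesis
    using that by blast
qed

end

section \<open>Finiteness and positivity of the Hausdorff measure\<close>

text \<open>The two assumptions identify \<open>s\<close> as the exponential growth rate of the cardinalities of
  \<open>r\<close>-separated sets as \<open>r\<close> tends to \<open>0\<close>.\<close>

locale conformal_growth = conformal_space M d G act iv V w c
  for M :: "'b set" and d and G :: "'g set" and act iv V w c +
  fixes s :: real
  assumes growth_lower: "0 \<le> t \<Longrightarrow> (\<And>r S. 0 < r \<Longrightarrow> r \<le> 1 \<Longrightarrow> separated r S \<Longrightarrow> real (card S) \<le> K * r powr - t) \<Longrightarrow> s \<le> t"
    and growth_upper: "0 < l \<Longrightarrow> l < 1 \<Longrightarrow> 1 \<le> N \<Longrightarrow> (\<And>k. \<exists>S. separated (l ^ k) S \<and> N ^ k \<le> card S) \<Longrightarrow> real N \<le> l powr - s"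
begin

lemma branching_bound:
  assumes \<kappa>: "0 < \<kappa>" "\<kappa> \<le> 1" and r: "0 < r" "r \<le> 1" and N: "1 \<le> N"
    and S: "\<And>Z. Z \<subseteq> M \<Longrightarrow> (\<And>y z. y \<in> Z \<Longrightarrow> z \<in> Z \<Longrightarrow> d y z \<le> 2 * \<kappa>) \<Longrightarrow>
      \<exists>S. separated r S \<and> S \<inter> Z = {} \<and> N \<le> card S"
  shows "real N \<le> (r * \<kappa> / (6 * c\<^sup>2)) powr - s" "r * \<kappa> / (6 * c\<^sup>2) < 1"
proof -
  have c2: "1 \<le> c\<^sup>2"
    using c_ge_1 by (simp add: one_le_power)
  have "r * \<kappa> \<le> 1 * 1"
    using r \<kappa> by (intro mult_mono) auto
  then show l: "r * \<kappa> / (6 * c\<^sup>2) < 1"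
    using c2 by (simp add: divide_less_eq)
  have "0 < r * \<kappa> / (6 * c\<^sup>2)"
    using r \<kappa> c2 by (intro divide_pos_pos mult_pos_pos) auto
  then show "real N \<le> (r * \<kappa> / (6 * c\<^sup>2)) powr - s"
    using l N branching[OF \<kappa> r S] by (intro growth_upper) auto
qed

text \<open>An exceptional set of small diameter contains at most one of three fixed points, so two
  survive and branching doubles at each step; doubling at a ratio \<open>l < 1\<close> rules out a
  nonpositive exponent.\<close>

lemma s_pos: "0 < s"
proof -
  obtain x y z where xyz: "x \<in> M" "y \<in> M" "z \<in> M" "x \<noteq> y" "y \<noteq> z" "x \<noteq> z"
    using three by blast
  define \<delta> where "\<delta> = min (d x y) (min (d y z) (d x z))"
  have \<delta>: "0 < \<delta>" "\<delta> \<le> d x y" "\<delta> \<le> d y z" "\<delta> \<le> d x z" "\<delta> \<le> 1"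
    using d_pos xyz d_le_1[of x y] by (auto simp: \<delta>_def)
  define \<kappa> where "\<kappa> = \<delta> / 3"
  define r where "r = \<delta> / 2"
  have \<kappa>: "0 < \<kappa>" "\<kappa> \<le> 1" "2 * \<kappa> < \<delta>" and r: "0 < r" "r \<le> 1" "r < \<delta>"
    using \<delta> by (auto simp: \<kappa>_def r_def)
  have far: "\<delta> \<le> d a b" if "a \<in> {x, y, z}" "b \<in> {x, y, z}" "a \<noteq> b" for a b
    using that \<delta> commute[of x y] commute[of y z] commute[of x z] by auto
  have S: "\<exists>S. separated r S \<and> S \<inter> Z = {} \<and> 2 \<le> card S"
    if Z: "Z \<subseteq> M" "\<And>a b. a \<in> Z \<Longrightarrow> b \<in> Z \<Longrightarrow> d a b \<le> 2 * \<kappa>" for Z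
  proof -
    have one: "a = b" if "a \<in> {x, y, z} \<inter> Z" "b \<in> {x, y, z} \<inter> Z" for a b
      using far[of a b] Z(2)[of a b] \<kappa>(3) that by force
    have "separated r ({x, y, z} - Z)"
      unfolding separated_def
    proof (intro conjI ballI impI)
      show "r < d a b" if "a \<in> {x, y, z} - Z" "b \<in> {x, y, z} - Z" "a \<noteq> b" for a b
        using far[of a b] that r(3) by force
    qed (use xyz in auto)
    moreover have "2 \<le> card ({x, y, z} - Z)"
    proof -
      have fin: "finite ({x, y, z} \<inter> Z)"
        by simp
      have "card ({x, y, z} \<inter> Z) \<le> Suc 0"
        unfolding card_le_Suc0_iff_eq[OF fin] by (intro ballI one)
      moreover have "card {x, y, z} = 3"
        using xyz by simp
      moreover have "card {x, y, z} = card ({x, y, z} \<inter> Z) + card ({x, y, z} - Z)"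
        by (rule card_Int_Diff) simp
      ultimately show ?thesis
        by linarith
    qed
    ultimately show ?thesis
      by (intro exI[of _ "{x, y, z} - Z"]) auto
  qed
  define l where "l = r * \<kappa> / (6 * c\<^sup>2)"
  have l: "2 \<le> l powr - s" "l < 1"
    using branching_bound[OF \<kappa>(1,2) r(1,2), of 2] S by (auto simp: l_def)
  have l0: "0 < l"
    unfolding l_def using r \<kappa> c_ge_1 by (intro divide_pos_pos mult_pos_pos) auto
  show ?thesis
  proof (rule ccontr)
    assume "\<not> 0 < s"
    then have "l powr - s \<le> 1"
      using l l0 by (intro powr_le1) auto
    then show False
      using l by simp
  qed
qed

sublocale hausdorff_space M d s
  by unfold_locales (rule s_pos)

text \<open>If halving fails at scale \<open>r\<close>, the bound at the coarser scale \<open>A * r\<close> already gives the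
  bound at scale \<open>r\<close>; if it holds, removing a small exceptional set from a maximal separated
  set costs at most half of it, and branching applies.\<close>

lemma separated_upper:
  obtains K where "0 < K" "\<And>r S. 0 < r \<Longrightarrow> r \<le> 1 \<Longrightarrow> separated r S \<Longrightarrow> real (card S) \<le> K * r powr - s"
proof -
  \<comment> \<open>A step by the factor \<open>A\<close> changes \<open>r powr - s\<close> by 4, so
    the factor 2 lost where halving fails is affordable.\<close>
  define A :: real where "A = 4 powr (1 / s)"
  have A: "1 < A" "A powr s = 4"
    using s_pos by (auto simp: A_def powr_powr)
  \<comment> \<open>Makes \<open>C * (2 * \<kappa>) = 1 / A\<close>: \<open>zoom\<close> then
    stretches an exceptional set by at least \<open>A\<close>, so it holds at most
    \<open>P (A * r)\<close> points of an \<open>r\<close>-separated set.\<close>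
  define \<kappa> where "\<kappa> = 1 / (2 * C * A)"
  have \<kappa>: "0 < \<kappa>" "C * (2 * \<kappa>) = 1 / A"
    using A C_ge_1 by (auto simp: \<kappa>_def)
  have "1 * (2 * \<kappa>) \<le> C * (2 * \<kappa>)"
    using C_ge_1 \<kappa>(1) by (intro mult_right_mono) auto
  moreover have "1 / A \<le> 1"
    using A(1) by simp
  ultimately have \<kappa>_le: "2 * \<kappa> \<le> 1" "\<kappa> \<le> 1"
    using \<kappa> by linarith+
  have small: "card (S \<inter> Z) \<le> P (A * r)"
    if r: "0 < r" and S: "separated r S" and Z: "Z \<subseteq> M" "\<And>y z. y \<in> Z \<Longrightarrow> z \<in> Z \<Longrightarrow> d y z \<le> 2 * \<kappa>" for r S Z
  proof (cases "Z = {}")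
    case False
    obtain g where g: "g \<in> G" "\<And>x y. x \<in> Z \<Longrightarrow> y \<in> Z \<Longrightarrow> d x y \<le> C * (2 * \<kappa>) * d (act g x) (act g y)"
      using zoom[OF Z(1) False _ \<kappa>_le(1) Z(2)] \<kappa>(1) by auto
    have inj: "inj_on (act g) (S \<inter> Z)"
      using act_inj[OF g(1)] Z(1) by (intro inj_onI) blast
    have "A * r < d (act g x) (act g y)" if "x \<in> S \<inter> Z" "y \<in> S \<inter> Z" "x \<noteq> y" for x y
    proof -
      have "A * r < A * d x y"
        using separatedD[OF S, of x y] A(1) that by (intro mult_strict_left_mono) auto
      also have "\<dots> \<le> d (act g x) (act g y)"
        using g(2)[of x y, unfolded \<kappa>(2)] A(1) that by (simp add: field_simps)
      finally show ?thesis .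
    qed
    moreover have "act g ` (S \<inter> Z) \<subseteq> M" "finite (S \<inter> Z)"
      using act_in[OF g(1)] Z(1) S by (auto simp: separated_def)
    ultimately have "separated (A * r) (act g ` (S \<inter> Z))"
      unfolding separated_def by blast
    then show ?thesis
      using P_facts(1)[of "A * r"] r A(1) card_image[OF inj] by fastforce
  qed simp
  define b where "b = (\<kappa> / (6 * c\<^sup>2)) powr - s"
  have good: "real (P r) \<le> 2 * b * r powr - s" if r: "0 < r" "r \<le> 1" and half: "2 * P (A * r) \<le> P r" for r
  proof -
    obtain S where S: "separated r S" "card S = P r"
      using P_facts(2)[OF r(1)] by blast
    define N where "N = P r - P (A * r)"
    obtain x where "x \<in> M"
      using M_nonempty by blast
    then have "separated r {x}"
      by (simp add: separated_def)
    then have "1 \<le> P r"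
      using P_facts(1)[OF r(1)] by fastforce
    then have N: "1 \<le> N" "P r \<le> 2 * N"
      using half by (auto simp: N_def)
    have "real N \<le> (r * \<kappa> / (6 * c\<^sup>2)) powr - s"
    proof (rule branching_bound(1)[OF \<kappa>(1) \<kappa>_le(2) r N(1)])
      fix Z
      assume Z: "Z \<subseteq> M" "\<And>y z. y \<in> Z \<Longrightarrow> z \<in> Z \<Longrightarrow> d y z \<le> 2 * \<kappa>"
      have "card S = card (S - Z) + card (S \<inter> Z)"
        using S(1) card_Int_Diff[of S Z] by (simp add: separated_def)
      then have "N \<le> card (S - Z)"
        using small[OF r(1) S(1) Z] S(2) by (simp add: N_def)
      then show "\<exists>S. separated r S \<and> S \<inter> Z = {} \<and> N \<le> card S"
        using separated_subset[OF S(1), of "S - Z"] by (intro exI[of _ "S - Z"]) auto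
    qed
    also have "\<dots> = b * r powr - s"
      using r \<kappa> by (simp add: b_def powr_mult[symmetric] mult.commute)
    finally show ?thesis
      using N(2) by linarith
  qed
  define K where "K = max 1 (max (2 * b) (real (P (1 / A))))"
  have K: "1 \<le> K" "2 * b \<le> K" "real (P (1 / A)) \<le> K"
    by (auto simp: K_def)
  have main: "r \<le> 1 \<Longrightarrow> 0 < r \<Longrightarrow> (1 / A) ^ n \<le> r \<Longrightarrow> real (P r) \<le> K * r powr - s" for n r
  proof (induction n arbitrary: r)
    case 0
    then have r: "r = 1"
      by simp
    have "P 1 \<le> P (1 / A)"
      using A(1) by (intro P_antimono) auto
    then show ?case
      using K(3) r by simp
  next
    case (Suc n)
    show ?case
    proof (cases "1 / A \<le> r")
      case True
      then have "P r \<le> P (1 / A)"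
        using A(1) by (intro P_antimono) auto
      then have "real (P r) \<le> K * 1"
        using K(3) by simp
      also have "1 \<le> r powr - s"
        using one_le_inverse[of "r powr s"] powr_le1[of s r] s_pos Suc.prems by (simp add: powr_minus)
      then have "K * 1 \<le> K * r powr - s"
        using K(1) by (intro mult_left_mono) auto
      finally show ?thesis .
    next
      case False
      show ?thesis
      proof (cases "2 * P (A * r) \<le> P r")
        case True
        have "real (P r) \<le> 2 * b * r powr - s"
          using Suc.prems True by (intro good) auto
        also have "\<dots> \<le> K * r powr - s"
          using K(2) by (intro mult_right_mono) auto
        finally show ?thesis .
      next
        case half: False
        have "real (P (A * r)) \<le> K * (A * r) powr - s"
          using False Suc.prems A(1) by (intro Suc.IH) (auto simp: field_simps)
        also have "\<dots> = K * r powr - s / 4"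
          using A Suc.prems by (simp add: powr_mult powr_minus divide_simps)
        finally have "real (P r) \<le> 2 * (K * r powr - s / 4)"
          using half by linarith
        also have "\<dots> \<le> K * r powr - s"
          using K(1) by simp
        finally show ?thesis .
      qed
    qed
  qed
  have "real (card S) \<le> K * r powr - s" if r: "0 < r" "r \<le> 1" "separated r S" for r S
  proof -
    obtain n where "(1 / A) ^ n < r"
      using real_arch_pow_inv[of r "1 / A"] r(1) A(1) by auto
    then have "real (P r) \<le> K * r powr - s"
      using r by (intro main[of r n]) auto
    moreover have "real (card S) \<le> real (P r)"
      using P_facts(1)[OF r(1,3)] by simp
    ultimately show ?thesis
      by linarith
  qed
  then show ?thesis
    using K(1) that[of K] by simp
qed

text \<open>Balls of radius \<open>r\<close> about a maximal separated set cover \<open>M\<close>;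
  there are at most \<open>K * r powr - s\<close> of them, of diameter at most \<open>2 * r\<close>,
  so their \<open>s\<close>-sums stay bounded as \<open>r\<close> tends to 0.\<close>

lemma H_finite: "H M < top_class.top"
proof -
  obtain K where K: "0 < K" "\<And>r S. 0 < r \<Longrightarrow> r \<le> 1 \<Longrightarrow> separated r S \<Longrightarrow> real (card S) \<le> K * r powr - s"
    using separated_upper by metis
  have "H M \<le> ennreal (K * 2 powr s)"
  proof (rule H_leI)
    fix \<delta> :: real
    assume \<delta>: "0 < \<delta>"
    define r where "r = min 1 (\<delta> / 2)"
    have r: "0 < r" "r \<le> 1" "2 * r \<le> \<delta>"
      using \<delta> by (auto simp: r_def)
    obtain S where S: "separated r S" "card S = P r"
      using P_facts(2)[OF r(1)] by blast
    have SM: "S \<subseteq> M" "finite S"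
      using S(1) by (auto simp: separated_def)
    have cover: "M \<subseteq> (\<Union>x\<in>S. mcball x r)"
      by (rule separated_net[OF r(1) S])
    have "pre \<delta> M \<le> pre (2 * r) M"
      using r(3) by (rule pre_antimono)
    also have "\<dots> \<le> ennreal (real (card S) * (2 * r) powr s)"
    proof (rule pre_finite_cover[OF SM(2) cover])
      show "d y z \<le> 2 * r" if "x \<in> S" "y \<in> mcball x r" "z \<in> mcball x r" for x y z
        using that triangle[of y x z] commute[of y x] by (auto simp: in_mcball)
    qed (use r in \<open>auto simp: in_mcball\<close>)
    also have "\<dots> \<le> ennreal ((K * r powr - s) * (2 * r) powr s)"
      using K(2)[OF r(1,2) S(1)] by (intro ennreal_leI mult_right_mono) auto
    also have "(K * r powr - s) * (2 * r) powr s = K * 2 powr s"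
      using r by (simp add: powr_mult powr_minus)
    finally show "pre \<delta> M \<le> ennreal (K * 2 powr s)" .
  qed
  then show ?thesis
    using le_less_trans ennreal_less_top by blast
qed

lemma compact_cover:
  assumes "\<And>n::nat. openin mtopology (U n)" "M \<subseteq> (\<Union>n. U n)"
  obtains I where "finite I" "M \<subseteq> (\<Union>n\<in>I. U n)"
proof -
  have "compactin mtopology M"
    using compact by (simp add: compact_space_def)
  then obtain F where "finite F" "F \<subseteq> range U" "M \<subseteq> \<Union>F"
    using assms unfolding compactin_def by (metis (no_types, lifting) imageE)
  then show ?thesis
    using that finite_subset_image[of F U UNIV] by metis
qed

text \<open>If the measure vanished, a finite open cover would have
  \<open>(\<Sum>n\<in>I. (C * \<rho> n) powr s)\<close> strictly below 1. By continuity the same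
  holds for some exponent \<open>t\<close> below \<open>s\<close>, and \<open>subdivision\<close>
  would bound the packing numbers with exponent \<open>t\<close>, against
  \<open>growth_lower\<close>.\<close>

lemma H_positive: "0 < H M"
proof (rule ccontr)
  assume "\<not> 0 < H M"
  then have "pre 1 M = 0"
    using pre_le_H[of 1 M] by simp
  \<comment> \<open>The diameters contribute at most \<open>e\<close> and the thickening at most
    \<open>2 * e\<close>, so the final sum is at most
    \<open>3 * C powr s * e = 1 / 2\<close>.\<close>
  define e where "e = 1 / (6 * C powr s)"
  have Cs: "0 < C powr s"
    using C_ge_1 by simp
  have e: "0 < e" "C powr s * e = 1 / 6"
    using Cs C_ge_1 by (auto simp: e_def)
  have "pre 1 M < ennreal e"
    using e(1) \<open>pre 1 M = 0\<close> by simp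
  then obtain U where U: "M \<subseteq> (\<Union>n. U n)" "\<And>n. U n \<subseteq> M" "\<And>n. ediam d (U n) \<le> ennreal 1"
    "(\<Sum>n. gauge (U n)) < ennreal e"
    using pre_less by metis
  define a where "a n = enn2real (ediam d (U n))" for n
  have a0: "0 \<le> a n" for n
    by (simp add: a_def)
  have fin_sum: "(\<Sum>n\<in>I. a n powr s) \<le> e" if I: "finite I" for I
  proof -
    have "ennreal (\<Sum>n\<in>I. a n powr s) = (\<Sum>n\<in>I. gauge (U n))"
      by (simp add: gauge_eq a_def)
    also have "\<dots> \<le> (\<Sum>n. gauge (U n))"
      using I by (intro sum_le_suminf) auto
    also have "\<dots> \<le> ennreal e"
      using U(4) by simp
    finally show ?thesis
      using e(1) by simp
  qed
  \<comment> \<open>Strictly larger than \<open>a n\<close> even when \<open>a n = 0\<close>, which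
    leaves room to thicken \<open>U n\<close> to an open set; the cost in the \<open>s\<close>-sum
    is geometric.\<close>
  define \<rho> where "\<rho> n = (a n powr s + e * (1 / 2) ^ n) powr (1 / s)" for n
  have \<rho>s: "\<rho> n powr s = a n powr s + e * (1 / 2) ^ n" for n
    using s_pos e(1) by (simp add: \<rho>_def powr_powr add_nonneg_nonneg)
  have \<rho>a: "a n < \<rho> n" for n
  proof -
    have "a n powr s < \<rho> n powr s"
      using e(1) by (simp add: \<rho>s)
    moreover have "\<rho> n powr s \<le> a n powr s" if "\<rho> n \<le> a n"
      using s_pos that by (intro powr_mono2) (auto simp: \<rho>_def)
    ultimately show ?thesis
      by linarith
  qed
  define W where "W n = (\<Union>y\<in>U n. mball y ((\<rho> n - a n) / 2))" for n
  have "openin mtopology (W n)" for n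
    unfolding W_def by (intro openin_Union) auto
  moreover have "M \<subseteq> (\<Union>n. W n)"
  proof
    fix x
    assume x: "x \<in> M"
    then obtain n where n: "x \<in> U n"
      using U(1) by blast
    have "x \<in> mball x ((\<rho> n - a n) / 2)"
      using x \<rho>a[of n] by simp
    then have "x \<in> W n"
      unfolding W_def using n by blast
    then show "x \<in> (\<Union>n. W n)"
      by blast
  qed
  ultimately obtain I where I: "finite I" "M \<subseteq> (\<Union>n\<in>I. W n)"
    by (rule compact_cover) (rule that)
  have sum_half: "(\<Sum>n\<in>I. (C * \<rho> n) powr s) \<le> 1 / 2"
  proof -
    have geo: "(\<Sum>n\<in>I. (1 / 2 :: real) ^ n) \<le> 2"
    proof -
      have "(\<Sum>n\<in>I. (1 / 2 :: real) ^ n) \<le> (\<Sum>n. (1 / 2) ^ n)"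
        using I(1) by (intro sum_le_suminf summable_geometric) auto
      then show ?thesis
        by (simp add: suminf_geometric)
    qed
    have "(\<Sum>n\<in>I. (C * \<rho> n) powr s) = (\<Sum>n\<in>I. C powr s * (a n powr s + e * (1 / 2) ^ n))"
      using C_ge_1 \<rho>a a0 by (intro sum.cong refl) (simp add: powr_mult \<rho>s less_imp_le[OF le_less_trans])
    also have "\<dots> = C powr s * ((\<Sum>n\<in>I. a n powr s) + e * (\<Sum>n\<in>I. (1 / 2) ^ n))"
      by (simp add: sum_distrib_left[symmetric] sum.distrib)
    also have "\<dots> \<le> C powr s * (e + e * 2)"
      using fin_sum[OF I(1)] geo e(1) Cs by (intro mult_left_mono add_mono) auto
    also have "\<dots> = 1 / 2"
      using e(2) by (simp add: algebra_simps)
    finally show ?thesis .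
  qed
  have pos: "0 < C * \<rho> n" for n
    using C_ge_1 a0[of n] \<rho>a[of n] by (intro mult_pos_pos) auto
  have less1: "C * \<rho> n < 1" if "n \<in> I" for n
  proof (rule ccontr)
    assume "\<not> C * \<rho> n < 1"
    then have "1 \<le> (C * \<rho> n) powr s"
      using s_pos by (intro ge_one_powr_ge_zero) auto
    also have "\<dots> \<le> (\<Sum>n\<in>I. (C * \<rho> n) powr s)"
      using I(1) that by (intro member_le_sum) auto
    finally show False
      using sum_half by simp
  qed
  have "((\<lambda>t. \<Sum>n\<in>I. (C * \<rho> n) powr t) \<longlongrightarrow> (\<Sum>n\<in>I. (C * \<rho> n) powr s)) (at_left s)"
    by (intro tendsto_intros disjI1 less_imp_neq[OF pos, symmetric])
  then have "\<forall>\<^sub>F t in at_left s. (\<Sum>n\<in>I. (C * \<rho> n) powr t) < 1"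
    using sum_half by (intro order_tendstoD(2)) auto
  moreover have "\<forall>\<^sub>F t in at_left s. 0 < t \<and> t < s"
    using eventually_at_left_real[OF s_pos] by eventually_elim auto
  ultimately have "\<forall>\<^sub>F t in at_left s. (\<Sum>n\<in>I. (C * \<rho> n) powr t) < 1 \<and> 0 < t \<and> t < s"
    by eventually_elim auto
  then obtain t where t: "(\<Sum>n\<in>I. (C * \<rho> n) powr t) < 1" "0 < t" "t < s"
    using eventually_happens'[OF trivial_limit_at_left_real] by blast
  have "W n \<subseteq> M \<and> 0 < \<rho> n \<and> C * \<rho> n < 1 \<and> (\<forall>x\<in>W n. \<forall>y\<in>W n. d x y \<le> \<rho> n)" if n: "n \<in> I" for n
  proof (intro conjI ballI)
    show "0 < \<rho> n"
      using a0[of n] \<rho>a[of n] by linarith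
    show "C * \<rho> n < 1"
      by (rule less1[OF n])
    show "d x y \<le> \<rho> n" if xy: "x \<in> W n" "y \<in> W n" for x y
    proof -
      obtain x' y' where x': "x \<in> M" "x' \<in> U n" "d x' x < (\<rho> n - a n) / 2"
        and y': "y \<in> M" "y' \<in> U n" "d y' y < (\<rho> n - a n) / 2"
        using xy by (auto simp: W_def in_mball)
      have "d x' y' \<le> a n"
        unfolding a_def by (rule dist_le_ediam[OF U(3) x'(2) y'(2)])
      moreover have "d x y \<le> d x x' + d x' y" "d x' y \<le> d x' y' + d y' y"
        using x' y' U(2) by (auto intro!: triangle)
      ultimately have "d x y \<le> d x' x + a n + d y' y"
        unfolding commute[of x' x] by linarith
      also have "\<dots> \<le> (\<rho> n - a n) / 2 + a n + (\<rho> n - a n) / 2"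
        using x'(3) y'(3) by (intro add_mono) auto
      finally show ?thesis
        by (simp add: field_simps)
    qed
  qed (auto simp: W_def)
  then obtain K where "\<forall>r S. 0 < r \<longrightarrow> r \<le> 1 \<longrightarrow> separated r S \<longrightarrow> real (card S) \<le> K * r powr - t"
    using subdivision[OF I, of t \<rho>] t by auto
  then have "s \<le> t"
    using t(2) by (intro growth_lower[of t K]) auto
  then show False
    using t by simp
qed

end

section \<open>Mass of balls and the density of the image measure\<close>

context hausdorff_space
begin

lemma normalized_hausdorff_measure:
  assumes fin: "H M < top_class.top" and pos: "0 < H M"
  defines "\<nu> \<equiv> normalized_hausdorff_measure M d s"
  shows "space \<nu> = M" "sets \<nu> = borel_sets" "\<And>A. A \<in> borel_sets \<Longrightarrow> emeasure \<nu> A = H A / H M" "emeasure \<nu> (space \<nu>) = 1"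
proof -
  have opens: "{U. openin mtopology U} \<subseteq> Pow M"
    by (auto simp: openin_mtopology)
  show sp: "space \<nu> = M" and se: "sets \<nu> = borel_sets"
    using opens by (auto simp: \<nu>_def normalized_hausdorff_measure_def mtopology_def)
  have ms: "measure_space M borel_sets H"
    by (rule H_measure_space[OF fin])
  have ca: "countably_additive borel_sets (\<lambda>A. H A / H M)"
    unfolding countably_additive_def
  proof (intro allI impI)
    fix A :: "nat \<Rightarrow> 'b set"
    assume A: "range A \<subseteq> borel_sets" "disjoint_family A" "(\<Union>i. A i) \<in> borel_sets"
    have "(\<Sum>i. H (A i)) = H (\<Union>i. A i)"
      using ms A unfolding measure_space_def countably_additive_def by blast
    then show "(\<Sum>i. H (A i) / H M) = H (\<Union>i. A i) / H M"
      by (simp add: divide_ennreal_def)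
  qed
  show em: "emeasure \<nu> A = H A / H M" if "A \<in> borel_sets" for A
  proof (rule emeasure_measure_of)
    show "\<nu> = measure_of M {U. openin mtopology U} (\<lambda>A. H A / H M)"
      by (simp add: \<nu>_def normalized_hausdorff_measure_def)
    show "positive (sets \<nu>) (\<lambda>A. H A / H M)"
      by (simp add: positive_def)
    show "countably_additive (sets \<nu>) (\<lambda>A. H A / H M)"
      using ca by (simp add: se)
    show "A \<in> sets \<nu>"
      using that by (simp add: se)
  qed (use opens in auto)
  have "M \<in> borel_sets"
    by (rule sigma_sets_top)
  then show "emeasure \<nu> (space \<nu>) = 1"
    using fin pos by (simp add: em sp)
qed

end

context conformal_growth
begin

definition \<nu> :: "'b measure" where "\<nu> = normalized_hausdorff_measure M d s"

lemmas \<nu>_facts = normalized_hausdorff_measure[OF H_finite H_positive, folded \<nu>_def]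
lemmas space_\<nu> [simp] = \<nu>_facts(1)
lemmas sets_\<nu> = \<nu>_facts(2)
lemmas emeasure_\<nu> = \<nu>_facts(3)[folded sets_\<nu>]

sublocale \<nu>: finite_measure \<nu>
  by (rule finite_measureI) (use \<nu>_facts(4) in simp)

lemma H_divide: "x \<le> k * H M \<longleftrightarrow> x / H M \<le> k"
proof -
  have "x = x / H M * H M"
    using H_finite H_positive by (simp add: ennreal_divide_times)
  then show ?thesis
    using H_finite H_positive
    by (metis divide_le_posI_ennreal mult.commute mult_right_mono zero_le)
qed

section \<open>Ahlfors regularity of the Hausdorff measure\<close>

lemma act_iv_image: "g \<in> G \<Longrightarrow> A \<subseteq> M \<Longrightarrow> act (iv g) ` (act g ` A) = A"
  using act_iv by (force simp: image_image subset_iff)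

text \<open>The zoomed copy of \<open>A\<close> has at most the full mass, and the way back
  contracts by \<open>C * \<rho>\<close>. For \<open>\<rho> > 1\<close> the factor is at least
  1.\<close>

lemma mass_upper:
  assumes A: "A \<subseteq> M" and \<rho>: "0 < \<rho>" and diam: "\<And>x y. x \<in> A \<Longrightarrow> y \<in> A \<Longrightarrow> d x y \<le> \<rho>"
  shows "H A \<le> ennreal ((C * \<rho>) powr s) * H M"
proof (cases "A = {} \<or> 1 < \<rho>")
  case True
  have "1 * H M \<le> ennreal ((C * \<rho>) powr s) * H M" if "1 < \<rho>"
  proof (rule mult_right_mono)
    have "1 * 1 \<le> C * \<rho>"
      using C_ge_1 that by (intro mult_mono) auto
    then show "1 \<le> ennreal ((C * \<rho>) powr s)"
      using s_pos by (simp add: ge_one_powr_ge_zero)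
  qed simp
  then show ?thesis
    using True H_mono[OF A] by auto
next
  case False
  obtain g where g: "g \<in> G" "\<forall>x\<in>A. \<forall>y\<in>A. d x y \<le> C * \<rho> * d (act g x) (act g y)"
    using zoom[OF A _ \<rho> _ diam] False by auto
  note eq = act_iv_image[OF g(1) A]
  have "H (act (iv g) ` (act g ` A)) \<le> ennreal ((C * \<rho>) powr s) * H (act g ` A)"
  proof (rule H_lipschitz)
    show "0 < C * \<rho>"
      using C_ge_1 \<rho> by (intro mult_pos_pos) auto
    show "act (iv g) ` (act g ` A) \<subseteq> M"
      using A by (simp add: eq)
    show "d (act (iv g) x) (act (iv g) y) \<le> C * \<rho> * d x y" if "x \<in> act g ` A" "y \<in> act g ` A" for x y
      using that g(2) act_iv[OF g(1)] A by (auto simp: subset_iff)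
  qed
  also have "\<dots> \<le> ennreal ((C * \<rho>) powr s) * H M"
    using act_in[OF g(1)] A by (intro mult_left_mono H_mono) auto
  finally show ?thesis
    by (simp add: eq)
qed

text \<open>The ball contains a contracted image of \<open>M - Z\<close>, and the contraction is no
  stronger than order \<open>\<rho>\<close>. Since \<open>Z\<close> carries at most half of the
  mass, the image keeps mass of order \<open>\<rho> powr s\<close>.\<close>

lemma mass_lower:
  obtains b where "0 < b"
    "\<And>x \<rho>. x \<in> M \<Longrightarrow> 0 < \<rho> \<Longrightarrow> \<rho> \<le> 1 \<Longrightarrow> ennreal (b * \<rho> powr s) * H M \<le> H {y \<in> M. d y x \<le> \<rho>}"
proof -
  \<comment> \<open>Solves \<open>(C * (2 * \<kappa>)) powr s = 1 / 2\<close>, so that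
    \<open>mass_upper\<close> leaves at most half of the mass to \<open>Z\<close>.\<close>
  define \<kappa> where "\<kappa> = (1 / 2) powr (1 / s) / (2 * C)"
  have "(1 / 2 :: real) powr (1 / s) \<le> 1"
    using s_pos by (intro powr_le1) auto
  then have \<kappa>: "0 < \<kappa>" "\<kappa> \<le> 1"
    unfolding \<kappa>_def using C_ge_1 by (auto simp: divide_le_eq)
  have half: "(C * (2 * \<kappa>)) powr s = 1 / 2"
    using C_ge_1 s_pos by (simp add: \<kappa>_def powr_powr)
  define b where "b = (\<kappa> / (2 * c\<^sup>2)) powr s / 2"
  have b: "0 < b"
    using \<kappa> c_ge_1 by (simp add: b_def)
  obtain h where h: "H M = ennreal h" "0 < h"
    using H_finite H_positive by (cases "H M") auto
  have "ennreal (b * \<rho> powr s) * H M \<le> H {y \<in> M. d y x \<le> \<rho>}" if x: "x \<in> M" and \<rho>: "0 < \<rho>" "\<rho> \<le> 1" for x \<rho>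
  proof -
    \<comment> \<open>Cancels the constant \<open>2 * c / \<kappa>\<close> of \<open>shrink\<close>,
      so that the image fits into the ball of radius \<open>\<rho>\<close>.\<close>
    define \<rho>' where "\<rho>' = \<rho> * \<kappa> / (2 * c)"
    have "\<rho> * \<kappa> \<le> 1 * 1"
      using \<rho> \<kappa> by (intro mult_mono) auto
    then have \<rho>': "0 < \<rho>'" "\<rho>' \<le> 1"
      unfolding \<rho>'_def using \<rho> \<kappa> c_ge_1 by (auto simp: divide_le_eq)
    obtain g Z where g: "g \<in> G" and Z: "Z \<subseteq> M" "\<forall>y\<in>Z. \<forall>z\<in>Z. d y z \<le> 2 * \<kappa>"
      and gZ: "\<forall>y\<in>M - Z. d (act g y) x \<le> 2 * c / \<kappa> * \<rho>'"
      and g2: "\<forall>y\<in>M. \<forall>z\<in>M. \<rho>' / c * d y z \<le> d (act g y) (act g z)"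
      by (rule shrink[OF \<kappa> x \<rho>']) (rule that)
    have sub: "act g ` (M - Z) \<subseteq> {y \<in> M. d y x \<le> \<rho>}"
      using gZ act_in[OF g] \<kappa> c_ge_1 by (auto simp: \<rho>'_def)
    note eq = act_iv_image[OF g Diff_subset[of M Z]]
    have "H (act (iv g) ` (act g ` (M - Z))) \<le> ennreal ((c / \<rho>') powr s) * H (act g ` (M - Z))"
    proof (rule H_lipschitz)
      show "0 < c / \<rho>'"
        using c_ge_1 \<rho>' by (intro divide_pos_pos) auto
      show "act (iv g) ` (act g ` (M - Z)) \<subseteq> M"
        by (simp add: eq)
      show "d (act (iv g) y) (act (iv g) z) \<le> c / \<rho>' * d y z" if yz: "y \<in> act g ` (M - Z)" "z \<in> act g ` (M - Z)" for y z
      proof -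
        obtain y' z' where y': "y' \<in> M" "y = act g y'" "z' \<in> M" "z = act g z'"
          using yz by blast
        have "\<rho>' / c * d y' z' \<le> d y z"
          using g2 y' by blast
        then show ?thesis
          using y' act_iv[OF g] \<rho>' c_ge_1 by (simp add: field_simps)
      qed
    qed
    also have "\<dots> \<le> ennreal ((c / \<rho>') powr s) * H {y \<in> M. d y x \<le> \<rho>}"
      by (intro mult_left_mono H_mono sub) simp
    finally have 1: "H (M - Z) \<le> ennreal ((c / \<rho>') powr s) * H {y \<in> M. d y x \<le> \<rho>}"
      by (simp add: eq)
    have 2: "H Z \<le> ennreal (1 / 2) * H M"
      using mass_upper[OF Z(1), of "2 * \<kappa>"] Z(2) \<kappa>(1) half by simp
    have 3: "H M \<le> H Z + H (M - Z)"
      using H_Un[of Z "M - Z"] Z(1) by (simp add: Un_absorb1)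
    have "H (M - Z) < top_class.top" "H Z < top_class.top" "H {y \<in> M. d y x \<le> \<rho>} < top_class.top"
      using Z(1) by (auto intro!: le_less_trans[OF H_mono H_finite])
    then obtain u v m where uvm: "H (M - Z) = ennreal u" "H Z = ennreal v" "H {y \<in> M. d y x \<le> \<rho>} = ennreal m"
      "0 \<le> u" "0 \<le> v" "0 \<le> m"
      by (cases "H (M - Z)"; cases "H Z"; cases "H {y \<in> M. d y x \<le> \<rho>}") auto
    have r1: "u \<le> (c / \<rho>') powr s * m"
      using 1 uvm by (simp add: ennreal_mult[symmetric])
    have r2: "v \<le> 1 / 2 * h"
      using 2 uvm h by (simp add: ennreal_mult[symmetric] del: ennreal_half)
    have r3: "h \<le> v + u"
      using 3 uvm h by (simp add: ennreal_plus[symmetric] del: ennreal_plus)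
    have "h / 2 \<le> (c / \<rho>') powr s * m"
      using r1 r2 r3 by linarith
    then have "(\<rho>' / c) powr s * (h / 2) \<le> (\<rho>' / c) powr s * ((c / \<rho>') powr s * m)"
      by (intro mult_left_mono) auto
    also have "\<dots> = m"
      using \<rho>' c_ge_1 by (simp add: powr_divide)
    also have "(\<rho>' / c) powr s * (h / 2) = b * \<rho> powr s * h"
    proof -
      have "\<rho>' / c = \<rho> * (\<kappa> / (2 * c\<^sup>2))"
        by (simp add: \<rho>'_def power2_eq_square)
      moreover have "0 \<le> \<kappa> / (2 * c\<^sup>2)"
        using \<kappa> by simp
      ultimately have "(\<rho>' / c) powr s = \<rho> powr s * (\<kappa> / (2 * c\<^sup>2)) powr s"
        using \<rho> by (metis less_imp_le powr_mult)
      then show ?thesis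
        by (simp add: b_def)
    qed
    finally show ?thesis
      using h uvm b by (simp add: ennreal_mult[symmetric] ennreal_leI)
  qed
  with b show ?thesis
    by (rule that)
qed

section \<open>Measurability and distortion of the group action\<close>

lemma openin_V_less: "openin mtopology {x \<in> M. V g x < a}"
  unfolding openin_mtopology
proof (intro conjI allI impI)
  fix x
  assume x: "x \<in> {x \<in> M. V g x < a}"
  have "mball x (a - V g x) \<subseteq> {x \<in> M. V g x < a}"
  proof
    fix y
    assume "y \<in> mball x (a - V g x)"
    then show "y \<in> {x \<in> M. V g x < a}"
      using V_le[of y x g] commute[of x y] by (auto simp: in_mball)
  qed
  then show "\<exists>r>0. mball x r \<subseteq> {x \<in> M. V g x < a}"
    using x by (intro exI[of _ "a - V g x"]) auto
qed auto

lemma measurable_V [measurable]: "V g \<in> borel_measurable \<nu>"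
  unfolding borel_measurable_iff_less
  using openin_V_less by (auto simp: sets_\<nu> intro!: sigma_sets.Basic)

text \<open>A crude constant, enough for continuity and hence measurability.\<close>

lemma act_lipschitz:
  assumes g: "g \<in> G" and xy: "x \<in> M" "y \<in> M"
  shows "d (act g x) (act g y) \<le> d x y / w g"
proof -
  have "d (act g x) (act g y) * (w g * w g) \<le> d (act g x) (act g y) * (V (iv g) x * V (iv g) y)"
    using w_le_V[OF xy(1), of "iv g"] w_le_V[OF xy(2), of "iv g"] w_iv[OF g] w_pos[of g]
    by (intro mult_left_mono mult_mono) auto
  also have "\<dots> = d x y * w g"
    using d_act[OF g xy] by (simp add: mult_ac)
  finally show ?thesis
    using w_pos[of g] by (simp add: field_simps)
qed

lemma measurable_act:
  assumes g: "g \<in> G"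
  shows "act g \<in> measurable \<nu> \<nu>"
proof (rule measurable_sigma_sets[OF sets_\<nu>])
  show "{U. openin mtopology U} \<subseteq> Pow M"
    by (auto simp: openin_mtopology)
  show "act g \<in> space \<nu> \<rightarrow> M"
    using act_in[OF g] by auto
  fix U
  assume U: "U \<in> {U. openin mtopology U}"
  have "openin mtopology (act g -` U \<inter> M)"
    unfolding openin_mtopology
  proof (intro conjI allI impI)
    fix x
    assume x: "x \<in> act g -` U \<inter> M"
    then obtain r where r: "0 < r" "mball (act g x) r \<subseteq> U"
      using U unfolding openin_mtopology by auto
    have "mball x (r * w g) \<subseteq> act g -` U \<inter> M"
    proof
      fix y
      assume y: "y \<in> mball x (r * w g)"
      then have "d (act g x) (act g y) < r"
        using act_lipschitz[OF g, of x y] w_pos[of g]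
        by (auto simp: in_mball pos_divide_less_eq elim!: le_less_trans)
      then show "y \<in> act g -` U \<inter> M"
        using y r(2) act_in[OF g] by (auto simp: in_mball subset_iff)
    qed
    then show "\<exists>r>0. mball x r \<subseteq> act g -` U \<inter> M"
      using r(1) w_pos[of g] by (intro exI[of _ "r * w g"]) auto
  qed auto
  then show "act g -` U \<inter> space \<nu> \<in> sets \<nu>"
    by (auto simp: sets_\<nu> intro!: sigma_sets.Basic)
qed

text \<open>The inverse of \<open>g\<close> multiplies the distance of \<open>x\<close> and
  \<open>y\<close> by exactly \<open>w g / (V g x * V g y)\<close>.\<close>

lemma distortion_upper:
  assumes g: "g \<in> G" and A: "A \<subseteq> M" and lo: "0 < lo" and V: "\<And>x. x \<in> A \<Longrightarrow> lo \<le> V g x"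
  shows "H (act (iv g) ` A) \<le> ennreal ((w g / lo\<^sup>2) powr s) * H A"
proof (rule H_lipschitz)
  show "0 < w g / lo\<^sup>2"
    using w_pos[of g] lo by simp
  show "act (iv g) ` A \<subseteq> M"
    using act_in[OF iv_in[OF g]] A by auto
  fix x y
  assume xy: "x \<in> A" "y \<in> A"
  have "d (act (iv g) x) (act (iv g) y) * (lo * lo) \<le> d (act (iv g) x) (act (iv g) y) * (V g x * V g y)"
    using V[OF xy(1)] V[OF xy(2)] lo by (intro mult_left_mono mult_mono) auto
  also have "\<dots> = d x y * w g"
    using d_act[OF iv_in[OF g], of x y] iv_iv[OF g] w_iv[OF g] xy A by (auto simp: mult_ac)
  finally show "d (act (iv g) x) (act (iv g) y) \<le> w g / lo\<^sup>2 * d x y"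
    using lo by (simp add: field_simps power2_eq_square)
qed

text \<open>The upper estimate for the inverse element on the image, where \<open>V (iv g)\<close>
  takes the value \<open>w g / V g x\<close> and so is at least \<open>w g / hi\<close>.\<close>

lemma distortion_lower:
  assumes g: "g \<in> G" and A: "A \<subseteq> M" and V: "\<And>x. x \<in> A \<Longrightarrow> V g x \<le> hi" and hi: "0 < hi"
  shows "H A \<le> ennreal ((hi\<^sup>2 / w g) powr s) * H (act (iv g) ` A)"
proof -
  have "w g / hi \<le> V (iv g) (act (iv g) x)" if x: "x \<in> A" for x
  proof -
    have xM: "x \<in> M"
      using x A by blast
    have "V (iv g) (act (iv g) x) * V g x = w g"
      using V_act[OF iv_in[OF g] xM] iv_iv[OF g] w_iv[OF g] by simp
    then have "V (iv g) (act (iv g) x) = w g / V g x"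
      using V_pos[OF xM, of g] by (simp add: field_simps)
    then show ?thesis
      using V[OF x] V_pos[OF xM, of g] w_pos[of g] by (simp add: divide_left_mono)
  qed
  moreover have "act (iv g) ` A \<subseteq> M"
    using act_in[OF iv_in[OF g]] A by auto
  ultimately have "H (act (iv (iv g)) ` (act (iv g) ` A))
      \<le> ennreal ((w (iv g) / (w g / hi)\<^sup>2) powr s) * H (act (iv g) ` A)"
    using w_pos[of g] hi by (intro distortion_upper[OF iv_in[OF g]]) auto
  moreover have "w (iv g) / (w g / hi)\<^sup>2 = hi\<^sup>2 / w g"
    using w_pos[of g] hi by (simp add: w_iv[OF g] power2_eq_square)
  ultimately show ?thesis
    using act_iv_image[OF iv_in[OF g] A] iv_iv[OF g] by simp
qed

end

text \<open>The truncation confines the outer integral to \<open>{0..L}\<close>: in the application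
  lower bounds for the superlevel sets are available only up to
  \<open>L = - ln (w g)\<close>.\<close>

lemma layer_cake:
  assumes N: "sigma_finite_measure N" and X[measurable]: "X \<in> borel_measurable N"
    and X0: "\<And>x. x \<in> space N \<Longrightarrow> 0 \<le> X x" and k: "0 \<le> k" and L: "0 \<le> L"
  shows "(\<integral>\<^sup>+x. ennreal (exp (k * min (X x) L)) \<partial>N) = emeasure N (space N) +
    (\<integral>\<^sup>+t. ennreal (k * exp (k * t)) * emeasure N {x \<in> space N. t \<le> X x} * indicator {0..L} t \<partial>lborel)"
proof -
  interpret N: sigma_finite_measure N
    by (rule N)
  interpret pair_sigma_finite lborel N
    by unfold_locales
  let ?f = "\<lambda>t x. ennreal (k * exp (k * t)) * indicator {0..L} t * indicator {t. t \<le> X x} t"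
  have FTC: "ennreal (exp (k * m)) = 1 + (\<integral>\<^sup>+t. ennreal (k * exp (k * t)) * indicator {0..m} t \<partial>lborel)"
    if "0 \<le> m" for m
  proof -
    have "(\<integral>\<^sup>+t. ennreal (k * exp (k * t)) * indicator {0..m} t \<partial>lborel) = ennreal (exp (k * m) - exp (k * 0))"
      using k that by (intro nn_integral_FTC_Icc) (auto intro!: derivative_eq_intros)
    moreover have "1 \<le> exp (k * m)"
      using k that by simp
    ultimately show ?thesis
      by (simp add: ennreal_1[symmetric] ennreal_plus[symmetric] del: ennreal_1 ennreal_plus)
  qed
  have "(\<integral>\<^sup>+x. ennreal (exp (k * min (X x) L)) \<partial>N) =
      (\<integral>\<^sup>+x. 1 + (\<integral>\<^sup>+t. ?f t x \<partial>lborel) \<partial>N)"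
  proof (rule nn_integral_cong)
    fix x
    assume "x \<in> space N"
    then have "0 \<le> min (X x) L"
      using X0 L by simp
    then show "ennreal (exp (k * min (X x) L)) =
        1 + (\<integral>\<^sup>+t. ?f t x \<partial>lborel)"
      by (subst FTC) (auto intro!: arg_cong2[where f = "(+)"] nn_integral_cong split: split_indicator)
  qed
  also have "\<dots> = emeasure N (space N) +
      (\<integral>\<^sup>+x. (\<integral>\<^sup>+t. ?f t x \<partial>lborel) \<partial>N)"
    by (subst nn_integral_add) auto
  also have "(\<integral>\<^sup>+x. (\<integral>\<^sup>+t. ?f t x \<partial>lborel) \<partial>N)
      = (\<integral>\<^sup>+t. (\<integral>\<^sup>+x. ?f t x \<partial>N) \<partial>lborel)"
    by (rule Fubini') (auto simp: indicator_def)
  also have "\<dots> = (\<integral>\<^sup>+t. ennreal (k * exp (k * t)) * emeasure N {x \<in> space N. t \<le> X x} * indicator {0..L} t \<partial>lborel)"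
  proof (rule nn_integral_cong)
    fix t :: real
    have "(\<integral>\<^sup>+x. ?f t x \<partial>N)
        = (\<integral>\<^sup>+x. ennreal (k * exp (k * t)) * indicator {0..L} t * indicator {x \<in> space N. t \<le> X x} x \<partial>N)"
      by (intro nn_integral_cong) (auto split: split_indicator)
    also have "\<dots> = ennreal (k * exp (k * t)) * indicator {0..L} t * emeasure N {x \<in> space N. t \<le> X x}"
      by (intro nn_integral_cmult_indicator) auto
    finally show "(\<integral>\<^sup>+x. ?f t x \<partial>N)
        = ennreal (k * exp (k * t)) * emeasure N {x \<in> space N. t \<le> X x} * indicator {0..L} t"
      by (simp add: mult_ac)
  qed
  finally show ?thesis .
qed

text \<open>The integral of \<open>2 * \<sigma> * exp ((2 * \<sigma> - 1) * u)\<close> over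
  \<open>{0..T}\<close>, evaluated separately where the exponent vanishes.\<close>

definition tail_integral :: "real \<Rightarrow> real \<Rightarrow> real" where
  "tail_integral \<sigma> T = (if \<sigma> = 1 / 2 then T else 2 * \<sigma> * (exp ((2 * \<sigma> - 1) * T) - 1) / (2 * \<sigma> - 1))"

lemma tail_integral:
  assumes \<sigma>: "0 \<le> \<sigma>" and s: "0 < s" and L: "0 \<le> L" and a: "0 \<le> a"
  shows "(\<integral>\<^sup>+t. ennreal (2 * \<sigma> * s * exp (2 * \<sigma> * s * t)) * ennreal (a * exp (- s * t)) * indicator {0..L} t \<partial>lborel)
    = ennreal (a * tail_integral \<sigma> (s * L))" (is "?I = _") "0 \<le> tail_integral \<sigma> (s * L)"
proof -
  define F where "F t = tail_integral \<sigma> (s * t)" for t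
  have F': "(F has_real_derivative 2 * \<sigma> * s * exp (2 * \<sigma> * s * t) * exp (- s * t)) (at t)" for t
  proof (cases "\<sigma> = 1 / 2")
    case True
    have "2 * \<sigma> * s * exp (2 * \<sigma> * s * t) * exp (- s * t) = s"
      unfolding True by (simp add: exp_minus)
    moreover have "F = (\<lambda>t. s * t)"
      by (simp add: F_def[abs_def] tail_integral_def True)
    ultimately show ?thesis
      by (auto intro!: derivative_eq_intros simp del: mult_minus_left)
  next
    case False
    have "exp (2 * \<sigma> * s * t) * exp (- s * t) = exp ((2 * \<sigma> - 1) * (s * t))"
      unfolding exp_add[symmetric] by (simp add: algebra_simps)
    then have e: "2 * \<sigma> * s * exp (2 * \<sigma> * s * t) * exp (- s * t) = 2 * \<sigma> * s * exp ((2 * \<sigma> - 1) * (s * t))"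
      by (simp only: mult.assoc)
    have "((\<lambda>t. 2 * \<sigma> * (exp (q * (s * t)) - 1) / q) has_real_derivative 2 * \<sigma> * s * exp (q * (s * t))) (at t)"
      if "q \<noteq> 0" for q
      using that by (auto intro!: derivative_eq_intros)
    from this[of "2 * \<sigma> - 1"] False
    have "((\<lambda>t. 2 * \<sigma> * (exp ((2 * \<sigma> - 1) * (s * t)) - 1) / (2 * \<sigma> - 1)) has_real_derivative
        2 * \<sigma> * s * exp ((2 * \<sigma> - 1) * (s * t))) (at t)"
      by simp
    moreover have "F = (\<lambda>t. 2 * \<sigma> * (exp ((2 * \<sigma> - 1) * (s * t)) - 1) / (2 * \<sigma> - 1))"
      using False by (simp add: F_def[abs_def] tail_integral_def)
    ultimately show ?thesis
      unfolding e by simp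
  qed
  have F0: "F 0 = 0"
    by (simp add: F_def tail_integral_def)
  have "?I
      = (\<integral>\<^sup>+t. ennreal (a * (2 * \<sigma> * s * exp (2 * \<sigma> * s * t) * exp (- s * t))) * indicator {0..L} t \<partial>lborel)"
    using \<sigma> s a by (intro nn_integral_cong) (simp add: ennreal_mult[symmetric] mult_ac)
  also have "\<dots> = ennreal (a * F L - a * F 0)"
    using \<sigma> s a L F'
    by (intro nn_integral_FTC_Icc) (auto intro!: derivative_eq_intros DERIV_cmult mult_nonneg_nonneg)
  finally show "?I
    = ennreal (a * tail_integral \<sigma> (s * L))"
    by (simp add: F0) (simp add: F_def)
  have "F 0 \<le> F L"
  proof (rule DERIV_nonneg_imp_nondecreasing[OF L])
    fix t
    have "0 \<le> 2 * \<sigma> * s * exp (2 * \<sigma> * s * t) * exp (- s * t)"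
      using \<sigma> s by simp
    then show "\<exists>y. (F has_real_derivative y) (at t) \<and> 0 \<le> y"
      using F'[of t] by (intro exI conjI)
  qed
  then show "0 \<le> tail_integral \<sigma> (s * L)"
    by (simp add: F0) (simp add: F_def)
qed

context conformal_growth
begin

text \<open>Both measures change by a factor close to the density on a piece where \<open>V g\<close> is
  almost constant; the mesh \<open>\<tau>\<close> of the logarithmic subdivision tends to zero.\<close>

lemma density_action:
  assumes g: "g \<in> G"
  shows "density \<nu> (\<lambda>x. ennreal ((w g / (V g x)\<^sup>2) powr s)) = distr \<nu> \<nu> (act g)"
proof (rule measure_eqI)
  define f where "f x = ennreal ((w g / (V g x)\<^sup>2) powr s)" for x
  have f[measurable]: "f \<in> borel_measurable \<nu>"
    unfolding f_def[abs_def] by measurable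
  show "sets (density \<nu> (\<lambda>x. ennreal ((w g / (V g x)\<^sup>2) powr s))) = sets (distr \<nu> \<nu> (act g))"
    by simp
  fix A
  assume "A \<in> sets (density \<nu> (\<lambda>x. ennreal ((w g / (V g x)\<^sup>2) powr s)))"
  then have A: "A \<in> sets \<nu>"
    by simp
  then have AM: "A \<subseteq> M"
    using sets.sets_into_space by fastforce
  define m1 where "m1 = emeasure (distr \<nu> \<nu> (act g))"
  define m2 where "m2 = emeasure (density \<nu> f)"
  have key: "m1 A \<le> ennreal (exp (2 * \<tau> * s)) * m2 A \<and> m2 A \<le> ennreal (exp (2 * \<tau> * s)) * m1 A"
    if \<tau>: "0 < \<tau>" for \<tau>
  proof -
    \<comment> \<open>Level sets of \<open>V g\<close> on a logarithmic grid of mesh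
      \<open>\<tau>\<close>. As \<open>V g \<le> 1\<close>, the values \<open>- ln (V g x)\<close>
      are nonnegative and natural indices suffice.\<close>
    define B where "B j = {x \<in> A. nat \<lfloor>- ln (V g x) / \<tau>\<rfloor> = j}" for j
    have "B j = A \<inter> {x \<in> space \<nu>. nat \<lfloor>- ln (V g x) / \<tau>\<rfloor> = j}" for j
      using AM by (auto simp: B_def)
    moreover have "{x \<in> space \<nu>. nat \<lfloor>- ln (V g x) / \<tau>\<rfloor> = j} \<in> sets \<nu>" for j
      by measurable
    ultimately have B: "B j \<in> sets \<nu>" for j
      using A by simp
    have BM: "B j \<subseteq> M" for j
      using AM by (auto simp: B_def)
    have sums: "(\<Sum>j. emeasure N (B j)) = emeasure N A" if "sets N = sets \<nu>" for N
    proof -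
      have "(\<Union>j. B j) = A"
        by (auto simp: B_def)
      then show ?thesis
        using B that by (subst suminf_emeasure) (auto simp: disjoint_family_on_def B_def)
    qed
    have sum1: "(\<Sum>j. m1 (B j)) = m1 A" and sum2: "(\<Sum>j. m2 (B j)) = m2 A"
      unfolding m1_def m2_def by (simp_all add: sums)
    have piece: "m1 (B j) \<le> ennreal (exp (2 * \<tau> * s)) * m2 (B j) \<and> m2 (B j) \<le> ennreal (exp (2 * \<tau> * s)) * m1 (B j)" for j
    proof -
      define hi where "hi = exp (- real j * \<tau>)"
      define lo where "lo = hi * exp (- \<tau>)"
      have lohi: "0 < lo" "0 < hi"
        by (auto simp: lo_def hi_def)
      have V: "lo \<le> V g x \<and> V g x \<le> hi" if x: "x \<in> B j" for x
      proof -
        have xM: "x \<in> M"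
          using x BM by blast
        define y where "y = - ln (V g x) / \<tau>"
        have "0 \<le> y"
          using V_pos[OF xM, of g] V_le_1[OF xM, of g] \<tau> by (simp add: y_def divide_nonpos_pos)
        moreover have "nat \<lfloor>y\<rfloor> = j"
          using x by (simp add: B_def y_def)
        ultimately have "real j \<le> y" "y \<le> real j + 1"
          by linarith+
        then have "real j * \<tau> \<le> - ln (V g x)" "- ln (V g x) \<le> (real j + 1) * \<tau>"
          using \<tau> by (auto simp: y_def field_simps)
        then have "exp (- (real j + 1) * \<tau>) \<le> exp (ln (V g x))" "exp (ln (V g x)) \<le> exp (- real j * \<tau>)"
          by (auto simp: algebra_simps)
        then show ?thesis
          using V_pos[OF xM] by (simp add: lo_def hi_def exp_add[symmetric] algebra_simps)
      qed
      define u where "u = (w g / hi\<^sup>2) powr s"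
      have Q: "(w g / lo\<^sup>2) powr s = exp (2 * \<tau> * s) * u"
      proof -
        have "w g / lo\<^sup>2 = exp (2 * \<tau>) * (w g / hi\<^sup>2)"
          by (simp add: lo_def power_mult_distrib exp_double[symmetric] exp_minus field_simps flip: power2_eq_square exp_of_nat_mult)
        then show ?thesis
          using w_pos[of g] lohi by (simp only: u_def) (subst powr_mult, auto simp: exp_powr_real)
      qed
      have upos: "0 < u"
        using w_pos[of g] lohi by (simp add: u_def)
      have m1_eq: "m1 (B j) = H (act (iv g) ` B j) / H M"
      proof -
        \<comment> \<open>The preimage under \<open>g\<close> is the direct image under the inverse,
          to which the distortion estimates apply.\<close>
        have "act g -` B j \<inter> M = act (iv g) ` B j"
        proof
          show "act g -` B j \<inter> M \<subseteq> act (iv g) ` B j"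
            using act_iv[OF g] by (metis (no_types, lifting) IntE image_eqI subsetI vimageE)
          show "act (iv g) ` B j \<subseteq> act g -` B j \<inter> M"
            using act_iv'[OF g] act_in[OF iv_in[OF g]] BM by (auto simp: subset_iff)
        qed
        moreover have "act g -` B j \<inter> M \<in> sets \<nu>"
          using measurable_sets[OF measurable_act[OF g] B] by simp
        ultimately show ?thesis
          using B by (simp add: m1_def emeasure_distr[OF measurable_act[OF g]] emeasure_\<nu>)
      qed
      have u1: "m1 (B j) \<le> ennreal (exp (2 * \<tau> * s) * u) * emeasure \<nu> (B j)"
        unfolding m1_eq emeasure_\<nu>[OF B] Q[symmetric] ennreal_times_divide
        by (intro divide_right_mono_ennreal distortion_upper[OF g BM lohi(1)] conjunct1[OF V])
      have u2: "ennreal u * emeasure \<nu> (B j) \<le> m1 (B j)"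
      proof -
        have "ennreal u * H (B j) \<le> ennreal u * (ennreal ((hi\<^sup>2 / w g) powr s) * H (act (iv g) ` B j))"
          by (intro mult_left_mono distortion_lower[OF g BM _ lohi(2)] conjunct2[OF V]) auto
        also have "\<dots> = ennreal (u * (hi\<^sup>2 / w g) powr s) * H (act (iv g) ` B j)"
          using upos by (simp add: ennreal_mult mult.assoc)
        also have "u * (hi\<^sup>2 / w g) powr s = 1"
          using w_pos[of g] lohi by (simp add: u_def powr_divide)
        finally show ?thesis
          unfolding m1_eq emeasure_\<nu>[OF B] ennreal_times_divide
          by (intro divide_right_mono_ennreal) simp
      qed
      have m2_eq: "m2 (B j) = (\<integral>\<^sup>+x. f x * indicator (B j) x \<partial>\<nu>)"
        unfolding m2_def using B by (intro emeasure_density) auto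
      have f_le: "f x \<le> ennreal (exp (2 * \<tau> * s) * u)" "ennreal u \<le> f x" if "x \<in> B j" for x
        unfolding f_def u_def Q[symmetric, unfolded u_def] using V[OF that] lohi w_pos[of g] s_pos
        by (auto intro!: ennreal_leI powr_mono2 divide_left_mono power_mono)
      have v1: "m2 (B j) \<le> ennreal (exp (2 * \<tau> * s) * u) * emeasure \<nu> (B j)"
      proof -
        have "m2 (B j) \<le> (\<integral>\<^sup>+x. ennreal (exp (2 * \<tau> * s) * u) * indicator (B j) x \<partial>\<nu>)"
          unfolding m2_eq using f_le by (intro nn_integral_mono) (auto split: split_indicator)
        then show ?thesis
          using B by (simp add: nn_integral_cmult_indicator)
      qed
      have v2: "ennreal u * emeasure \<nu> (B j) \<le> m2 (B j)"
      proof -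
        have "(\<integral>\<^sup>+x. ennreal u * indicator (B j) x \<partial>\<nu>) \<le> m2 (B j)"
          unfolding m2_eq using f_le by (intro nn_integral_mono) (auto split: split_indicator)
        then show ?thesis
          using B by (simp add: nn_integral_cmult_indicator)
      qed
      have split: "ennreal (exp (2 * \<tau> * s) * u) * z = ennreal (exp (2 * \<tau> * s)) * (ennreal u * z)" for z
        using upos by (simp add: ennreal_mult mult.assoc)
      have "m1 (B j) \<le> ennreal (exp (2 * \<tau> * s)) * m2 (B j)"
        using u1 unfolding split by (rule order_trans) (intro mult_left_mono v2, simp)
      moreover have "m2 (B j) \<le> ennreal (exp (2 * \<tau> * s)) * m1 (B j)"
        using v1 unfolding split by (rule order_trans) (intro mult_left_mono u2, simp)
      ultimately show ?thesis
        by simp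
    qed
    have "m1 A \<le> (\<Sum>j. ennreal (exp (2 * \<tau> * s)) * m2 (B j))"
      unfolding sum1[symmetric] using piece by (intro suminf_le) auto
    moreover have "m2 A \<le> (\<Sum>j. ennreal (exp (2 * \<tau> * s)) * m1 (B j))"
      unfolding sum2[symmetric] using piece by (intro suminf_le) auto
    ultimately show ?thesis
      by (simp add: sum1 sum2)
  qed
  \<comment> \<open>Finiteness allows the two masses to be compared as real numbers when
    \<open>\<tau>\<close> tends to 0.\<close>
  have fin1: "m1 A < top_class.top"
    unfolding m1_def emeasure_distr[OF measurable_act[OF g] A]
    unfolding less_top[symmetric] by simp
  then have fin2: "m2 A < top_class.top"
    using key[of 1] by (auto intro: le_less_trans simp: ennreal_mult_less_top)
  obtain u v where uv: "m1 A = ennreal u" "m2 A = ennreal v" "0 \<le> u" "0 \<le> v"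
    using fin1 fin2 by (cases "m1 A"; cases "m2 A") auto
  have le: "u \<le> exp (2 * \<tau> * s) * v" "v \<le> exp (2 * \<tau> * s) * u" if "0 < \<tau>" for \<tau>
    using key[OF that] uv by (auto simp: ennreal_mult[symmetric])
  have lim: "((\<lambda>\<tau>. exp (2 * \<tau> * s) * z) \<longlongrightarrow> exp (2 * 0 * s) * z) (at_right 0)" for z
    by (intro tendsto_intros)
  have "u \<le> exp (2 * 0 * s) * v"
    by (rule tendsto_lowerbound[OF lim]) (auto intro!: eventually_at_rightI[of 0 1] le)
  moreover have "v \<le> exp (2 * 0 * s) * u"
    by (rule tendsto_lowerbound[OF lim]) (auto intro!: eventually_at_rightI[of 0 1] le)
  ultimately have "m1 A = m2 A"
    using uv by simp
  then show "emeasure (density \<nu> (\<lambda>x. ennreal ((w g / (V g x)\<^sup>2) powr s))) A = emeasure (distr \<nu> \<nu> (act g)) A"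
    by (simp add: m1_def m2_def f_def[abs_def])
qed

definition sph :: "'g \<Rightarrow> real \<Rightarrow> real" where
  "sph g \<sigma> = (\<integral>x. enn2real (RN_deriv \<nu> (distr \<nu> \<nu> (act g)) x) powr \<sigma> \<partial>\<nu>)"

text \<open>The value that the integral would take if the set where \<open>- ln (V g x)\<close> is
  at least \<open>t\<close> had mass exactly \<open>exp (- s * t)\<close> for all \<open>t\<close>
  from 0 to \<open>- ln (w g)\<close>, and mass 0 beyond.\<close>

definition bound :: "'g \<Rightarrow> real \<Rightarrow> real" where
  "bound g \<sigma> = w g powr (s * \<sigma>) * (1 + tail_integral \<sigma> (s * - ln (w g)))"

lemma spherical_bounds:
  "\<exists>B\<ge>1. \<forall>g\<in>G. \<forall>\<sigma>\<in>{0..1}. sph g \<sigma> \<in> {bound g \<sigma> / B .. B * bound g \<sigma>}"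
proof -
  obtain b where b: "0 < b"
    "\<And>x \<rho>. x \<in> M \<Longrightarrow> 0 < \<rho> \<Longrightarrow> \<rho> \<le> 1 \<Longrightarrow> ennreal (b * \<rho> powr s) * H M \<le> H {y \<in> M. d y x \<le> \<rho>}"
    using mass_lower by metis
  obtain v where v: "1 \<le> v" "\<And>g. g \<in> G \<Longrightarrow> \<exists>x\<in>M. V g x \<le> v * w g"
    using visible_point by metis
  \<comment> \<open>On the ball of radius \<open>exp (- t)\<close> about a visible point,
    \<open>V g\<close> is at most \<open>(1 + v) * exp (- t)\<close>; the superlevel sets are
    therefore shifted by \<open>ln (1 + v)\<close>.\<close>
  define \<tau> where "\<tau> = ln (1 + v)"
  have \<tau>: "0 \<le> \<tau>" "exp \<tau> = 1 + v"
    using v(1) by (auto simp: \<tau>_def)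
  have one: "emeasure \<nu> M = 1"
    using \<nu>_facts(4) by simp
  have sets: "{x \<in> M. t \<le> - ln (V g x) + a} \<in> sets \<nu>" for g t a
  proof -
    have "{x \<in> space \<nu>. t \<le> - ln (V g x) + a} \<in> sets \<nu>"
      by measurable
    then show ?thesis
      by simp
  qed
  have upper: "emeasure \<nu> {x \<in> M. t \<le> - ln (V g x)} \<le> ennreal ((2 * C) powr s * exp (- s * t))" for g t
  proof -
    let ?A = "{x \<in> M. t \<le> - ln (V g x)}"
    have "V g x \<le> exp (- t)" if "x \<in> ?A" for x
      using that V_pos[of x g] by (simp add: ln_ge_iff le_minus_iff) (metis exp_ln exp_le_cancel_iff le_minus_iff)
    \<comment> \<open>By \<open>d_le\<close> through the common orbit point this set has diameter at
      most \<open>2 * exp (- t)\<close>.\<close>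
    then have "H ?A \<le> ennreal ((C * (2 * exp (- t))) powr s) * H M"
      using d_le[of _ _ g] by (intro mass_upper) (auto, smt (verit))
    moreover have "(C * (2 * exp (- t))) powr s = (2 * C) powr s * exp (- s * t)"
      using C_ge_1 by (simp add: powr_mult exp_powr_real mult_ac)
    moreover have "?A \<in> sets \<nu>"
      using sets[of t g 0] by simp
    ultimately show ?thesis
      using H_divide[of "H ?A"] by (simp add: emeasure_\<nu>)
  qed
  have lower: "ennreal (b * exp (- s * t)) \<le> emeasure \<nu> {x \<in> M. t \<le> - ln (V g x) + \<tau>}"
    if g: "g \<in> G" and t: "0 \<le> t" "t \<le> - ln (w g)" for g t
  proof -
    obtain x0 where x0: "x0 \<in> M" "V g x0 \<le> v * w g"
      using v(2)[OF g] by blast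
    have "{y \<in> M. d y x0 \<le> exp (- t)} \<subseteq> {x \<in> M. t \<le> - ln (V g x) + \<tau>}"
    proof safe
      fix y
      assume y: "y \<in> M" "d y x0 \<le> exp (- t)"
      have "w g \<le> exp (- t)"
        using t(2) w_pos[of g] by (metis exp_ln exp_le_cancel_iff le_minus_iff)
      then have "v * w g \<le> v * exp (- t)"
        using v(1) by (intro mult_left_mono) auto
      then have "V g y \<le> (1 + v) * exp (- t)"
        using V_le[OF y(1) x0(1), of g] y(2) x0(2) by (simp add: algebra_simps)
      also have "\<dots> = exp (\<tau> - t)"
        by (simp add: \<tau> exp_diff exp_minus divide_inverse)
      finally have "ln (V g y) \<le> \<tau> - t"
        using V_pos[OF y(1), of g] by (metis exp_le_cancel_iff exp_ln)
      then show "t \<le> - ln (V g y) + \<tau>"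
        by simp
    qed
    then have "ennreal (b * exp (- t) powr s) * H M \<le> H {x \<in> M. t \<le> - ln (V g x) + \<tau>}"
      using b(2)[OF x0(1), of "exp (- t)"] t(1) by (auto intro: order_trans H_mono)
    moreover have "exp (- t) powr s = exp (- s * t)"
      by (simp add: exp_powr_real mult.commute)
    ultimately have "ennreal (b * exp (- s * t)) * H M / H M \<le> emeasure \<nu> {x \<in> M. t \<le> - ln (V g x) + \<tau>}"
      by (simp only: emeasure_\<nu>[OF sets] divide_right_mono_ennreal)
    then show ?thesis
      using H_finite H_positive by (simp add: mult_divide_eq_ennreal)
  qed
  \<comment> \<open>The first part serves the upper bound; the second pays for the shift by
    \<open>\<tau>\<close> and for a small \<open>b\<close> in the lower bound.\<close>
  define B where "B = max (max 1 ((2 * C) powr s)) (exp (2 * s * \<tau>) * max 1 (1 / b))"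
  have B: "1 \<le> B" "(2 * C) powr s \<le> B" "exp (2 * s * \<tau>) * max 1 (1 / b) \<le> B"
    by (auto simp: B_def)
  have "sph g \<sigma> \<in> {bound g \<sigma> / B .. B * bound g \<sigma>}"
    if g: "g \<in> G" and \<sigma>: "0 \<le> \<sigma>" "\<sigma> \<le> 1" for g \<sigma>
  proof -
    define L where "L = - ln (w g)"
    obtain y where "y \<in> M"
      using M_nonempty by blast
    then have "w g \<le> 1"
      using w_le_V[of y g] V_le_1[of y g] by simp
    then have L: "0 \<le> L"
      using w_pos[of g] by (simp add: L_def)
    define J where "J = tail_integral \<sigma> (s * L)"
    define k where "k = 2 * \<sigma> * s"
    have k: "0 \<le> k" "k \<le> 2 * s"
      using \<sigma> s_pos by (auto simp: k_def)
    have J: "0 \<le> J"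
      unfolding J_def by (rule tail_integral(2)[OF \<sigma>(1) s_pos L order_refl])
    have XL: "0 \<le> - ln (V g x)" "- ln (V g x) \<le> L" if "x \<in> M" for x
      using V_pos[OF that, of g] V_le_1[OF that, of g] w_le_V[OF that, of g] w_pos[of g] by (auto simp: L_def)
    define I where "I = (\<integral>\<^sup>+x. ennreal (exp (k * - ln (V g x))) \<partial>\<nu>)"
    \<comment> \<open>\<open>- ln (V g x)\<close> never exceeds \<open>L\<close>, so truncation
      changes nothing here; it takes effect for the shifted function in the lower bound.\<close>
    have "I = (\<integral>\<^sup>+x. ennreal (exp (k * min (- ln (V g x)) L)) \<partial>\<nu>)"
      unfolding I_def using XL by (intro nn_integral_cong) (simp add: min_absorb1)
    also have "\<dots> = emeasure \<nu> (space \<nu>) +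
        (\<integral>\<^sup>+t. ennreal (k * exp (k * t)) * emeasure \<nu> {x \<in> space \<nu>. t \<le> - ln (V g x)} * indicator {0..L} t \<partial>lborel)"
      using XL k L by (intro layer_cake \<nu>.sigma_finite_measure_axioms) auto
    also have "\<dots> \<le> 1 + (\<integral>\<^sup>+t. ennreal (k * exp (k * t)) * ennreal ((2 * C) powr s * exp (- s * t)) * indicator {0..L} t \<partial>lborel)"
      using upper by (intro add_mono nn_integral_mono mult_right_mono mult_left_mono) (auto simp: one)
    also have "\<dots> = 1 + ennreal ((2 * C) powr s * J)"
      unfolding k_def J_def by (subst tail_integral(1)[OF \<sigma>(1) s_pos L]) auto
    also have "\<dots> = ennreal (1 + (2 * C) powr s * J)"
      using J by simp
    also have "\<dots> \<le> ennreal (B * (1 + J))"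
      using B(1) mult_right_mono[OF B(2) J] by (intro ennreal_leI) (simp add: algebra_simps)
    finally have I_upper: "I \<le> ennreal (B * (1 + J))" .
    have "ennreal (1 + b * J) = 1 + ennreal (b * J)"
      using J b(1) by simp
    also have "\<dots> = 1 + (\<integral>\<^sup>+t. ennreal (k * exp (k * t)) * ennreal (b * exp (- s * t)) * indicator {0..L} t \<partial>lborel)"
      unfolding k_def J_def by (subst tail_integral(1)[OF \<sigma>(1) s_pos L]) (use b in auto)
    also have "\<dots> \<le> emeasure \<nu> (space \<nu>) +
        (\<integral>\<^sup>+t. ennreal (k * exp (k * t)) * emeasure \<nu> {x \<in> space \<nu>. t \<le> - ln (V g x) + \<tau>} * indicator {0..L} t \<partial>lborel)"
      using lower[OF g] by (intro add_mono nn_integral_mono) (auto simp: one L_def split: split_indicator intro!: mult_left_mono)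
    also have "\<dots> = (\<integral>\<^sup>+x. ennreal (exp (k * min (- ln (V g x) + \<tau>) L)) \<partial>\<nu>)"
      using add_nonneg_nonneg[OF XL(1) \<tau>(1)] k L
      by (intro layer_cake[symmetric] \<nu>.sigma_finite_measure_axioms) auto
    \<comment> \<open>Dropping the truncation increases the integrand, and the shift costs at most
      \<open>exp (2 * s * \<tau>)\<close> for every \<open>\<sigma> \<le> 1\<close> because
      \<open>k \<le> 2 * s\<close>.\<close>
    also have "\<dots> \<le> (\<integral>\<^sup>+x. ennreal (exp (2 * s * \<tau>)) * ennreal (exp (k * - ln (V g x))) \<partial>\<nu>)"
    proof (rule nn_integral_mono)
      fix x
      have "k * min (- ln (V g x) + \<tau>) L \<le> k * (- ln (V g x) + \<tau>)"
        using k by (intro mult_left_mono) auto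
      also have "\<dots> \<le> 2 * s * \<tau> + k * - ln (V g x)"
        using mult_right_mono[OF k(2) \<tau>(1)] by (simp add: algebra_simps)
      finally show "ennreal (exp (k * min (- ln (V g x) + \<tau>) L)) \<le> ennreal (exp (2 * s * \<tau>)) * ennreal (exp (k * - ln (V g x)))"
        by (simp add: ennreal_mult[symmetric] exp_add[symmetric] ennreal_leI)
    qed
    also have "\<dots> = ennreal (exp (2 * s * \<tau>)) * I"
      unfolding I_def by (rule nn_integral_cmult) measurable
    finally have I_lower: "ennreal (1 + b * J) \<le> ennreal (exp (2 * s * \<tau>)) * I" .
    obtain i where i: "I = ennreal i" "0 \<le> i"
      using le_less_trans[OF I_upper ennreal_less_top] by (cases I) auto
    have i1: "i \<le> B * (1 + J)"
      using I_upper i B(1) J by (simp add: ennreal_le_iff)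
    have i2: "1 + b * J \<le> exp (2 * s * \<tau>) * i"
      using I_lower i b(1) J by (simp add: ennreal_mult[symmetric] del: ennreal_plus)
    have i3: "(1 + J) / B \<le> i"
    proof -
      have "1 + J \<le> max 1 (1 / b) * (1 + b * J)"
      proof -
        have "1 / b * (b * J) \<le> max 1 (1 / b) * (b * J)"
          using b(1) J by (intro mult_right_mono) auto
        moreover have "1 / b * (b * J) = J" "1 \<le> max 1 (1 / b)"
          using b(1) by auto
        ultimately show ?thesis
          unfolding distrib_left by linarith
      qed
      also have "\<dots> \<le> max 1 (1 / b) * (exp (2 * s * \<tau>) * i)"
        using i2 by (intro mult_left_mono) auto
      also have "\<dots> = (exp (2 * s * \<tau>) * max 1 (1 / b)) * i"
        by (simp only: mult_ac)
      also have "\<dots> \<le> B * i"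
        using B(3) i(2) by (rule mult_right_mono)
      finally show ?thesis
        using B(1) by (simp add: field_simps)
    qed
    have "sph g \<sigma> = (\<integral>x. w g powr (s * \<sigma>) * exp (k * - ln (V g x)) \<partial>\<nu>)"
      unfolding sph_def
    proof (rule integral_cong_AE)
      have "AE x in \<nu>. ennreal ((w g / (V g x)\<^sup>2) powr s) = RN_deriv \<nu> (distr \<nu> \<nu> (act g)) x"
        by (rule \<nu>.RN_deriv_unique[OF _ density_action[OF g]]) measurable
      then show "AE x in \<nu>. enn2real (RN_deriv \<nu> (distr \<nu> \<nu> (act g)) x) powr \<sigma> = w g powr (s * \<sigma>) * exp (k * - ln (V g x))"
      proof (rule AE_mp, intro AE_I2 impI)
        fix x
        assume x: "x \<in> space \<nu>" and eq: "ennreal ((w g / (V g x)\<^sup>2) powr s) = RN_deriv \<nu> (distr \<nu> \<nu> (act g)) x"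
        have Vx: "0 < V g x"
          using x V_pos by simp
        have "enn2real (RN_deriv \<nu> (distr \<nu> \<nu> (act g)) x) powr \<sigma> = (w g / (V g x)\<^sup>2) powr (s * \<sigma>)"
          by (simp add: eq[symmetric] powr_powr)
        also have "\<dots> = w g powr (s * \<sigma>) * exp (k * - ln (V g x))"
          using Vx w_pos[of g] by (simp add: powr_def ln_div ln_realpow k_def exp_add[symmetric] algebra_simps)
        finally show "enn2real (RN_deriv \<nu> (distr \<nu> \<nu> (act g)) x) powr \<sigma> = w g powr (s * \<sigma>) * exp (k * - ln (V g x))" .
      qed
    qed measurable
    also have "\<dots> = w g powr (s * \<sigma>) * (\<integral>x. exp (k * - ln (V g x)) \<partial>\<nu>)"
      by simp
    also have "(\<integral>x. exp (k * - ln (V g x)) \<partial>\<nu>) = i"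
      using i by (subst integral_eq_nn_integral) (auto simp: I_def)
    finally have eq: "sph g \<sigma> = w g powr (s * \<sigma>) * i" .
    have "w g powr (s * \<sigma>) * ((1 + J) / B) \<le> w g powr (s * \<sigma>) * i"
      by (intro mult_left_mono i3) simp
    moreover have "w g powr (s * \<sigma>) * i \<le> w g powr (s * \<sigma>) * (B * (1 + J))"
      by (intro mult_left_mono i1) simp
    ultimately show ?thesis
      unfolding eq bound_def by (simp add: J_def L_def mult_ac)
  qed
  with B(1) show ?thesis
    by auto
qed

end

section \<open>The Gromov boundary of a strongly hyperbolic space\<close>

text \<open>Strong hyperbolicity is its triangle inequality. On the diagonal it does not vanish but
  equals \<open>exp (- \<epsilon> * dist x q)\<close>, so it becomes a metric only at
  infinity.\<close>

definition visual_kernel :: "real \<Rightarrow> 'a::metric_space \<Rightarrow> 'a \<Rightarrow> 'a \<Rightarrow> real" where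
  "visual_kernel \<epsilon> q x y = exp (- \<epsilon> * gromov_product q x y)"

locale strongly_hyperbolic_space =
  fixes p :: "'a::metric_space" and \<epsilon> :: real
  assumes eps_pos: "0 < \<epsilon>"
    and kernel_triangle': "\<And>q x y z :: 'a. visual_kernel \<epsilon> q x y \<le> visual_kernel \<epsilon> q x z + visual_kernel \<epsilon> q z y"
begin

abbreviation E :: "'a \<Rightarrow> 'a \<Rightarrow> real" where "E \<equiv> visual_kernel \<epsilon> p"
abbreviation conv :: "(nat \<Rightarrow> 'a) \<Rightarrow> bool" where "conv \<equiv> converges_at_infinity p"
abbreviation M :: "(nat \<Rightarrow> 'a) set set" where "M \<equiv> gromov_boundary p"
abbreviation D :: "(nat \<Rightarrow> 'a) set \<Rightarrow> (nat \<Rightarrow> 'a) set \<Rightarrow> real" where "D \<equiv> boundary_dist \<epsilon> p"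

text \<open>The extension of the kernel to one boundary argument; the choice of representative is
  immaterial by \<open>tendsto_V\<close>.\<close>

definition V :: "(nat \<Rightarrow> 'a) set \<Rightarrow> 'a \<Rightarrow> real" where
  "V \<xi> y = lim (\<lambda>n. E ((SOME u. u \<in> \<xi>) n) y)"

lemma kernel_pos [simp]: "0 < E x y"
  by (simp add: visual_kernel_def)

lemma kernel_nonneg [simp]: "0 \<le> E x y"
  by (simp add: visual_kernel_def)

lemma kernel_commute: "E x y = E y x"
  by (simp add: visual_kernel_def gromov_product_def dist_commute algebra_simps)

lemma kernel_triangle: "E x y \<le> E x z + E z y"
  by (rule kernel_triangle')

lemma kernel_triangle_r: "E x y \<le> E x z + E y z"
  using kernel_triangle[of x y z] kernel_commute[of z y] by simp

lemma kernel_triangle_l: "E x y \<le> E z x + E z y"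
  using kernel_triangle[of x y z] kernel_commute[of z x] by simp

lemma kernel_le_1: "E x y \<le> 1"
proof -
  have "0 \<le> gromov_product p x y"
    using dist_triangle[of x y p] by (simp add: gromov_product_def dist_commute)
  then show ?thesis
    using eps_pos by (simp add: visual_kernel_def)
qed

lemma kernel_ge: "exp (- \<epsilon> * dist p y) \<le> E x y"
proof -
  have "gromov_product p x y \<le> dist p y"
    using dist_triangle[of x p y] by (simp add: gromov_product_def dist_commute)
  then show ?thesis
    using eps_pos by (simp add: visual_kernel_def)
qed

text \<open>Lipschitz control of the kernel by itself: the reason why the limits below exist and do
  not depend on representatives.\<close>

lemma kernel_abs_le: "\<bar>E x y - E z y\<bar> \<le> E x z"
  using kernel_triangle[of x y z] kernel_triangle[of z y x] kernel_commute[of x z] by linarith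

text \<open>For Gromov products based at \<open>p\<close>,
  \<open>(gx, gy) + (x, q) + (y, q) = (x, y) + d(p, q)\<close> by cancellation of distances. This
  exact identity is the source of conformality on the boundary.\<close>

lemma kernel_isometry:
  assumes iso: "\<And>x y. dist (g x) (g y) = dist x y" and q: "g q = p"
  shows "E (g x) (g y) * E x q * E y q = E x y * exp (- \<epsilon> * dist p q)"
proof -
  have *: "dist p (g z) = dist q z" for z
    using iso[of q z] q by simp
  have "exp (- \<epsilon> * gromov_product p (g x) (g y)) * exp (- \<epsilon> * gromov_product p x q)
      * exp (- \<epsilon> * gromov_product p y q)
      = exp (- \<epsilon> * gromov_product p x y) * exp (- \<epsilon> * dist p q)"
    unfolding exp_add[symmetric]
    by (rule arg_cong[where f = exp])
      (simp add: gromov_product_def iso * dist_commute field_simps)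
  then show ?thesis
    by (simp add: visual_kernel_def)
qed

lemma kernel_base [simp]: "E x p = 1"
  by (simp add: visual_kernel_def gromov_product_def)

lemma kernel_base' [simp]: "E p x = 1"
  using kernel_commute[of p x] by simp

lemma kernel_less_iff: "E x y < exp (- \<epsilon> * Z) \<longleftrightarrow> Z < gromov_product p x y"
  using eps_pos by (simp add: visual_kernel_def)

text \<open>As \<open>Z\<close> varies, \<open>exp (- \<epsilon> * Z)\<close> runs through all
  positive reals; divergence of Gromov products thus becomes smallness of the kernel.\<close>

lemma all_exp_iff: "(\<forall>Z. P (exp (- \<epsilon> * Z))) \<longleftrightarrow> (\<forall>e>0. P e)"
proof safe
  fix e :: real
  assume *: "\<forall>Z. P (exp (- \<epsilon> * Z))" and e: "0 < e"
  have "exp (- \<epsilon> * (- ln e / \<epsilon>)) = e"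
    using e eps_pos by simp
  with * show "P e"
    by metis
qed simp

lemma conv_iff: "conv u \<longleftrightarrow> (\<forall>e>0. \<exists>N. \<forall>m\<ge>N. \<forall>n\<ge>N. E (u m) (u n) < e)"
proof -
  have "conv u \<longleftrightarrow> (\<forall>Z. \<exists>N. \<forall>m\<ge>N. \<forall>n\<ge>N. E (u n) (u m) < exp (- \<epsilon> * Z))"
    unfolding converges_at_infinity_def filterlim_at_top_dense eventually_prod_sequentially
      kernel_less_iff by simp
  also have "\<dots> \<longleftrightarrow> (\<forall>Z. \<exists>N. \<forall>m\<ge>N. \<forall>n\<ge>N. E (u m) (u n) < exp (- \<epsilon> * Z))"
    by blast
  finally show ?thesis
    using all_exp_iff[of "\<lambda>e. \<exists>N. \<forall>m\<ge>N. \<forall>n\<ge>N. E (u m) (u n) < e"] by blast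
qed

lemma kernel_tendsto_0_iff:
  "(\<lambda>n. E (u n) (v n)) \<longlonglongrightarrow> 0 \<longleftrightarrow> filterlim (\<lambda>n. gromov_product p (u n) (v n)) at_top sequentially"
proof -
  have "(\<lambda>n. E (u n) (v n)) \<longlonglongrightarrow> 0 \<longleftrightarrow> (\<forall>e>0. \<forall>\<^sub>F n in sequentially. E (u n) (v n) < e)"
    by (simp add: tendsto_iff)
  then show ?thesis
    unfolding filterlim_at_top_dense kernel_less_iff[symmetric]
    using all_exp_iff[of "\<lambda>e. \<forall>\<^sub>F n in sequentially. E (u n) (v n) < e"] by blast
qed

lemma rel_iff: "(u, v) \<in> boundary_rel p \<longleftrightarrow> conv u \<and> conv v \<and> (\<lambda>n. E (u n) (v n)) \<longlonglongrightarrow> 0"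
  by (simp add: boundary_rel_def kernel_tendsto_0_iff)

lemma conv_diag: "conv u \<Longrightarrow> (\<lambda>n. E (u n) (u n)) \<longlonglongrightarrow> 0"
  unfolding conv_iff tendsto_iff eventually_sequentially by simp blast

lemma equiv_rel: "equiv {u. conv u} (boundary_rel p)"
proof (rule equivI)
  show "boundary_rel p \<subseteq> {u. conv u} \<times> {u. conv u}"
    by (auto simp: boundary_rel_def)
  show "refl_on {u. conv u} (boundary_rel p)"
    by (auto simp: refl_on_def rel_iff conv_diag)
  show "sym (boundary_rel p)"
    by (auto simp: sym_def rel_iff kernel_commute)
  show "trans (boundary_rel p)"
    unfolding trans_def rel_iff
  proof safe
    fix u v w
    assume *: "(\<lambda>n. E (u n) (v n)) \<longlonglongrightarrow> 0" "(\<lambda>n. E (v n) (w n)) \<longlonglongrightarrow> 0"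
    have lim: "(\<lambda>n. E (u n) (v n) + E (v n) (w n)) \<longlonglongrightarrow> 0"
      using tendsto_add[OF *] by simp
    show "(\<lambda>n. E (u n) (w n)) \<longlonglongrightarrow> 0"
      by (rule tendsto_sandwich[OF _ _ tendsto_const lim]) (auto simp: kernel_triangle)
  qed
qed

lemma boundary_conv: "\<xi> \<in> M \<Longrightarrow> u \<in> \<xi> \<Longrightarrow> conv u"
  using in_quotient_imp_subset[OF equiv_rel] by (auto simp: gromov_boundary_def)

lemma boundary_nonempty: "\<xi> \<in> M \<Longrightarrow> \<xi> \<noteq> {}"
  using in_quotient_imp_non_empty[OF equiv_rel] by (auto simp: gromov_boundary_def)

lemma boundary_rel_in: "\<xi> \<in> M \<Longrightarrow> u \<in> \<xi> \<Longrightarrow> v \<in> \<xi> \<Longrightarrow> (u, v) \<in> boundary_rel p"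
  using in_quotient_imp_in_rel[OF equiv_rel] by (auto simp: gromov_boundary_def)

lemma boundary_closed: "\<xi> \<in> M \<Longrightarrow> u \<in> \<xi> \<Longrightarrow> (u, v) \<in> boundary_rel p \<Longrightarrow> v \<in> \<xi>"
  using in_quotient_imp_closed[OF equiv_rel] by (auto simp: gromov_boundary_def)

lemma boundary_class: "conv u \<Longrightarrow> boundary_rel p `` {u} \<in> M" "conv u \<Longrightarrow> u \<in> boundary_rel p `` {u}"
  using equiv_class_self[OF equiv_rel] by (auto simp: gromov_boundary_def intro!: quotientI)

lemma boundary_eqI: "\<xi> \<in> M \<Longrightarrow> \<eta> \<in> M \<Longrightarrow> u \<in> \<xi> \<Longrightarrow> v \<in> \<eta> \<Longrightarrow> (u, v) \<in> boundary_rel p \<Longrightarrow> \<xi> = \<eta>"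
  using quotient_eqI[OF equiv_rel] by (auto simp: gromov_boundary_def)

section \<open>Continuous extension of the kernel to the boundary, and completeness\<close>

lemma kernel_convergent:
  assumes "conv u" "conv v"
  shows "convergent (\<lambda>n. E (u n) (v n))"
proof -
  have "Cauchy (\<lambda>n. E (u n) (v n))"
  proof (rule metric_CauchyI)
    fix e :: real
    assume "0 < e"
    then obtain N1 N2 where N: "\<And>m n. m \<ge> N1 \<Longrightarrow> n \<ge> N1 \<Longrightarrow> E (u m) (u n) < e / 2"
      "\<And>m n. m \<ge> N2 \<Longrightarrow> n \<ge> N2 \<Longrightarrow> E (v m) (v n) < e / 2"
      using assms unfolding conv_iff by (metis half_gt_zero)
    have "dist (E (u m) (v m)) (E (u n) (v n)) < e" if "m \<ge> max N1 N2" "n \<ge> max N1 N2" for m n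
      using that N(1)[of m n] N(2)[of m n] kernel_abs_le[of "u m" "v m" "u n"]
        kernel_abs_le[of "v m" "u n" "v n"]
      unfolding dist_real_def kernel_commute[of "v _" "u n"] by simp
    then show "\<exists>K. \<forall>m\<ge>K. \<forall>n\<ge>K. dist (E (u m) (v m)) (E (u n) (v n)) < e"
      by blast
  qed
  then show ?thesis
    by (simp add: Cauchy_convergent_iff)
qed

lemma kernel_convergent_point:
  assumes "conv u"
  shows "convergent (\<lambda>n. E (u n) y)"
proof -
  have "Cauchy (\<lambda>n. E (u n) y)"
    using assms le_less_trans[OF kernel_abs_le] unfolding conv_iff Cauchy_def dist_real_def by meson
  then show ?thesis
    by (simp add: Cauchy_convergent_iff)
qed

lemma tendsto_V:
  assumes "\<xi> \<in> M" "u \<in> \<xi>"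
  shows "(\<lambda>n. E (u n) y) \<longlonglongrightarrow> V \<xi> y"
proof -
  define v where "v = (SOME v. v \<in> \<xi>)"
  have v: "v \<in> \<xi>"
    using assms unfolding v_def by (metis someI)
  have 1: "(\<lambda>n. E (v n) y) \<longlonglongrightarrow> V \<xi> y"
    using kernel_convergent_point[OF boundary_conv[OF assms(1) v]]
    by (simp add: V_def v_def convergent_LIMSEQ_iff)
  have 2: "(\<lambda>n. E (v n) (u n)) \<longlonglongrightarrow> 0"
    using boundary_rel_in[OF assms(1) v assms(2)] by (simp add: rel_iff)
  have "(\<lambda>n. E (u n) y - E (v n) y) \<longlonglongrightarrow> 0"
    using kernel_abs_le[of "u _" y "v _"]
    by (intro Lim_null_comparison[OF _ 2] always_eventually) (simp add: kernel_commute[of "v _" "u _"])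
  from tendsto_add[OF this 1] show ?thesis
    by simp
qed

text \<open>\<open>boundary_product\<close> is a definite description, so its limit must be
  exhibited for all pairs of representatives at once and shown to be unique.\<close>

lemma tendsto_D:
  assumes \<xi>: "\<xi> \<in> M" "u \<in> \<xi>" and \<eta>: "\<eta> \<in> M" "v \<in> \<eta>"
  shows "(\<lambda>n. E (u n) (v n)) \<longlonglongrightarrow> D \<xi> \<eta>"
proof -
  have "convergent (\<lambda>n. E (u n) (v n))"
    using assms boundary_conv by (intro kernel_convergent) auto
  then obtain l where l: "(\<lambda>n. E (u n) (v n)) \<longlonglongrightarrow> l"
    by (auto simp: convergent_def)
  have all: "(\<lambda>n. E (u' n) (v' n)) \<longlonglongrightarrow> l" if "u' \<in> \<xi>" "v' \<in> \<eta>" for u' v'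
  proof -
    have uv: "(\<lambda>n. E (u n) (u' n) + E (v n) (v' n)) \<longlonglongrightarrow> 0"
      using tendsto_add[of "\<lambda>n. E (u n) (u' n)" 0 _ "\<lambda>n. E (v n) (v' n)" 0]
        boundary_rel_in[OF \<xi> that(1)] boundary_rel_in[OF \<eta> that(2)] by (simp add: rel_iff)
    have "\<bar>E (u' n) (v' n) - E (u n) (v n)\<bar> \<le> E (u n) (u' n) + E (v n) (v' n)" for n
      using kernel_abs_le[of "u' n" "v' n" "u n"] kernel_abs_le[of "v' n" "u n" "v n"]
      by (simp add: kernel_commute)
    then have "(\<lambda>n. E (u' n) (v' n) - E (u n) (v n)) \<longlonglongrightarrow> 0"
      by (intro Lim_null_comparison[OF _ uv]) (auto intro!: always_eventually)
    from tendsto_add[OF this l] show ?thesis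
      by simp
  qed
  have l0: "0 \<le> l"
    using l by (rule LIMSEQ_le_const) simp
  \<comment> \<open>The product is infinite exactly when the kernel tends to 0, matching the
    convention in \<open>boundary_dist\<close>.\<close>
  define L where "L = (if l = 0 then \<infinity> else ereal (- ln l / \<epsilon>))"
  have L: "(\<lambda>n. ereal (gromov_product p (u' n) (v' n))) \<longlonglongrightarrow> L" if "u' \<in> \<xi>" "v' \<in> \<eta>" for u' v'
  proof (cases "l = 0")
    case True
    then have "filterlim (\<lambda>n. gromov_product p (u' n) (v' n)) at_top sequentially"
      using all[OF that] by (simp add: kernel_tendsto_0_iff)
    then show ?thesis
      using True by (simp add: L_def tendsto_PInfty filterlim_at_top_dense)
  next
    case False
    have "(\<lambda>n. - ln (E (u' n) (v' n)) / \<epsilon>) \<longlonglongrightarrow> - ln l / \<epsilon>"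
      using False all[OF that] eps_pos by (intro tendsto_intros) auto
    moreover have "- ln (E x y) / \<epsilon> = gromov_product p x y" for x y
      using eps_pos by (simp add: visual_kernel_def)
    ultimately show ?thesis
      using False by (simp add: L_def)
  qed
  have "boundary_product p \<xi> \<eta> = L"
    unfolding boundary_product_def
  proof (rule the_equality)
    show "\<forall>u\<in>\<xi>. \<forall>v\<in>\<eta>. (\<lambda>n. ereal (gromov_product p (u n) (v n))) \<longlonglongrightarrow> L"
      using L by blast
    show "l' = L" if "\<forall>u\<in>\<xi>. \<forall>v\<in>\<eta>. (\<lambda>n. ereal (gromov_product p (u n) (v n))) \<longlonglongrightarrow> l'" for l'
      using that L \<xi>(2) \<eta>(2) LIMSEQ_unique by blast
  qed
  then have "D \<xi> \<eta> = l"
    using l0 eps_pos by (simp add: boundary_dist_def L_def)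
  then show ?thesis
    using l by simp
qed

lemma D_le_V: assumes "\<xi> \<in> M" "\<eta> \<in> M" shows "D \<xi> \<eta> \<le> V \<xi> y + V \<eta> y"
proof -
  obtain u v where u: "u \<in> \<xi>" "v \<in> \<eta>" using boundary_nonempty assms by blast
  show ?thesis
    by (rule LIMSEQ_le[OF tendsto_D[OF assms(1) u(1) assms(2) u(2)]
          tendsto_add[OF tendsto_V[OF assms(1) u(1)] tendsto_V[OF assms(2) u(2)]]])
      (auto intro: kernel_triangle_r)
qed

lemma V_le_D: assumes "\<xi> \<in> M" "\<eta> \<in> M" shows "V \<xi> y \<le> D \<xi> \<eta> + V \<eta> y"
proof -
  obtain u v where u: "u \<in> \<xi>" "v \<in> \<eta>" using boundary_nonempty assms by blast
  show ?thesis
    by (rule LIMSEQ_le[OF tendsto_V[OF assms(1) u(1)]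
          tendsto_add[OF tendsto_D[OF assms(1) u(1) assms(2) u(2)] tendsto_V[OF assms(2) u(2)]]])
      (auto intro: kernel_triangle)
qed

lemma kernel_le_V: assumes "\<xi> \<in> M" shows "E x y \<le> V \<xi> x + V \<xi> y"
proof -
  obtain u where u: "u \<in> \<xi>" using boundary_nonempty assms by blast
  show ?thesis
    by (rule LIMSEQ_le_const[OF tendsto_add[OF tendsto_V[OF assms u] tendsto_V[OF assms u]]])
      (auto intro: kernel_triangle_l)
qed

lemma V_bounds: assumes "\<xi> \<in> M" shows "exp (- \<epsilon> * dist p y) \<le> V \<xi> y" "V \<xi> y \<le> 1"
proof -
  obtain u where u: "u \<in> \<xi>" using boundary_nonempty assms by blast
  show "exp (- \<epsilon> * dist p y) \<le> V \<xi> y"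
    by (rule LIMSEQ_le_const[OF tendsto_V[OF assms u]]) (use kernel_ge in auto)
  show "V \<xi> y \<le> 1"
    by (rule LIMSEQ_le_const2[OF tendsto_V[OF assms u]]) (auto intro: kernel_le_1)
qed

lemma D_commute: "D \<xi> \<eta> = D \<eta> \<xi>"
proof -
  have *: "gromov_product p x y = gromov_product p y x" for x y
    by (simp add: gromov_product_def dist_commute)
  have "boundary_product p \<xi> \<eta> = boundary_product p \<eta> \<xi>"
    unfolding boundary_product_def by (subst *) (rule arg_cong[where f = The], blast)
  then show ?thesis
    by (simp add: boundary_dist_def)
qed

lemma D_le_1: assumes "\<xi> \<in> M" "\<eta> \<in> M" shows "D \<xi> \<eta> \<le> 1"
proof -
  obtain u v where u: "u \<in> \<xi>" "v \<in> \<eta>" using boundary_nonempty assms by blast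
  show ?thesis
    by (rule LIMSEQ_le_const2[OF tendsto_D[OF assms(1) u(1) assms(2) u(2)]]) (auto intro: kernel_le_1)
qed

lemma Metric_space_boundary: "Metric_space M D"
proof
  show "0 \<le> D x y" for x y
    by (simp add: boundary_dist_def)
  show "D x y = D y x" for x y
    by (rule D_commute)
  show "D x y = 0 \<longleftrightarrow> x = y" if xy: "x \<in> M" "y \<in> M" for x y
  proof -
    obtain u v where u: "u \<in> x" "v \<in> y" using boundary_nonempty xy by blast
    have lim: "(\<lambda>n. E (u n) (v n)) \<longlonglongrightarrow> D x y"
      by (rule tendsto_D[OF xy(1) u(1) xy(2) u(2)])
    have "D x y = 0 \<longleftrightarrow> (\<lambda>n. E (u n) (v n)) \<longlonglongrightarrow> 0"
      using lim LIMSEQ_unique[OF lim, of 0] by auto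
    also have "\<dots> \<longleftrightarrow> (u, v) \<in> boundary_rel p"
      using boundary_conv[OF xy(1) u(1)] boundary_conv[OF xy(2) u(2)] by (simp add: rel_iff)
    also have "\<dots> \<longleftrightarrow> x = y"
      using boundary_eqI[OF xy u] boundary_rel_in[OF xy(1) u(1)] u(2) by blast
    finally show ?thesis .
  qed
  show "D x z \<le> D x y + D y z" if xyz: "x \<in> M" "y \<in> M" "z \<in> M" for x y z
  proof -
    obtain u v w where u: "u \<in> x" "v \<in> y" "w \<in> z"
      using xyz[THEN boundary_nonempty] by auto
    show ?thesis
      by (rule LIMSEQ_le[OF tendsto_D[OF xyz(1) u(1) xyz(3) u(3)]
          tendsto_add[OF tendsto_D[OF xyz(1) u(1) xyz(2) u(2)] tendsto_D[OF xyz(2) u(2) xyz(3) u(3)]]])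
        (auto intro: kernel_triangle)
  qed
qed

lemma V_small: assumes "\<xi> \<in> M" "0 < e" obtains x where "V \<xi> x \<le> e"
proof -
  obtain u where u: "u \<in> \<xi>" using boundary_nonempty[OF assms(1)] by blast
  obtain N where N: "\<And>m n. m \<ge> N \<Longrightarrow> n \<ge> N \<Longrightarrow> E (u m) (u n) < e"
    using boundary_conv[OF assms(1) u] assms(2) unfolding conv_iff by metis
  have "V \<xi> (u N) \<le> e"
    by (rule LIMSEQ_le_const2[OF tendsto_V[OF assms(1) u]]) (use N in \<open>auto intro!: exI[of _ N] less_imp_le\<close>)
  then show ?thesis
    by (rule that)
qed

text \<open>A Cauchy sequence of boundary points is followed by points \<open>x k\<close> of the
  space with \<open>V (\<sigma> k) (x k)\<close> at most \<open>1 / (k + 1)\<close>; these converge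
  at infinity and their class is the limit.\<close>

lemma mcomplete_boundary: "Metric_space.mcomplete M D"
proof -
  interpret MS: Metric_space M D
    by (rule Metric_space_boundary)
  show ?thesis
    unfolding MS.mcomplete_def
  proof (intro allI impI)
    fix \<sigma>
    assume \<sigma>: "MS.MCauchy \<sigma>"
    then have in_M: "\<sigma> n \<in> M" for n
      unfolding MS.MCauchy_def by blast
    have "\<exists>x. V (\<sigma> k) x \<le> inverse (real (Suc k))" for k
      using V_small[OF in_M[of k], of "inverse (real (Suc k))"] by auto
    then obtain x where x: "\<And>k. V (\<sigma> k) (x k) \<le> inverse (real (Suc k))"
      by metis
    have small: "\<exists>N. \<forall>k\<ge>N. V (\<sigma> k) (x k) < e" if e: "0 < e" for e
    proof -
      obtain N where "inverse (real (Suc N)) < e"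
        using reals_Archimedean[OF e] by blast
      moreover have "inverse (real (Suc k)) \<le> inverse (real (Suc N))" if "k \<ge> N" for k
        using that by (intro le_imp_inverse_le) auto
      ultimately have "V (\<sigma> k) (x k) < e" if "k \<ge> N" for k
        using that x[of k] by (meson le_less_trans order_trans)
      then show ?thesis
        by blast
    qed
    have xx: "\<exists>N. \<forall>k\<ge>N. \<forall>l\<ge>N. E (x k) (x l) < e" if e: "0 < e" for e
    proof -
      obtain N1 where N1: "\<And>k. k \<ge> N1 \<Longrightarrow> V (\<sigma> k) (x k) < e / 3"
        using small[of "e / 3"] e by auto
      obtain N2 where N2: "\<And>k l. k \<ge> N2 \<Longrightarrow> l \<ge> N2 \<Longrightarrow> D (\<sigma> k) (\<sigma> l) < e / 3"
        using \<sigma> e unfolding MS.MCauchy_def by (metis zero_less_divide_iff zero_less_numeral)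
      have "E (x k) (x l) < e" if "k \<ge> max N1 N2" "l \<ge> max N1 N2" for k l
        using N1[of k] N1[of l] N2[of k l] that kernel_le_V[OF in_M[of k], of "x k" "x l"]
          V_le_D[OF in_M[of k] in_M[of l], of "x l"] by simp
      then show ?thesis
        by blast
    qed
    then have cx: "conv x"
      unfolding conv_iff by blast
    define \<xi> where "\<xi> = boundary_rel p `` {x}"
    have \<xi>: "\<xi> \<in> M" "x \<in> \<xi>"
      using boundary_class[OF cx] by (auto simp: \<xi>_def)
    have "\<exists>N. \<forall>l\<ge>N. D (\<sigma> l) \<xi> < e" if e: "0 < e" for e
    proof -
      obtain N1 where N1: "\<And>k. k \<ge> N1 \<Longrightarrow> V (\<sigma> k) (x k) < e / 2"
        using small[of "e / 2"] e by auto
      obtain N2 where N2: "\<And>k l. k \<ge> N2 \<Longrightarrow> l \<ge> N2 \<Longrightarrow> E (x k) (x l) < e / 2"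
        using xx[of "e / 2"] e by auto
      have "D (\<sigma> l) \<xi> < e" if l: "l \<ge> max N1 N2" for l
      proof -
        have "V \<xi> (x l) \<le> e / 2"
          by (rule LIMSEQ_le_const2[OF tendsto_V[OF \<xi>]])
            (use N2 l in \<open>auto intro!: exI[of _ N2] less_imp_le\<close>)
        then show ?thesis
          using N1[of l] l D_le_V[OF in_M[of l] \<xi>(1), of "x l"] by simp
      qed
      then show ?thesis
        by blast
    qed
    then have "limitin MS.mtopology \<sigma> \<xi> sequentially"
      unfolding MS.limitin_metric eventually_sequentially using \<xi>(1) in_M by auto
    then show "\<exists>x. limitin MS.mtopology \<sigma> x sequentially"
      by blast
  qed
qed

end

section \<open>Action of the isometry group on the boundary\<close>

abbreviation ginv :: "('a \<Rightarrow> 'a) \<Rightarrow> 'a \<Rightarrow> 'a" where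
  "ginv \<equiv> inv_into UNIV"

lemma isometry_groupD:
  assumes "isometry_group \<Gamma>" "g \<in> \<Gamma>"
  shows "dist (g x) (g y) = dist x y" "bij g" "ginv g \<in> \<Gamma>"
proof -
  have sub: "subgroup \<Gamma> (BijGroup UNIV)"
    using assms by (simp add: isometry_group_def)
  show "dist (g x) (g y) = dist x y"
    using assms by (simp add: isometry_group_def)
  have g: "g \<in> Bij UNIV"
    using subgroup.subset[OF sub] assms(2) by (auto simp: BijGroup_def)
  then show "bij g"
    by (simp add: Bij_def)
  show "ginv g \<in> \<Gamma>"
    using subgroup.m_inv_closed[OF sub assms(2)] inv_BijGroup[OF g] by (simp add: restrict_def)
qed

lemma isometry_group_comp:
  assumes "isometry_group \<Gamma>" "g \<in> \<Gamma>" "h \<in> \<Gamma>"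
  shows "g \<circ> h \<in> \<Gamma>"
proof -
  have sub: "subgroup \<Gamma> (BijGroup UNIV)"
    using assms by (simp add: isometry_group_def)
  have gh: "g \<in> Bij UNIV" "h \<in> Bij UNIV"
    using subgroup.subset[OF sub] assms(2,3) by (auto simp: BijGroup_def)
  show ?thesis
    using subgroup.m_closed[OF sub assms(2,3)] gh
    by (simp add: BijGroup_def compose_def comp_def restrict_def)
qed

locale cocompact_hyperbolic_group = strongly_hyperbolic_space p \<epsilon>
  for p :: "'a::metric_space" and \<epsilon> :: real +
  fixes \<Gamma> :: "('a \<Rightarrow> 'a) set"
  assumes prop_space: "proper_metric TYPE('a)"
    and rough: "roughly_geodesic TYPE('a)"
    and grp: "isometry_group \<Gamma>"
    and disc: "properly_discontinuous \<Gamma>"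
    and coc: "cocompact \<Gamma>"
begin

lemmas iso = isometry_groupD(1)[OF grp]
lemmas bij = isometry_groupD(2)[OF grp]
lemmas inv_in = isometry_groupD(3)[OF grp]

lemma inv_apply [simp]: "g \<in> \<Gamma> \<Longrightarrow> g (ginv g x) = x" "g \<in> \<Gamma> \<Longrightarrow> ginv g (g x) = x"
  using bij by (simp_all add: bij_is_surj surj_f_inv_f bij_is_inj)

lemma inv_inv [simp]: "g \<in> \<Gamma> \<Longrightarrow> ginv (ginv g) = g"
  using bij inv_inv_eq by blast

definition w :: "('a \<Rightarrow> 'a) \<Rightarrow> real" where "w g = exp (- \<epsilon> * dist p (g p))"

lemma w_pos [simp]: "0 < w g"
  by (simp add: w_def)

lemma w_inv: assumes "g \<in> \<Gamma>" shows "w (ginv g) = w g"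
  using iso[OF assms, of "ginv g p" p] assms by (simp add: w_def dist_commute)

lemma kernel_action:
  assumes "g \<in> \<Gamma>"
  shows "E (g x) (g y) * E x (ginv g p) * E y (ginv g p) = E x y * w g"
  using kernel_isometry[of g "ginv g p" x y] iso[OF assms] assms w_inv[OF assms]
  by (simp add: w_def)

lemma kernel_action_le:
  assumes "g \<in> \<Gamma>"
  shows "E (g x) (g y) \<le> E x y / w g"
proof -
  have w: "w g \<le> E z (ginv g p)" for z
    using kernel_ge[of "ginv g p" z] w_inv[OF assms] by (simp only: w_def)
  have "E (g x) (g y) * (w g * w g) \<le> E (g x) (g y) * (E x (ginv g p) * E y (ginv g p))"
    using w by (intro mult_left_mono mult_mono) (auto intro: less_imp_le)
  also have "\<dots> = E x y * w g"
    using kernel_action[OF assms, of x y] by (simp add: mult_ac)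
  finally show ?thesis
    by (simp add: field_simps)
qed

lemma conv_action:
  assumes "g \<in> \<Gamma>" "conv u"
  shows "conv (g \<circ> u)"
  unfolding conv_iff
proof (intro allI impI)
  fix e :: real
  assume "0 < e"
  then have "0 < e * w g"
    by simp
  then obtain N where N: "\<And>m n. m \<ge> N \<Longrightarrow> n \<ge> N \<Longrightarrow> E (u m) (u n) < e * w g"
    using assms(2) unfolding conv_iff by metis
  have "E ((g \<circ> u) m) ((g \<circ> u) n) < e" if "m \<ge> N" "n \<ge> N" for m n
    using kernel_action_le[OF assms(1), of "u m" "u n"] N[OF that]
    by (simp add: field_simps) (smt (verit) mult.commute w_pos mult_less_cancel_left_pos)
  then show "\<exists>N. \<forall>m\<ge>N. \<forall>n\<ge>N. E ((g \<circ> u) m) ((g \<circ> u) n) < e"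
    by blast
qed

lemma rel_action:
  assumes "g \<in> \<Gamma>" "(u, v) \<in> boundary_rel p"
  shows "(g \<circ> u, g \<circ> v) \<in> boundary_rel p"
proof -
  have "(\<lambda>n. E (u n) (v n) / w g) \<longlonglongrightarrow> 0"
    using assms(2) tendsto_divide[of "\<lambda>n. E (u n) (v n)" 0 _ "\<lambda>_. w g" "w g"]
    by (simp add: rel_iff less_imp_neq[symmetric])
  then have "(\<lambda>n. E (g (u n)) (g (v n))) \<longlonglongrightarrow> 0"
    by (rule tendsto_sandwich[OF _ _ tendsto_const, rotated 2]) (auto simp: kernel_action_le[OF assms(1)])
  then show ?thesis
    using assms by (auto simp: rel_iff conv_action)
qed

text \<open>\<open>boundary_action\<close> is a mere image of a set of sequences; that it fills a
  whole class comes from applying the inverse isometry.\<close>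

lemma boundary_action_eq:
  assumes g: "g \<in> \<Gamma>" and \<xi>: "\<xi> \<in> M" "u \<in> \<xi>"
  shows "boundary_action g \<xi> = boundary_rel p `` {g \<circ> u}"
proof
  show "boundary_action g \<xi> \<subseteq> boundary_rel p `` {g \<circ> u}"
    using boundary_rel_in[OF \<xi>] rel_action[OF g] by (auto simp: boundary_action_def)
  show "boundary_rel p `` {g \<circ> u} \<subseteq> boundary_action g \<xi>"
  proof
    fix v
    assume "v \<in> boundary_rel p `` {g \<circ> u}"
    then have "(ginv g \<circ> (g \<circ> u), ginv g \<circ> v) \<in> boundary_rel p"
      by (intro rel_action inv_in g) auto
    moreover have "ginv g \<circ> (g \<circ> u) = u" "g \<circ> (ginv g \<circ> v) = v"
      using g by (auto simp: fun_eq_iff)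
    ultimately show "v \<in> boundary_action g \<xi>"
      using boundary_closed[OF \<xi>] unfolding boundary_action_def by (metis image_eqI)
  qed
qed

lemma boundary_action_in:
  assumes g: "g \<in> \<Gamma>" and \<xi>: "\<xi> \<in> M"
  shows "boundary_action g \<xi> \<in> M"
  using boundary_nonempty[OF \<xi>] boundary_action_eq[OF g \<xi>]
    boundary_class(1)[OF conv_action[OF g boundary_conv[OF \<xi>]]] by auto

lemma boundary_action_inv:
  assumes g: "g \<in> \<Gamma>"
  shows "boundary_action (ginv g) (boundary_action g \<xi>) = \<xi>" "boundary_action g (boundary_action (ginv g) \<xi>) = \<xi>"
  using g by (auto simp: boundary_action_def image_image comp_def)

lemma V_action:
  assumes g: "g \<in> \<Gamma>" and \<xi>: "\<xi> \<in> M"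
  shows "V (boundary_action g \<xi>) (g p) * V \<xi> (ginv g p) = w g"
proof -
  obtain u where u: "u \<in> \<xi>" using boundary_nonempty[OF \<xi>] by blast
  then have gu: "g \<circ> u \<in> boundary_action g \<xi>"
    by (auto simp: boundary_action_def)
  have "(\<lambda>n. E ((g \<circ> u) n) (g p) * E (u n) (ginv g p)) \<longlonglongrightarrow> V (boundary_action g \<xi>) (g p) * V \<xi> (ginv g p)"
    by (intro tendsto_mult tendsto_V \<xi> u gu boundary_action_in g)
  moreover have "E ((g \<circ> u) n) (g p) * E (u n) (ginv g p) = w g" for n
    using kernel_action[OF g, of "u n" p] by simp
  ultimately show ?thesis
    by (simp add: LIMSEQ_const_iff)
qed

lemma D_action:
  assumes g: "g \<in> \<Gamma>" and \<xi>: "\<xi> \<in> M" and \<eta>: "\<eta> \<in> M"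
  shows "D (boundary_action g \<xi>) (boundary_action g \<eta>) * V \<xi> (ginv g p) * V \<eta> (ginv g p) = D \<xi> \<eta> * w g"
proof -
  obtain u v where u: "u \<in> \<xi>" "v \<in> \<eta>" using \<xi> \<eta> boundary_nonempty by blast
  then have gu: "g \<circ> u \<in> boundary_action g \<xi>" "g \<circ> v \<in> boundary_action g \<eta>"
    by (auto simp: boundary_action_def)
  have "(\<lambda>n. E ((g \<circ> u) n) ((g \<circ> v) n) * E (u n) (ginv g p) * E (v n) (ginv g p))
      \<longlonglongrightarrow> D (boundary_action g \<xi>) (boundary_action g \<eta>) * V \<xi> (ginv g p) * V \<eta> (ginv g p)"
    by (intro tendsto_mult tendsto_V tendsto_D \<xi> \<eta> u gu boundary_action_in g)
  moreover have "(\<lambda>n. E (u n) (v n) * w g) \<longlonglongrightarrow> D \<xi> \<eta> * w g"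
    by (intro tendsto_mult tendsto_const tendsto_D \<xi> \<eta> u)
  ultimately show ?thesis
    using kernel_action[OF g] by (simp add: LIMSEQ_unique)
qed

lemma net: obtains R where "0 \<le> R" "\<And>x. \<exists>g\<in>\<Gamma>. dist x (g p) \<le> R"
proof -
  obtain K where K: "compact K" "(\<Union>g\<in>\<Gamma>. g ` K) = UNIV"
    using coc by (auto simp: cocompact_def)
  then obtain R where R: "\<And>y. y \<in> K \<Longrightarrow> dist p y \<le> R"
    using compact_imp_bounded bounded_any_center[of K p] by metis
  have "\<exists>g\<in>\<Gamma>. dist x (g p) \<le> \<bar>R\<bar>" for x
  proof -
    obtain g y where "g \<in> \<Gamma>" "y \<in> K" "x = g y"
      using K(2) by blast
    then show ?thesis
      using iso[of g y p] R[of y] by (intro bexI[of _ g]) (auto simp: dist_commute)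
  qed
  then show ?thesis
    using that[of "\<bar>R\<bar>"] by auto
qed

lemma finite_ball: "finite {g \<in> \<Gamma>. dist p (g p) \<le> R}"
proof -
  have "compact (cball p R)"
    using prop_space by (simp add: proper_metric_def)
  then have "finite {g \<in> \<Gamma>. g ` cball p R \<inter> cball p R \<noteq> {}}"
    using disc unfolding properly_discontinuous_def by blast
  moreover have "{g \<in> \<Gamma>. dist p (g p) \<le> R} \<subseteq> {g \<in> \<Gamma>. g ` cball p R \<inter> cball p R \<noteq> {}}"
  proof safe
    fix g
    assume "g \<in> \<Gamma>" "dist p (g p) \<le> R" and e: "g ` cball p R \<inter> cball p R = {}"
    moreover from this have "0 \<le> R"
      using zero_le_dist[of p "g p"] by linarith
    ultimately have "g p \<in> g ` cball p R \<inter> cball p R"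
      by (intro IntI imageI) auto
    then show False
      using e by simp
  qed
  ultimately show ?thesis
    by (rule rev_finite_subset)
qed

text \<open>No infinite ray is constructed: at a given scale, a rough geodesic from \<open>p\<close>
  to a far term of a representative follows the direction of \<open>\<xi>\<close> long enough, and
  cocompactness supplies an orbit point near its point at time \<open>t\<close>.\<close>

lemma ray:
  obtains c where "1 \<le> c"
    "\<And>\<xi> \<rho>. \<xi> \<in> M \<Longrightarrow> 0 < \<rho> \<Longrightarrow> \<rho> \<le> 1 \<Longrightarrow> \<exists>g\<in>\<Gamma>. \<rho> / c \<le> w g \<and> w g \<le> c * \<rho> \<and> V \<xi> (g p) \<le> c * \<rho>"
proof -
  obtain R where R: "0 \<le> R" "\<And>x. \<exists>g\<in>\<Gamma>. dist x (g p) \<le> R"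
    using net by metis
  obtain B where B: "0 < B" "\<And>x y::'a. \<exists>a b. \<exists>r :: real \<Rightarrow> 'a. a \<le> b \<and> r a = x \<and> r b = y \<and>
        (\<forall>t\<in>{a..b}. \<forall>u\<in>{a..b}.
           \<bar>t - u\<bar> - B \<le> dist (r t) (r u) \<and> dist (r t) (r u) \<le> \<bar>t - u\<bar> + B)"
    using rough unfolding roughly_geodesic_def by blast
  \<comment> \<open>\<open>Q\<close> collects the roughness errors and the distance to the orbit;
    the 2 in \<open>c\<close> comes from the triangle inequality through \<open>u N\<close>.\<close>
  define Q where "Q = 2 * B + R"
  define c where "c = 2 * exp (\<epsilon> * Q)"
  have Q: "0 \<le> Q" using B R by (simp add: Q_def)
  have eQ: "1 \<le> exp (\<epsilon> * Q)" using Q eps_pos by simp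
  have "\<exists>g\<in>\<Gamma>. \<rho> / c \<le> w g \<and> w g \<le> c * \<rho> \<and> V \<xi> (g p) \<le> c * \<rho>"
    if \<xi>: "\<xi> \<in> M" and \<rho>: "0 < \<rho>" "\<rho> \<le> 1" for \<xi> \<rho>
  proof -
    define t where "t = - ln \<rho> / \<epsilon>"
    have t: "0 \<le> t" "exp (- \<epsilon> * t) = \<rho>"
      using \<rho> eps_pos by (auto simp: t_def field_simps)
    obtain u where u: "u \<in> \<xi>" using boundary_nonempty[OF \<xi>] by blast
    have "0 < exp (- \<epsilon> * (t + B))" by simp
    then obtain N where N: "\<And>m n. m \<ge> N \<Longrightarrow> n \<ge> N \<Longrightarrow> E (u m) (u n) < exp (- \<epsilon> * (t + B))"
      using boundary_conv[OF \<xi> u] unfolding conv_iff by meson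
    \<comment> \<open>On the diagonal the Gromov product is the distance from \<open>p\<close>;
      \<open>u N\<close> is thus far enough for the parameter \<open>a + t\<close> to lie in the
      interval.\<close>
    have far: "t + B < dist p (u N)"
      using N[of N N] kernel_less_iff by (simp add: gromov_product_def dist_commute)
    obtain a b r where r: "a \<le> b" "r a = p" "r b = u N"
        "\<And>s u. s \<in> {a..b} \<Longrightarrow> u \<in> {a..b} \<Longrightarrow> \<bar>s - u\<bar> - B \<le> dist (r s) (r u) \<and> dist (r s) (r u) \<le> \<bar>s - u\<bar> + B"
      using B(2)[of p "u N"] by blast
    define x where "x = r (a + t)"
    have ab: "t \<le> b - a"
      using r(4)[of a b] r(1-3) far by simp
    have x: "t - B \<le> dist p x" "dist p x \<le> t + B" "dist x (u N) \<le> b - a - t + B" "b - a - B \<le> dist p (u N)"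
      using r(4)[of a "a + t"] r(4)[of "a + t" b] r(4)[of a b] r(1-3) t(1) ab by (auto simp: x_def)
    obtain g where g: "g \<in> \<Gamma>" "dist x (g p) \<le> R"
      using R by blast
    have gp: "t - Q \<le> dist p (g p)" "dist p (g p) \<le> t + Q" "dist (g p) (u N) \<le> b - a - t + B + R"
      using x g(2) dist_triangle[of p "g p" x] dist_triangle[of p x "g p"] dist_triangle[of "g p" "u N" x] B(1)
      by (auto simp: Q_def dist_commute)
    have "t - Q \<le> gromov_product p (u N) (g p)"
      using x g(2) gp(3) dist_triangle[of p x "g p"] unfolding gromov_product_def Q_def
      by (simp add: dist_commute)
    then have "\<epsilon> * (t - Q) \<le> \<epsilon> * gromov_product p (u N) (g p)"
      using eps_pos by simp
    then have "E (u N) (g p) \<le> exp (\<epsilon> * Q) * exp (- \<epsilon> * t)"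
      unfolding visual_kernel_def exp_add[symmetric] by (simp add: algebra_simps)
    then have "E (u N) (g p) \<le> exp (\<epsilon> * Q) * \<rho>"
      by (simp only: t)
    moreover have "E (u m) (u N) \<le> exp (\<epsilon> * Q) * \<rho>" if "m \<ge> N" for m
    proof -
      have "E (u m) (u N) \<le> exp (- \<epsilon> * t)"
        using N[of m N] that B(1) eps_pos by (smt (verit) exp_le_cancel_iff mult_less_cancel_left_pos order_refl minus_mult_commute)
      also have "\<dots> \<le> exp (\<epsilon> * Q) * \<rho>"
        unfolding t(2) using eQ \<rho>(1) by simp
      finally show ?thesis .
    qed
    ultimately have "E (u m) (g p) \<le> c * \<rho>" if "m \<ge> N" for m
      using that kernel_triangle[of "u m" "g p" "u N"] by (force simp: c_def)
    then have V: "V \<xi> (g p) \<le> c * \<rho>"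
      by (intro LIMSEQ_le_const2[OF tendsto_V[OF \<xi> u]]) auto
    have "\<epsilon> * (t - Q) \<le> \<epsilon> * dist p (g p)" "\<epsilon> * dist p (g p) \<le> \<epsilon> * (t + Q)"
      using gp eps_pos by auto
    then have "exp (- \<epsilon> * t) / exp (\<epsilon> * Q) \<le> w g" "w g \<le> exp (\<epsilon> * Q) * exp (- \<epsilon> * t)"
      unfolding w_def exp_add[symmetric] exp_diff[symmetric] by (auto simp: algebra_simps)
    then have "\<rho> / exp (\<epsilon> * Q) \<le> w g" "w g \<le> exp (\<epsilon> * Q) * \<rho>"
      unfolding t(2) by auto
    moreover have "\<rho> / c \<le> \<rho> / exp (\<epsilon> * Q)" "exp (\<epsilon> * Q) * \<rho> \<le> c * \<rho>"
      using \<rho>(1) by (auto simp: c_def field_simps)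
    ultimately show ?thesis
      using V g(1) by (intro bexI[of _ g]) auto
  qed
  moreover have "1 \<le> c"
    using eQ unfolding c_def by linarith
  ultimately show ?thesis
    using that by blast
qed

end

section \<open>Orbit growth and the spherical function\<close>

lemma one_minus_exp_bounds:
  fixes y :: real
  assumes "0 < y"
  shows "1 - exp (- y) \<le> y" "y / (1 + y) \<le> 1 - exp (- y)"
proof -
  show "1 - exp (- y) \<le> y"
    using exp_ge_add_one_self[of "- y"] by simp
  have "exp (- y) \<le> 1 / (1 + y)"
    using exp_ge_add_one_self[of y] assms by (simp add: exp_minus field_simps)
  moreover have "1 - 1 / (1 + y) = y / (1 + y)"
    using assms by (simp add: field_simps)
  ultimately show "y / (1 + y) \<le> 1 - exp (- y)"
    by linarith
qed

definition omega_profile :: "real \<Rightarrow> real \<Rightarrow> real \<Rightarrow> real" where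
  "omega_profile \<alpha> \<sigma> t = (omega \<alpha> \<bar>\<sigma> - 1/2\<bar> t + 1) * exp (- (1/2) * \<alpha> * t)"

text \<open>With \<open>\<delta> = \<sigma> - 1/2\<close>, the quantity \<open>exp (- \<sigma> T) * (1 + tail_integral \<sigma> T)\<close> is
  \<open>exp (- T/2) * (exp (- \<delta> T) + (1 + 2 \<delta>) * S)\<close> for \<open>S = sinh (\<delta> T) / \<delta>\<close>; both this and
  \<open>omega\<close> are comparable with \<open>S\<close>.\<close>

lemma tail_integral_omega:
  fixes \<alpha> :: real
  assumes \<alpha>: "0 < \<alpha>"
  obtains A where "0 < A"
    "\<And>\<sigma> t. 0 \<le> \<sigma> \<Longrightarrow> \<sigma> \<le> 1 \<Longrightarrow> 0 \<le> t \<Longrightarrow>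
      omega_profile \<alpha> \<sigma> t \<le> A * (exp (- \<sigma> * (\<alpha> * t)) * (1 + tail_integral \<sigma> (\<alpha> * t))) \<and>
      exp (- \<sigma> * (\<alpha> * t)) * (1 + tail_integral \<sigma> (\<alpha> * t)) \<le> A * omega_profile \<alpha> \<sigma> t"
proof -
  define A where "A = 3 * (((1 + \<alpha>) / \<alpha> + 1) + (\<alpha> + 1))"
  have A: "0 < A" "3 * ((1 + \<alpha>) / \<alpha> + 1) \<le> A" "3 * (\<alpha> + 1) \<le> A"
  proof -
    have q: "0 < 3 * ((q + 1) + (\<alpha> + 1))" "3 * (q + 1) \<le> 3 * ((q + 1) + (\<alpha> + 1))"
      "3 * (\<alpha> + 1) \<le> 3 * ((q + 1) + (\<alpha> + 1))" if "0 < q" for q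
      using that \<alpha> by auto
    show "0 < A" "3 * ((1 + \<alpha>) / \<alpha> + 1) \<le> A" "3 * (\<alpha> + 1) \<le> A"
      unfolding A_def using \<alpha> by (intro q; simp)+
  qed
  show ?thesis
  proof (rule that[OF A(1)])
    fix \<sigma> t :: real
    assume \<sigma>: "0 \<le> \<sigma>" "\<sigma> \<le> 1" and t: "0 \<le> t"
    define T where "T = \<alpha> * t"
    define x where "x = \<bar>\<sigma> - 1/2\<bar>"
    define S where "S = (if x = 0 then T else sinh (x * T) / x)"
    define Z where "Z = exp (- (\<sigma> - 1/2) * T) * (1 + tail_integral \<sigma> T)"
    define W where "W = omega \<alpha> x t"
    have T: "0 \<le> T"
      using \<alpha> t by (simp add: T_def)
    have x: "0 \<le> x" "x \<le> 1/2"
      using \<sigma> unfolding x_def by linarith+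
    have S: "0 \<le> S"
      using T x by (simp add: S_def)
    have W: "S / \<alpha> \<le> W" "W \<le> (1 + \<alpha>) / \<alpha> * S"
    proof -
      have "S / \<alpha> \<le> W \<and> W \<le> (1 + \<alpha>) / \<alpha> * S"
      proof (cases "x = 0")
        case True
        then show ?thesis
          using \<alpha> t by (simp add: W_def S_def omega_def T_def field_simps)
      next
        case False
        \<comment> \<open>The exponent in the denominator of \<open>omega\<close>. As it stays below
          \<open>\<alpha>\<close>, that denominator is comparable with \<open>y\<close> uniformly as
          \<open>x\<close> tends to 0.\<close>
        define y where "y = 2 * x * \<alpha>"
        have y: "0 < y" "y \<le> \<alpha>"
          using False x \<alpha> mult_right_mono[of "2 * x" 1 \<alpha>] by (auto simp: y_def)
        note e = one_minus_exp_bounds[OF y(1)]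
        have e0: "0 < 1 - exp (- y)"
          using y by simp
        have Weq: "W = S * (2 * x) / (1 - exp (- y))"
          using False by (simp add: W_def S_def omega_def T_def y_def mult.assoc)
        have "S / \<alpha> = S * (2 * x) / y"
          using False \<alpha> by (simp add: y_def)
        also have "\<dots> \<le> W"
          unfolding Weq using S x e(1) e0 by (intro divide_left_mono mult_nonneg_nonneg mult_pos_pos y) auto
        finally have 1: "S / \<alpha> \<le> W" .
        have "W \<le> S * (2 * x) / (y / (1 + y))"
          unfolding Weq using S x e(2) e0 y(1) by (intro divide_left_mono mult_nonneg_nonneg mult_pos_pos) auto
        also have "\<dots> = (1 + y) / \<alpha> * S"
          using False \<alpha> by (simp add: y_def)
        also have "\<dots> \<le> (1 + \<alpha>) / \<alpha> * S"
          using y \<alpha> S by (intro mult_right_mono divide_right_mono) auto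
        finally show ?thesis
          using 1 by simp
      qed
      then show "S / \<alpha> \<le> W" "W \<le> (1 + \<alpha>) / \<alpha> * S"
        by auto
    qed
    have Z: "Z = exp (- (\<sigma> - 1/2) * T) + 2 * \<sigma> * S"
    proof (cases "\<sigma> = 1/2")
      case True
      show ?thesis
        unfolding Z_def tail_integral_def S_def x_def True by simp
    next
      case False
      define \<delta> where "\<delta> = \<sigma> - 1/2"
      have d: "\<delta> \<noteq> 0" "\<sigma> = \<delta> + 1/2"
        using False by (auto simp: \<delta>_def)
      have Seq: "S = sinh (\<delta> * T) / \<delta>"
        using d by (cases "0 \<le> \<delta>") (auto simp: S_def x_def)
      have "exp (- \<delta> * T) * (exp (2 * \<delta> * T) - 1) = 2 * sinh (\<delta> * T)"
        by (simp add: sinh_field_def right_diff_distrib exp_add[symmetric] algebra_simps)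
      then have "exp (- \<delta> * T) * (2 * \<sigma> * (exp (2 * \<delta> * T) - 1) / (2 * \<delta>)) = 2 * \<sigma> * S"
        using d(1) by (simp add: Seq field_simps)
      moreover have "tail_integral \<sigma> T = 2 * \<sigma> * (exp (2 * \<delta> * T) - 1) / (2 * \<delta>)"
        using False by (simp add: tail_integral_def \<delta>_def right_diff_distrib)
      ultimately show ?thesis
        unfolding Z_def \<delta>_def[symmetric] by (simp add: distrib_left)
    qed
    have sinh_S: "2 * sinh (x * T) \<le> S"
    proof (cases "x = 0")
      case False
      then have "2 * sinh (x * T) * x \<le> 1 * sinh (x * T)"
        using x T mult_right_mono[of "2 * x" 1 "sinh (x * T)"] by (simp add: mult_ac)
      then show ?thesis
        using False x by (simp add: S_def pos_le_divide_eq)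
    qed (use T in \<open>simp add: S_def\<close>)
    have sinh_exp: "2 * sinh (x * T) = exp (x * T) - exp (- (x * T))" "exp (- (x * T)) \<le> 1" "1 \<le> exp (x * T)"
      using x T by (auto simp: sinh_field_def)
    define u where "u = 2 * \<sigma> * S"
    define e where "e = exp (- (\<sigma> - 1/2) * T)"
    have Zeu: "Z = e + u"
      by (simp only: Z u_def e_def)
    have exp_S: "exp (x * T) \<le> 1 + S" "1 \<le> exp (- (x * T)) + S"
      using sinh_S sinh_exp by linarith+
    have Z_upper: "Z \<le> 3 * (1 + S)"
    proof -
      have "- (\<sigma> - 1/2) * T \<le> x * T"
        using T by (intro mult_right_mono) (auto simp: x_def)
      then have "e \<le> exp (x * T)"
        by (simp add: e_def)
      moreover have "u \<le> 2 * S"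
        unfolding u_def using \<sigma> S by (intro mult_right_mono) auto
      ultimately show ?thesis
        unfolding Zeu distrib_left using exp_S S by linarith
    qed
    \<comment> \<open>From 1/2 on, \<open>u\<close> is at least \<open>S\<close>. Below 1/2 its
      coefficient \<open>2 * \<sigma>\<close> may vanish: for \<open>x \<ge> 1/4\<close> the bound
      on \<open>S\<close> comes from \<open>e = exp (x * T)\<close> alone, for smaller
      \<open>x\<close> from \<open>u \<ge> S / 2\<close>.\<close>
    have Z_lower: "1 + S \<le> 3 * Z"
    proof (cases "1/2 \<le> \<sigma>")
      case True
      have "1 * S \<le> u"
        unfolding u_def using True S by (intro mult_right_mono) auto
      moreover have "e = exp (- (x * T))"
      proof -
        have "x = \<sigma> - 1/2"
          using True by (simp add: x_def)
        then show ?thesis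
          by (simp only: e_def mult_minus_left)
      qed
      ultimately show ?thesis
        unfolding Zeu distrib_left using exp_S S exp_ge_zero[of "- (x * T)"] by linarith
    next
      case False
      then have xs: "- (\<sigma> - 1/2) = x" "2 * \<sigma> = 1 - 2 * x"
        by (auto simp: x_def)
      have ex: "e = exp (x * T)"
        by (simp only: e_def xs)
      show ?thesis
      proof (cases "1/4 \<le> x")
        case True
        have "sinh (x * T) \<le> 4 * x * sinh (x * T)"
          using True T x mult_right_mono[of 1 "4 * x" "sinh (x * T)"] by simp
        then have "S \<le> 4 * sinh (x * T)"
          using True by (simp add: S_def pos_divide_le_eq mult_ac)
        moreover have "0 \<le> u"
          unfolding u_def using \<sigma> S by simp
        ultimately show ?thesis
          unfolding Zeu ex distrib_left using sinh_exp exp_ge_zero[of "- (x * T)"] by linarith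
      next
        case False
        have "1/2 * S \<le> u"
          unfolding u_def xs(2) using False S by (intro mult_right_mono) auto
        then show ?thesis
          unfolding Zeu ex distrib_left using sinh_exp(3) S by linarith
      qed
    qed
    have up: "Z \<le> A * (W + 1)"
    proof -
      have "S \<le> \<alpha> * W"
        using W(1) \<alpha> by (simp add: field_simps)
      moreover have "0 \<le> W"
        using W(1) S \<alpha> by (meson divide_nonneg_pos order_trans)
      ultimately have "1 + S \<le> (\<alpha> + 1) * (W + 1)"
        using \<alpha> by (simp add: algebra_simps)
      then have "3 * (1 + S) \<le> 3 * ((\<alpha> + 1) * (W + 1))"
        by (rule mult_left_mono) simp
      then have "Z \<le> 3 * (\<alpha> + 1) * (W + 1)"
        unfolding mult.assoc by (rule order_trans[OF Z_upper])
      also have "\<dots> \<le> A * (W + 1)"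
        using A(3) \<open>0 \<le> W\<close> by (intro mult_right_mono) auto
      finally show ?thesis .
    qed
    have low: "W + 1 \<le> A * Z"
    proof -
      have "W + 1 \<le> ((1 + \<alpha>) / \<alpha> + 1) * (1 + S)"
      proof -
        have "0 \<le> (1 + \<alpha>) / \<alpha>"
          using \<alpha> by simp
        then show ?thesis
          using W(2) S by (simp add: distrib_left distrib_right)
      qed
      also have "\<dots> \<le> ((1 + \<alpha>) / \<alpha> + 1) * (3 * Z)"
        using Z_lower \<alpha> by (intro mult_left_mono) auto
      also have "\<dots> = 3 * ((1 + \<alpha>) / \<alpha> + 1) * Z"
        by (simp only: mult_ac)
      also have "\<dots> \<le> A * Z"
        using A(2) Z_lower S by (intro mult_right_mono) auto
      finally show ?thesis .
    qed
    have eq: "exp (- \<sigma> * T) * (1 + tail_integral \<sigma> T) = Z * exp (- (1/2) * T)"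
      by (simp add: Z_def exp_add[symmetric] algebra_simps flip: mult.assoc)
    have "(W + 1) * exp (- (1/2) * T) \<le> A * Z * exp (- (1/2) * T)" "Z * exp (- (1/2) * T) \<le> A * (W + 1) * exp (- (1/2) * T)"
      using up low by (auto intro!: mult_right_mono)
    then show "omega_profile \<alpha> \<sigma> t \<le> A * (exp (- \<sigma> * (\<alpha> * t)) * (1 + tail_integral \<sigma> (\<alpha> * t))) \<and>
      exp (- \<sigma> * (\<alpha> * t)) * (1 + tail_integral \<sigma> (\<alpha> * t)) \<le> A * omega_profile \<alpha> \<sigma> t"
      unfolding omega_profile_def W_def x_def T_def[symmetric] eq mult.assoc[of "- (1/2)" \<alpha> t] by (simp only: mult.assoc)
  qed
qed

section \<open>Compactness of the boundary, orbit counting and the final estimate\<close>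

locale nonelementary_hyperbolic_group = cocompact_hyperbolic_group p \<epsilon> \<Gamma>
  for p :: "'a::metric_space" and \<epsilon> :: real and \<Gamma> :: "('a \<Rightarrow> 'a) set" +
  assumes nonel: "non_elementary \<Gamma> p"
begin

lemma three_boundary_points: "\<exists>x\<in>M. \<exists>y\<in>M. \<exists>z\<in>M. x \<noteq> y \<and> y \<noteq> z \<and> x \<noteq> z"
proof -
  have "\<exists>T\<subseteq>limit_set \<Gamma> p. card T = 3"
  proof (cases "finite (limit_set \<Gamma> p)")
    case True
    then have "3 \<le> card (limit_set \<Gamma> p)"
      using nonel by (simp add: non_elementary_def)
    then show ?thesis
      using obtain_subset_with_card_n by metis
  next
    case False
    then show ?thesis
      using infinite_arbitrarily_large by blast
  qed
  then obtain T where T: "T \<subseteq> limit_set \<Gamma> p" "card T = 3"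
    by blast
  then obtain x y z where xyz: "T = {x, y, z}" "x \<noteq> y \<and> y \<noteq> z \<and> x \<noteq> z"
    by (auto simp: card_3_iff)
  have "limit_set \<Gamma> p \<subseteq> M"
    by (auto simp: limit_set_def)
  then have "x \<in> M" "y \<in> M" "z \<in> M"
    using T(1) xyz(1) by auto
  with xyz(2) show ?thesis
    by blast
qed

text \<open>Compactness is completeness plus total boundedness. For the latter, \<open>ray\<close>
  puts every boundary point in the shadow of one of finitely many orbit points, and such a shadow
  has diameter at most \<open>2 * (c * \<rho>)\<close>.\<close>

lemma conformal_space_boundary:
  obtains c where "conformal_space M D \<Gamma> boundary_action ginv (\<lambda>g \<xi>. V \<xi> (g p)) w c"
proof -
  interpret MS: Metric_space M D
    by (rule Metric_space_boundary)
  obtain c where c: "1 \<le> c"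
    "\<And>\<xi> \<rho>. \<xi> \<in> M \<Longrightarrow> 0 < \<rho> \<Longrightarrow> \<rho> \<le> 1 \<Longrightarrow> \<exists>g\<in>\<Gamma>. \<rho> / c \<le> w g \<and> w g \<le> c * \<rho> \<and> V \<xi> (g p) \<le> c * \<rho>"
    using ray by metis
  have "MS.mtotally_bounded M"
    unfolding MS.mtotally_bounded_def
  proof (intro allI impI)
    fix r :: real
    assume r: "0 < r"
    define \<rho> where "\<rho> = min 1 (r / (3 * c))"
    have "c * \<rho> \<le> c * (r / (3 * c))"
      using c(1) by (intro mult_left_mono) (auto simp: \<rho>_def)
    then have \<rho>: "0 < \<rho>" "\<rho> \<le> 1" "2 * (c * \<rho>) < r"
      using r c(1) by (auto simp: \<rho>_def)
    define F where "F = {g \<in> \<Gamma>. dist p (g p) \<le> - ln (\<rho> / c) / \<epsilon>}"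
    define K where "K g = {\<xi> \<in> M. V \<xi> (g p) \<le> c * \<rho>}" for g
    \<comment> \<open>A shadow belongs to an orbit point, which is not on the boundary; some
      boundary point inside it has to serve as centre of a ball.\<close>
    define z where "z g = (SOME \<xi>. \<xi> \<in> K g)" for g
    have z: "z g \<in> K g" if "K g \<noteq> {}" for g
      using that unfolding z_def by (meson ex_in_conv someI_ex)
    show "\<exists>N. finite N \<and> N \<subseteq> M \<and> M \<subseteq> (\<Union>x\<in>N. MS.mball x r)"
    proof (intro exI conjI)
      show "finite (z ` {g \<in> F. K g \<noteq> {}})"
        by (intro finite_imageI finite_subset[OF _ finite_ball[of "- ln (\<rho> / c) / \<epsilon>"]]) (auto simp: F_def)
      show "z ` {g \<in> F. K g \<noteq> {}} \<subseteq> M"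
        using z by (auto simp: K_def)
      show "M \<subseteq> (\<Union>x\<in>z ` {g \<in> F. K g \<noteq> {}}. MS.mball x r)"
      proof
        fix \<xi>
        assume \<xi>: "\<xi> \<in> M"
        obtain g where g: "g \<in> \<Gamma>" "\<rho> / c \<le> w g" "V \<xi> (g p) \<le> c * \<rho>"
          using c(2)[OF \<xi> \<rho>(1,2)] by blast
        have "ln (\<rho> / c) \<le> ln (w g)"
          using g(2) \<rho>(1) c(1) by (subst ln_le_cancel_iff) auto
        then have "g \<in> F"
          using g(1) eps_pos by (simp add: F_def w_def field_simps)
        moreover have \<xi>K: "\<xi> \<in> K g"
          using g(3) \<xi> by (simp add: K_def)
        moreover have "\<xi> \<in> MS.mball (z g) r"
        proof -
          have zg: "z g \<in> M" "V (z g) (g p) \<le> c * \<rho>"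
            using z[of g] \<xi>K by (auto simp: K_def)
          then have "D (z g) \<xi> < r"
            using D_le_V[OF zg(1) \<xi>, of "g p"] g(3) \<rho>(3) by simp
          then show ?thesis
            using zg \<xi> by (simp add: MS.in_mball)
        qed
        ultimately show "\<xi> \<in> (\<Union>x\<in>z ` {g \<in> F. K g \<noteq> {}}. MS.mball x r)"
          by blast
      qed
    qed
  qed
  then have compact_boundary: "compact_space MS.mtopology"
    using mcomplete_boundary by (simp add: MS.compact_space_eq_mcomplete_mtotally_bounded)
  have "conformal_space M D \<Gamma> boundary_action ginv (\<lambda>g \<xi>. V \<xi> (g p)) w c"
  proof (rule conformal_space.intro[OF Metric_space_boundary], unfold_locales)
    show "w g \<le> V \<xi> (g p)" "V \<xi> (g p) \<le> 1" if "\<xi> \<in> M" for \<xi> and g :: "'a \<Rightarrow> 'a"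
      using V_bounds[OF that, of "g p"] by (auto simp: w_def)
  qed (use compact_boundary D_le_1 inv_in boundary_action_in boundary_action_inv V_le_D D_le_V V_action D_action
      c three_boundary_points in auto)
  then show ?thesis
    by (rule that)
qed

definition \<alpha> :: real where "\<alpha> = volume_growth \<Gamma> p"

definition orbit_ball :: "real \<Rightarrow> 'a set" where "orbit_ball T = orbit_of \<Gamma> p \<inter> ball p T"

lemma orbit_cball_image: "orbit_of \<Gamma> p \<inter> cball p R = (\<lambda>g. g p) ` {g \<in> \<Gamma>. dist p (g p) \<le> R}"
  by (auto simp: orbit_of_def)

lemma finite_orbit_cball: "finite (orbit_of \<Gamma> p \<inter> cball p R)"
  unfolding orbit_cball_image using finite_ball by simp

lemma finite_orbit_ball: "finite (orbit_ball T)"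
  by (rule finite_subset[OF _ finite_orbit_cball[of T]]) (auto simp: orbit_ball_def)

lemma base_in_orbit: "p \<in> orbit_of \<Gamma> p"
proof -
  have "subgroup \<Gamma> (BijGroup UNIV)"
    using grp by (simp add: isometry_group_def)
  then have "\<one>\<^bsub>BijGroup UNIV\<^esub> \<in> \<Gamma>"
    by (rule subgroup.one_closed)
  then have "(\<lambda>x. x) \<in> \<Gamma>"
    by (simp add: BijGroup_def restrict_def)
  then show ?thesis
    by (auto simp: orbit_of_def)
qed

lemma orbit_cball_translate:
  assumes g: "g \<in> \<Gamma>"
  shows "finite (orbit_of \<Gamma> p \<inter> cball (g p) R)"
    "card (orbit_of \<Gamma> p \<inter> cball (g p) R) \<le> card (orbit_of \<Gamma> p \<inter> cball p R)"
proof -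
  have sub: "ginv g ` (orbit_of \<Gamma> p \<inter> cball (g p) R) \<subseteq> orbit_of \<Gamma> p \<inter> cball p R"
  proof
    fix x
    assume "x \<in> ginv g ` (orbit_of \<Gamma> p \<inter> cball (g p) R)"
    then obtain h where h: "h \<in> \<Gamma>" "x = ginv g (h p)" "dist (g p) (h p) \<le> R"
      by (auto simp: orbit_of_def)
    have "(ginv g \<circ> h) p \<in> orbit_of \<Gamma> p"
      unfolding orbit_of_def by (intro imageI isometry_group_comp[OF grp] inv_in g h)
    then show "x \<in> orbit_of \<Gamma> p \<inter> cball p R"
      using h iso[OF g, of p x] g by simp
  qed
  have inj: "inj_on (ginv g) (orbit_of \<Gamma> p \<inter> cball (g p) R)"
    using bij[OF inv_in[OF g]] by (meson bij_is_inj inj_on_subset subset_UNIV)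
  show "finite (orbit_of \<Gamma> p \<inter> cball (g p) R)"
    using inj_on_finite[OF inj sub] finite_orbit_cball by blast
  show "card (orbit_of \<Gamma> p \<inter> cball (g p) R) \<le> card (orbit_of \<Gamma> p \<inter> cball p R)"
    using card_inj_on_le[OF inj sub] finite_orbit_cball by blast
qed

lemma card_orbit_ball_pos: "0 < T \<Longrightarrow> 0 < card (orbit_ball T)"
  using base_in_orbit finite_orbit_ball by (auto simp: card_gt_0_iff orbit_ball_def)

abbreviation growth :: ereal where
  "growth \<equiv> Limsup at_top (\<lambda>T::real. ereal (ln (real (card (orbit_of \<Gamma> p \<inter> ball p T))) / T))"

lemma growth_nonneg: "0 \<le> growth"
proof (rule le_Limsup)
  have "0 \<le> ereal (ln (real (card (orbit_of \<Gamma> p \<inter> ball p T))) / T)" if "0 < T" for T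
  proof -
    have "0 \<le> ln (real (card (orbit_ball T)))"
      using card_orbit_ball_pos[OF that] by (simp add: Suc_le_eq)
    then show ?thesis
      using that by (simp add: orbit_ball_def)
  qed
  then show "\<forall>\<^sub>F T in at_top. 0 \<le> ereal (ln (real (card (orbit_of \<Gamma> p \<inter> ball p T))) / T)"
    by (intro eventually_mono[OF eventually_gt_at_top[of 0]])
qed simp

text \<open>Each orbit point at distance about \<open>n\<close> is seen from \<open>p\<close> in the direction of a boundary
  point; orbit points at this distance in nearly the same direction are within bounded distance.\<close>

lemma growth_le:
  assumes "conformal_space M D \<Gamma> boundary_action ginv (\<lambda>g \<xi>. V \<xi> (g p)) w c" and t: "0 \<le> t"
    and K: "\<And>r S. 0 < r \<Longrightarrow> r \<le> 1 \<Longrightarrow> Metric_space.separated M D r S \<Longrightarrow> real (card S) \<le> K * r powr - t"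
  shows "growth \<le> ereal (\<epsilon> * t)"
proof -
  interpret C: conformal_space M D \<Gamma> boundary_action ginv "\<lambda>g \<xi>. V \<xi> (g p)" w c
    by (rule assms(1))
  obtain b where b: "1 \<le> b" "\<And>g. g \<in> \<Gamma> \<Longrightarrow> \<exists>x\<in>M. V x (g p) \<le> b * w g"
    using C.visible_point by metis
  obtain \<xi>0 where "\<xi>0 \<in> M"
    using C.M_nonempty by blast
  then have "C.separated 1 {\<xi>0}"
    by (simp add: C.separated_def)
  then have K1: "1 \<le> K"
    using K[of 1 "{\<xi>0}"] by simp
  \<comment> \<open>Two orbit points of one cell lie at distance below \<open>n + 1\<close> from
    \<open>p\<close> and have Gromov product at least
    \<open>n - ln (2 * (1 + b)) / \<epsilon>\<close>, hence are at most \<open>R\<close>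
    apart.\<close>
  define R where "R = 2 + 2 * ln (2 * (1 + b)) / \<epsilon>"
  define m where "m = card (orbit_of \<Gamma> p \<inter> cball p R)"
  have R: "0 \<le> R"
    using b(1) eps_pos by (simp add: R_def)
  have "p \<in> orbit_of \<Gamma> p \<inter> cball p R"
    using base_in_orbit R by simp
  then have m: "1 \<le> m"
    unfolding m_def using finite_orbit_cball by (metis card_0_eq empty_iff less_one not_le)
  define Ann where "Ann n = {x \<in> orbit_of \<Gamma> p. real n \<le> dist p x \<and> dist p x < real n + 1}" for n :: nat
  have finite_Ann: "finite (Ann n)" for n
    by (rule finite_subset[OF _ finite_orbit_cball[of "real n + 1"]]) (auto simp: Ann_def)
  have Ann: "real (card (Ann n)) \<le> K * exp (\<epsilon> * t * n) * real m" for n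
  proof -
    define r where "r = exp (- \<epsilon> * n)"
    have r: "0 < r" "r \<le> 1"
      using eps_pos by (auto simp: r_def)
    obtain S where S: "C.separated r S" "card S = C.P r"
      using C.P_facts(2)[OF r(1)] by blast
    have SM: "S \<subseteq> M" "finite S"
      using S(1) by (auto simp: C.separated_def)
    \<comment> \<open>\<open>b\<close> is the error of the visible direction, and 1 that of moving
      it to the net \<open>S\<close>.\<close>
    define Cl where "Cl \<eta> = {x \<in> Ann n. V \<eta> x \<le> (1 + b) * r}" for \<eta>
    have "Ann n \<subseteq> (\<Union>\<eta>\<in>S. Cl \<eta>)"
    proof
      fix x
      assume x: "x \<in> Ann n"
      then obtain g where g: "g \<in> \<Gamma>" "x = g p" "real n \<le> dist p (g p)"
        by (auto simp: Ann_def orbit_of_def)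
      obtain \<xi> where \<xi>: "\<xi> \<in> M" "V \<xi> (g p) \<le> b * w g"
        using b(2)[OF g(1)] by blast
      have "w g \<le> r"
        using g(3) eps_pos by (simp add: w_def r_def)
      then have "b * w g \<le> b * r"
        using b(1) by (intro mult_left_mono) auto
      moreover obtain \<eta> where \<eta>: "\<eta> \<in> S" "D \<eta> \<xi> \<le> r"
        using C.separated_net[OF r(1) S] \<xi>(1) by (auto simp: C.in_mcball)
      moreover have "V \<eta> (g p) \<le> D \<eta> \<xi> + V \<xi> (g p)"
        using \<eta> SM \<xi> by (intro V_le_D) auto
      ultimately have "V \<eta> x \<le> (1 + b) * r"
        using \<xi>(2) g(2) by (simp add: algebra_simps)
      then show "x \<in> (\<Union>\<eta>\<in>S. Cl \<eta>)"
        using \<eta>(1) x by (auto simp: Cl_def)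
    qed
    moreover have Cl_card: "card (Cl \<eta>) \<le> m" if \<eta>: "\<eta> \<in> S" for \<eta>
    proof (cases "Cl \<eta> = {}")
      case False
      then obtain x where x: "x \<in> Cl \<eta>"
        by blast
      then obtain g where g: "g \<in> \<Gamma>" "x = g p"
        by (auto simp: Cl_def Ann_def orbit_of_def)
      have "Cl \<eta> \<subseteq> orbit_of \<Gamma> p \<inter> cball (g p) R"
      proof
        fix y
        assume y: "y \<in> Cl \<eta>"
        have "E x y \<le> V \<eta> x + V \<eta> y"
          using \<eta> SM by (intro kernel_le_V) auto
        also have "\<dots> \<le> (1 + b) * r + (1 + b) * r"
          using x y unfolding Cl_def by (intro add_mono) auto
        also have "\<dots> = 2 * (1 + b) * r"
          by (simp add: algebra_simps)
        finally have "ln (E x y) \<le> ln (2 * (1 + b) * r)"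
          using b(1) r(1) by (subst ln_le_cancel_iff) auto
        then have "- \<epsilon> * gromov_product p x y \<le> ln (2 * (1 + b)) - \<epsilon> * n"
          using b(1) r(1) by (simp add: visual_kernel_def ln_mult r_def)
        then have "real n - ln (2 * (1 + b)) / \<epsilon> \<le> gromov_product p x y"
          using eps_pos by (simp add: field_simps)
        then have "dist x y \<le> dist p x + dist p y - 2 * (real n - ln (2 * (1 + b)) / \<epsilon>)"
          by (simp add: gromov_product_def dist_commute field_simps)
        also have "\<dots> \<le> R"
          using x y by (simp add: Cl_def Ann_def R_def)
        finally show "y \<in> orbit_of \<Gamma> p \<inter> cball (g p) R"
          using y g by (auto simp: Cl_def Ann_def)
      qed
      then have "card (Cl \<eta>) \<le> card (orbit_of \<Gamma> p \<inter> cball (g p) R)"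
        by (rule card_mono[OF orbit_cball_translate(1)[OF g(1)]])
      also have "\<dots> \<le> m"
        unfolding m_def by (rule orbit_cball_translate(2)[OF g(1)])
      finally show ?thesis .
    qed simp
    ultimately have "card (Ann n) \<le> (\<Sum>\<eta>\<in>S. m)"
    proof -
      have "finite (\<Union>\<eta>\<in>S. Cl \<eta>)"
        by (rule finite_subset[OF _ finite_Ann[of n]]) (auto simp: Cl_def)
      then have "card (Ann n) \<le> card (\<Union>\<eta>\<in>S. Cl \<eta>)"
        using \<open>Ann n \<subseteq> _\<close> by (rule card_mono)
      also have "\<dots> \<le> (\<Sum>\<eta>\<in>S. card (Cl \<eta>))"
        by (rule card_UN_le[OF SM(2)])
      also have "\<dots> \<le> (\<Sum>\<eta>\<in>S. m)"
        by (intro sum_mono Cl_card)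
      finally show ?thesis .
    qed
    then have "real (card (Ann n)) \<le> real (card S * m)"
      by (simp only: of_nat_le_iff sum_constant of_nat_id)
    also have "\<dots> = real (card S) * real m"
      by simp
    also have "\<dots> \<le> (K * r powr - t) * real m"
      using K[OF r S(1)] by (intro mult_right_mono) auto
    also have "r powr - t = exp (\<epsilon> * t * n)"
      by (simp add: r_def exp_powr_real mult_ac)
    finally show ?thesis
      by simp
  qed
  \<comment> \<open>At most \<open>T + 1\<close> annuli contribute, each at most
    \<open>K * exp (\<epsilon> * t * T) * m\<close> points; the logarithms of the other factors
    vanish after division by \<open>T\<close>.\<close>
  define g where "g T = \<epsilon> * t + (ln (T + 1) + ln (K * real m)) / T" for T :: real
  have le: "ln (real (card (orbit_ball T))) / T \<le> g T" if T: "0 < T" for T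
  proof -
    define N where "N = nat \<lfloor>T\<rfloor>"
    have N: "real N \<le> T" "T < real N + 1"
      unfolding N_def using T by linarith+
    have "orbit_ball T \<subseteq> (\<Union>n\<in>{..N}. Ann n)"
    proof
      fix x
      assume x: "x \<in> orbit_ball T"
      define n where "n = nat \<lfloor>dist p x\<rfloor>"
      have "real n \<le> dist p x" "dist p x < real n + 1"
        unfolding n_def using zero_le_dist[of p x] by linarith+
      moreover have "n \<le> N"
        unfolding n_def N_def using x by (intro nat_mono floor_mono) (auto simp: orbit_ball_def)
      ultimately show "x \<in> (\<Union>n\<in>{..N}. Ann n)"
        using x by (auto simp: Ann_def orbit_ball_def)
    qed
    then have "card (orbit_ball T) \<le> card (\<Union>n\<in>{..N}. Ann n)"
      using finite_Ann by (intro card_mono) auto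
    also have "\<dots> \<le> (\<Sum>n\<in>{..N}. card (Ann n))"
      by (rule card_UN_le) simp
    finally have "real (card (orbit_ball T)) \<le> (\<Sum>n\<in>{..N}. real (card (Ann n)))"
      by (metis of_nat_le_iff of_nat_sum)
    also have "\<dots> \<le> (\<Sum>n\<in>{..N}. K * exp (\<epsilon> * t * T) * real m)"
    proof (rule sum_mono)
      fix n
      assume "n \<in> {..N}"
      then have "\<epsilon> * t * real n \<le> \<epsilon> * t * T"
        using N eps_pos t by (intro mult_left_mono) auto
      then have "K * exp (\<epsilon> * t * n) * real m \<le> K * exp (\<epsilon> * t * T) * real m"
        using K1 by (intro mult_right_mono mult_left_mono) auto
      then show "real (card (Ann n)) \<le> K * exp (\<epsilon> * t * T) * real m"
        using Ann[of n] by linarith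
    qed
    also have "\<dots> = (real N + 1) * (K * exp (\<epsilon> * t * T) * real m)"
      by simp
    also have "\<dots> \<le> (T + 1) * (K * exp (\<epsilon> * t * T) * real m)"
      using N K1 by (intro mult_right_mono) auto
    finally have up: "real (card (orbit_ball T)) \<le> (T + 1) * (K * exp (\<epsilon> * t * T) * real m)" .
    have "ln (real (card (orbit_ball T))) \<le> ln ((T + 1) * (K * exp (\<epsilon> * t * T) * real m))"
      using up T K1 m card_orbit_ball_pos[OF T] by (subst ln_le_cancel_iff) auto
    also have "\<dots> = ln (T + 1) + ln (K * real m) + \<epsilon> * t * T"
      using T K1 m by (simp add: ln_mult)
    finally show ?thesis
      using T by (simp add: g_def field_simps)
  qed
  have "growth \<le> Limsup at_top (\<lambda>T. ereal (g T))"
    by (intro Limsup_mono eventually_mono[OF eventually_gt_at_top[of 0]]) (use le in \<open>simp add: orbit_ball_def\<close>)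
  also have "\<dots> = ereal (\<epsilon> * t)"
  proof (rule lim_imp_Limsup)
    have "(g \<longlongrightarrow> \<epsilon> * t) at_top"
      unfolding g_def by real_asymp
    then show "((\<lambda>T. ereal (g T)) \<longlongrightarrow> ereal (\<epsilon> * t)) at_top"
      by simp
  qed simp
  finally show ?thesis .
qed

text \<open>\<open>volume_growth\<close> applies \<open>real_of_ereal\<close>, so the upper limit
  must be shown finite first; this is what \<open>polynomial_growth\<close> provides.\<close>

lemma growth_eq: "growth = ereal \<alpha>"
proof -
  obtain c where c: "conformal_space M D \<Gamma> boundary_action ginv (\<lambda>g \<xi>. V \<xi> (g p)) w c"
    by (rule conformal_space_boundary)
  interpret C: conformal_space M D \<Gamma> boundary_action ginv "\<lambda>g \<xi>. V \<xi> (g p)" w c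
    by (rule c)
  obtain K t where "0 \<le> t" "\<And>r S. 0 < r \<Longrightarrow> r \<le> 1 \<Longrightarrow> C.separated r S \<Longrightarrow> real (card S) \<le> K * r powr - t"
    using C.polynomial_growth by metis
  then have "growth \<le> ereal (\<epsilon> * t)"
    by (intro growth_le[OF c])
  then have "\<bar>growth\<bar> \<noteq> \<infinity>"
    using growth_nonneg by auto
  then show ?thesis
    by (simp add: \<alpha>_def volume_growth_def ereal_real')
qed

text \<open>Points of an \<open>l ^ k\<close>-separated set of directions select distinct orbit
  points at distance at most \<open>k * \<tau>\<close> plus a constant, so branching in the boundary
  forces orbit growth.\<close>

lemma growth_ge:
  assumes "conformal_space M D \<Gamma> boundary_action ginv (\<lambda>g \<xi>. V \<xi> (g p)) w c"
    and l: "0 < l" "l < 1" and N: "1 \<le> N"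
    and S: "\<And>k. \<exists>S. Metric_space.separated M D (l ^ k) S \<and> N ^ k \<le> card S"
  shows "real N \<le> l powr - (\<alpha> / \<epsilon>)"
proof -
  interpret C: conformal_space M D \<Gamma> boundary_action ginv "\<lambda>g \<xi>. V \<xi> (g p)" w c
    by (rule assms(1))
  define \<tau> where "\<tau> = - ln l / \<epsilon>"
  have \<tau>: "0 < \<tau>"
    using l eps_pos by (simp add: \<tau>_def divide_neg_pos)
  \<comment> \<open>The logarithm absorbs the constants of \<open>ray\<close>; the added 1 places
    the orbit points strictly inside an open ball.\<close>
  define R where "R = ln (2 * c\<^sup>2) / \<epsilon> + 1"
  have c1: "1 \<le> c\<^sup>2"
    using C.c_ge_1 by (simp add: one_le_power)
  then have R: "0 < R"
    using eps_pos by (simp add: R_def add_nonneg_pos)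
  define T where "T k = real k * \<tau> + R" for k :: nat
  have T: "0 < T k" for k
    using \<tau> R by (simp add: T_def add_nonneg_pos)
  have count: "N ^ k \<le> card (orbit_ball (T k))" for k
  proof -
    obtain S where S: "C.separated (l ^ k) S" "N ^ k \<le> card S"
      using S by blast
    have SM: "S \<subseteq> M"
      using S(1) by (simp add: C.separated_def)
    \<comment> \<open>Two directions sharing an orbit point would be within
      \<open>2 * c * \<rho> = l ^ k\<close>, contradicting strict separation.\<close>
    define \<rho> where "\<rho> = l ^ k / (2 * c)"
    have lk: "0 < l ^ k" "l ^ k \<le> 1"
      using l by (auto intro: power_le_one)
    then have \<rho>: "0 < \<rho>" "\<rho> \<le> 1"
      using C.c_ge_1 by (auto simp: \<rho>_def divide_le_eq)
    have "\<forall>\<xi>\<in>S. \<exists>g\<in>\<Gamma>. \<rho> / c \<le> w g \<and> V \<xi> (g p) \<le> c * \<rho>"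
      using C.ray[OF _ \<rho>] SM by blast
    then obtain h where h: "\<And>\<xi>. \<xi> \<in> S \<Longrightarrow> h \<xi> \<in> \<Gamma> \<and> \<rho> / c \<le> w (h \<xi>) \<and> V \<xi> (h \<xi> p) \<le> c * \<rho>"
      by metis
    have "inj_on (\<lambda>\<xi>. h \<xi> p) S"
    proof (rule inj_onI, rule ccontr)
      fix \<xi> \<eta>
      assume *: "\<xi> \<in> S" "\<eta> \<in> S" "h \<xi> p = h \<eta> p" "\<xi> \<noteq> \<eta>"
      have "D \<xi> \<eta> \<le> V \<xi> (h \<xi> p) + V \<eta> (h \<xi> p)"
        using * SM by (intro D_le_V) auto
      also have "\<dots> \<le> c * \<rho> + c * \<rho>"
        using h[OF *(1)] h[OF *(2)] *(3) by (intro add_mono) auto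
      also have "\<dots> = l ^ k"
        using C.c_ge_1 by (simp add: \<rho>_def)
      finally show False
        using C.separatedD[OF S(1) *(1,2,4)] by simp
    qed
    moreover have "(\<lambda>\<xi>. h \<xi> p) ` S \<subseteq> orbit_ball (T k)"
    proof safe
      fix \<xi>
      assume \<xi>: "\<xi> \<in> S"
      have "ln (\<rho> / c) \<le> ln (w (h \<xi>))"
        using h[OF \<xi>] \<rho>(1) C.c_ge_1 by (subst ln_le_cancel_iff) auto
      moreover have "\<rho> / c = l ^ k / (2 * c\<^sup>2)"
        by (simp add: \<rho>_def power2_eq_square)
      ultimately have "ln (l ^ k / (2 * c\<^sup>2)) \<le> - \<epsilon> * dist p (h \<xi> p)"
        by (simp add: w_def)
      moreover have "ln (l ^ k / (2 * c\<^sup>2)) = real k * ln l - ln (2 * c\<^sup>2)"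
        using l C.c_ge_1 by (simp add: ln_div ln_realpow)
      ultimately have "\<epsilon> * dist p (h \<xi> p) \<le> - real k * ln l + ln (2 * c\<^sup>2)"
        by simp
      then have "dist p (h \<xi> p) \<le> (- real k * ln l + ln (2 * c\<^sup>2)) / \<epsilon>"
        using eps_pos by (simp add: field_simps)
      also have "\<dots> = T k - 1"
        using eps_pos by (simp add: T_def \<tau>_def R_def field_simps)
      finally show "h \<xi> p \<in> orbit_ball (T k)"
        using h[OF \<xi>] by (auto simp: orbit_ball_def orbit_of_def)
    qed
    ultimately have "card S \<le> card (orbit_ball (T k))"
      by (rule card_inj_on_le[OF _ _ finite_orbit_ball])
    then show ?thesis
      using S(2) by linarith
  qed
  have low: "real k * ln N / T k \<le> ln (real (card (orbit_ball (T k)))) / T k" for k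
  proof -
    have "real (N ^ k) \<le> real (card (orbit_ball (T k)))"
      using count[of k] by (simp only: of_nat_le_iff)
    then have "ln (real (N ^ k)) \<le> ln (real (card (orbit_ball (T k))))"
      using N by (intro ln_mono) auto
    then show ?thesis
      using T[of k] N by (simp add: ln_realpow divide_right_mono)
  qed
  \<comment> \<open>The upper limit bounds the quotients along the radii \<open>T k\<close> from
    above, and their lower estimates in \<open>low\<close> tend to
    \<open>ln N / \<tau>\<close>.\<close>
  have "ln N / \<tau> \<le> \<alpha>"
  proof (rule field_le_epsilon)
    fix e :: real
    assume "0 < e"
    then have "growth < ereal (\<alpha> + e)"
      by (simp add: growth_eq)
    then have "\<forall>\<^sub>F T in at_top. ereal (ln (real (card (orbit_of \<Gamma> p \<inter> ball p T))) / T) < ereal (\<alpha> + e)"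
      by (rule Limsup_lessD)
    moreover have "filterlim T at_top sequentially"
      unfolding T_def using \<tau> by real_asymp
    ultimately have "\<forall>\<^sub>F k in sequentially. ln (real (card (orbit_ball (T k)))) / T k < \<alpha> + e"
      unfolding orbit_ball_def by (auto dest: eventually_compose_filterlim)
    then have "\<forall>\<^sub>F k in sequentially. real k * ln N / T k \<le> \<alpha> + e"
      by eventually_elim (use low in \<open>meson less_imp_le order_trans\<close>)
    moreover have "(\<lambda>k. real k * ln N / T k) \<longlonglongrightarrow> ln N / \<tau>"
      unfolding T_def divide_inverse[of "ln N" \<tau>] using \<tau> by real_asymp
    ultimately show "ln N / \<tau> \<le> \<alpha> + e"
      by (intro tendsto_upperbound[of _ _ sequentially]) auto
  qed
  then have "ln N \<le> \<alpha> * \<tau>"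
    using \<tau> by (simp add: pos_divide_le_eq)
  also have "\<dots> = - (\<alpha> / \<epsilon>) * ln l"
    by (simp add: \<tau>_def)
  finally have "ln N \<le> - (\<alpha> / \<epsilon>) * ln l" .
  then have "exp (ln (real N)) \<le> exp (- (\<alpha> / \<epsilon>) * ln l)"
    by simp
  then show ?thesis
    using N l by (simp add: powr_def)
qed

text \<open>The dimension is \<open>\<alpha> / \<epsilon>\<close> and
  \<open>- ln (w \<gamma>)\<close> is \<open>\<epsilon>\<close> times the length of
  \<open>\<gamma>\<close>, so \<open>\<epsilon>\<close> cancels and only \<open>\<alpha>\<close>
  remains in the profile.\<close>

lemma spherical_function_bounds:
  "\<exists>C>0. \<forall>s\<in>{0..1}. \<forall>\<gamma>\<in>\<Gamma>. inverse C * omega_profile \<alpha> s (dist p (\<gamma> p)) \<le> spherical_function \<epsilon> \<Gamma> p s \<gamma> \<and>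
    spherical_function \<epsilon> \<Gamma> p s \<gamma> \<le> C * omega_profile \<alpha> s (dist p (\<gamma> p))"
proof -
  obtain c where c: "conformal_space M D \<Gamma> boundary_action ginv (\<lambda>g \<xi>. V \<xi> (g p)) w c"
    by (rule conformal_space_boundary)
  have "conformal_growth M D \<Gamma> boundary_action ginv (\<lambda>g \<xi>. V \<xi> (g p)) w c (\<alpha> / \<epsilon>)"
  proof (rule conformal_growth.intro[OF c], unfold_locales)
    fix t K :: real
    assume "0 \<le> t" "\<And>r S. 0 < r \<Longrightarrow> r \<le> 1 \<Longrightarrow> Metric_space.separated M D r S \<Longrightarrow> real (card S) \<le> K * r powr - t"
    then have "growth \<le> ereal (\<epsilon> * t)"
      by (rule growth_le[OF c])
    then show "\<alpha> / \<epsilon> \<le> t"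
      using eps_pos by (simp add: growth_eq field_simps)
  next
    fix l :: real and N :: nat
    assume "0 < l" "l < 1" "1 \<le> N" "\<And>k. \<exists>S. Metric_space.separated M D (l ^ k) S \<and> N ^ k \<le> card S"
    then show "real N \<le> l powr - (\<alpha> / \<epsilon>)"
      by (rule growth_ge[OF c])
  qed
  then interpret C: conformal_growth M D \<Gamma> boundary_action ginv "\<lambda>g \<xi>. V \<xi> (g p)" w c "\<alpha> / \<epsilon>" .
  have \<alpha>_pos: "0 < \<alpha>"
    using C.s_pos eps_pos by (simp add: zero_less_divide_iff)
  obtain B where B: "1 \<le> B" "\<forall>g\<in>\<Gamma>. \<forall>\<sigma>\<in>{0..1}. C.sph g \<sigma> \<in> {C.bound g \<sigma> / B .. B * C.bound g \<sigma>}"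
    using C.spherical_bounds by blast
  obtain A where A: "0 < A"
    "\<And>\<sigma> t. 0 \<le> \<sigma> \<Longrightarrow> \<sigma> \<le> 1 \<Longrightarrow> 0 \<le> t \<Longrightarrow>
      omega_profile \<alpha> \<sigma> t \<le> A * (exp (- \<sigma> * (\<alpha> * t)) * (1 + tail_integral \<sigma> (\<alpha> * t))) \<and>
      exp (- \<sigma> * (\<alpha> * t)) * (1 + tail_integral \<sigma> (\<alpha> * t)) \<le> A * omega_profile \<alpha> \<sigma> t"
    using tail_integral_omega[OF \<alpha>_pos] by metis
  have "inverse (A * B) * omega_profile \<alpha> s (dist p (\<gamma> p)) \<le> spherical_function \<epsilon> \<Gamma> p s \<gamma> \<and>
      spherical_function \<epsilon> \<Gamma> p s \<gamma> \<le> (A * B) * omega_profile \<alpha> s (dist p (\<gamma> p))"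
    if s: "s \<in> {0..1}" and \<gamma>: "\<gamma> \<in> \<Gamma>" for s \<gamma>
  proof -
    define t where "t = dist p (\<gamma> p)"
    define X where "X = exp (- s * (\<alpha> * t)) * (1 + tail_integral s (\<alpha> * t))"
    define Y where "Y = omega_profile \<alpha> s t"
    define \<Phi> where "\<Phi> = spherical_function \<epsilon> \<Gamma> p s \<gamma>"
    have \<Phi>: "\<Phi> = C.sph \<gamma> s"
      unfolding C.sph_def \<Phi>_def spherical_function_def patterson_sullivan_def Let_def C.\<nu>_def \<alpha>_def[symmetric] ..
    have "w \<gamma> powr (\<alpha> / \<epsilon> * s) = exp (- s * (\<alpha> * t))" "\<alpha> / \<epsilon> * - ln (w \<gamma>) = \<alpha> * t"
      using eps_pos by (auto simp: w_def t_def exp_powr_real)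
    then have 1: "X / B \<le> \<Phi>" "\<Phi> \<le> B * X"
      using B(2)[rule_format, OF \<gamma> s] unfolding \<Phi> X_def C.bound_def by auto
    have 2: "Y \<le> A * X" "X \<le> A * Y"
      using A(2)[of s t] s unfolding X_def Y_def by (auto simp: t_def)
    have "Y / (A * B) \<le> X / B"
      using 2(1) A(1) B(1) by (simp add: field_simps)
    then have 3: "inverse (A * B) * Y \<le> \<Phi>"
      using 1(1) by (simp add: divide_inverse mult.commute)
    have "B * X \<le> B * (A * Y)"
      using 2(2) B(1) by (intro mult_left_mono) auto
    then have 4: "\<Phi> \<le> (A * B) * Y"
      using 1(2) by (simp add: mult_ac)
    show ?thesis
      using 3 4 unfolding Y_def t_def \<Phi>_def by (simp only: mult.assoc)
  qed
  then show ?thesis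
    using A(1) B(1) by (intro exI[of _ "A * B"]) auto
qed

end

theorem proposition1p1:
  fixes p :: "'a::metric_space" and \<Gamma> :: "('a \<Rightarrow> 'a) set" and \<epsilon> :: real
  assumes "proper_metric TYPE('a)"
    and "roughly_geodesic TYPE('a)"
    and "strongly_hyperbolic TYPE('a) \<epsilon>"
    and "isometry_group \<Gamma>"
    and "properly_discontinuous \<Gamma>"
    and "cocompact \<Gamma>"
    and "non_elementary \<Gamma> p"
  defines "\<alpha> \<equiv> volume_growth \<Gamma> p"
  shows "\<exists>C>0. \<forall>s\<in>{0..1}. \<forall>\<gamma>\<in>\<Gamma>.
           inverse C * (omega \<alpha> \<bar>s - 1/2\<bar> (dist p (\<gamma> p)) + 1) * exp (- (1/2) * \<alpha> * dist p (\<gamma> p))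
             \<le> spherical_function \<epsilon> \<Gamma> p s \<gamma> \<and>
           spherical_function \<epsilon> \<Gamma> p s \<gamma>
             \<le> C * (omega \<alpha> \<bar>s - 1/2\<bar> (dist p (\<gamma> p)) + 1) * exp (- (1/2) * \<alpha> * dist p (\<gamma> p))"
proof -
  interpret nonelementary_hyperbolic_group p \<epsilon> \<Gamma>
    using assms(1-7) by unfold_locales (auto simp: strongly_hyperbolic_def visual_kernel_def)
  show ?thesis
    using spherical_function_bounds unfolding assms(8) \<alpha>_def omega_profile_def mult.assoc .
qed

end
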